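(* Let $K$ be a field of characteristic zero. The basis elements $p_M$ for the space $P(H)$ of primitive elements of the matroid-minor Hopf algebra $H$ are given by $$p_M=\sum_{N\in\mathcal R_M}\mu_{\mathcal R}(M,N)\,e_N,$$ for all irreducible matroids $M\in\mathcal W$.
   Context: Fix an infinite set and let $\mathcal U$ be the set of its finite subsets. $M(S)$ means that $M$ is a matroid with ground set $S$. $\mathcal W$ is the set of all (labeled) matroids $M(S)$ with $S\in\mathcal U$. $M|A$ and $M/A$ denote restriction to $A$ and contraction by $A$ (a matroid on $S\setminus A$); $\rho(M)$ is the rank of $M$. Free product: for matroids $M(S)$, $N(T)$ on disjoint sets, $M\mathbin{\Box}N$ is the matroid on $S\cup T$ whose bases are the sets $B\subseteq S\cup T$ with $|B|=\rho(M)+\rho(N)$ such that $B\cap S$ is independent in $M$ and $B\cap T$ spans $N$; this operation is associative. A matroid is irreducible if it is nonempty (has nonempty ground set) and is not a free product of two nonempty matroids; otherwise it is reducible. $\mathcal R$ is the set of reducible matroids in $\mathcal W$. Weak order on $\mathcal W$: $M\le N$ means that $M$ and $N$ have the same ground set and every basis of $M$ is a basis of $N$. For $M\in\mathcal W$, $\mathcal R_M=\{N\in\mathcal R: N\ge M\}\cup\{M\}$ with the induced order, and $\mu_{\mathcal R}(M,N)$, for $N\in\mathcal R_M$, is the value at $(M,N)$ of the Möbius function of the poset $\mathcal R_M$ (given by $\mu(x,x)=1$, $\mu(x,z)=-\sum_{x\le y<z}\mu(x,y)$ for $x<z$). $e_M$ is the isomorphism class of $M$, and $\mathcal M=\{e_M: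 M\in\mathcal W\}$. The matroid-minor Hopf algebra $H$ is the $K$-vector space with basis $\mathcal M$, product $e_Me_N=e_{M\oplus N}$, coproduct $\delta_H(e_M)=\sum_{A\subseteq S}e_{M|A}\otimes e_{M/A}$, and counit $\epsilon(e_M)=1$ if $S=\emptyset$, $0$ otherwise, for $M=M(S)$. $P(H)=\{x\in H:\delta_H(x)=1\otimes x+x\otimes1\}$, where $1$ is the class of the empty matroid. For a matroid $M(S)$ and $A\subseteq B\subseteq S$, let $M(A,B)=(M|B)/A$. An $M$-irreducible chain is a sequence $D=(S_0,\dots,S_k)$ with $\emptyset=S_0\subsetneq S_1\subsetneq\cdots\subsetneq S_k=S$ such that each minor $M(S_{i-1},S_i)$ is irreducible; $\mathrm{IC}(M)$ is the set of these, and $M(D)=M(S_0,S_1)\mathbin{\Box}\cdots\mathbin{\Box}M(S_{k-1},S_k)$ (for $S=\emptyset$, $\mathrm{IC}(M)$ consists of the single chain $(\emptyset)$ and $M(D)$ is the empty matroid). Let $\varphi$ be the linear endomorphism of the vector space with basis $\mathcal M$ given by $\varphi(e_M)=\sum_{D\in\mathrm{IC}(M)}e_{M(D)}$. In characteristic zero $\varphi$ is known to be bijective; set $p_M=\varphi^{-1}(e_M)\in H$. It is known that $p_M$ depends only on $e_M$ and that the $p_M$, over isomorphism classes of irreducible $M$, form a basis for $P(H)$. *)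

theory Defs
  imports Complex_Main "HOL-Library.Poly_Mapping" "HOL-Library.Infinite_Typeclass"
begin

section \<open>Finite labeled matroids\<close>

definition is_matroid :: "'a set \<Rightarrow> 'a set set \<Rightarrow> bool" where
  "is_matroid S \<I> \<longleftrightarrow> finite S \<and> \<I> \<subseteq> Pow S \<and> {} \<in> \<I>
     \<and> (\<forall>X\<in>\<I>. \<forall>Y\<subseteq>X. Y \<in> \<I>)
     \<and> (\<forall>X\<in>\<I>. \<forall>Y\<in>\<I>. card X < card Y \<longrightarrow> (\<exists>y\<in>Y - X. insert y X \<in> \<I>))"

typedef 'a matroid = "{(S :: 'a set, \<I>). is_matroid S \<I>}"
  by (rule exI[of _ "({}, {{}})"]) (auto simp: is_matroid_def)

definition ground :: "'a matroid \<Rightarrow> 'a set" where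
  "ground M = fst (Rep_matroid M)"

definition indep :: "'a matroid \<Rightarrow> 'a set \<Rightarrow> bool" where
  "indep M X \<longleftrightarrow> X \<in> snd (Rep_matroid M)"

lemma is_matroid_Rep: "is_matroid (ground M) {X. indep M X}"
  using Rep_matroid[of M] by (auto simp: ground_def indep_def)

lemma ground_Abs: "is_matroid S \<I> \<Longrightarrow> ground (Abs_matroid (S, \<I>)) = S"
  by (simp add: ground_def Abs_matroid_inverse)

lemma indep_Abs: "is_matroid S \<I> \<Longrightarrow> indep (Abs_matroid (S, \<I>)) X \<longleftrightarrow> X \<in> \<I>"
  by (simp add: indep_def Abs_matroid_inverse)

lemma matroid_eqI:
  assumes "ground M = ground N" "\<And>X. indep M X \<longleftrightarrow> indep N X"
  shows "M = N"
proof -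
  have "Rep_matroid M = Rep_matroid N"
    using assms by (intro prod_eqI) (auto simp: ground_def indep_def)
  then show ?thesis by (simp add: Rep_matroid_inject)
qed

lemma finite_ground [simp]: "finite (ground M)"
  using is_matroid_Rep[of M] by (simp add: is_matroid_def)

lemma indep_empty [simp]: "indep M {}"
  using is_matroid_Rep[of M] by (simp add: is_matroid_def)

lemma indep_ground: "indep M X \<Longrightarrow> X \<subseteq> ground M"
  using is_matroid_Rep[of M] by (auto simp: is_matroid_def)

lemma indep_finite: "indep M X \<Longrightarrow> finite X"
  using indep_ground finite_ground finite_subset by blast

lemma indep_subset: "indep M X \<Longrightarrow> Y \<subseteq> X \<Longrightarrow> indep M Y"
  using is_matroid_Rep[of M] by (auto simp: is_matroid_def)

lemma indep_augment:
  "indep M X \<Longrightarrow> indep M Y \<Longrightarrow> card X < card Y \<Longrightarrow> \<exists>y\<in>Y - X. indep M (insert y X)"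
  using is_matroid_Rep[of M] by (auto simp: is_matroid_def)

definition basis :: "'a matroid \<Rightarrow> 'a set \<Rightarrow> bool" where
  "basis M B \<longleftrightarrow> indep M B \<and> (\<forall>X. indep M X \<longrightarrow> B \<subseteq> X \<longrightarrow> X = B)"

definition rank :: "'a matroid \<Rightarrow> nat" where
  "rank M = Max (card ` {X. indep M X})"

lemma basis_indep: "basis M B \<Longrightarrow> indep M B"
  unfolding basis_def by (rule conjunct1)

lemma basis_ground: "basis M B \<Longrightarrow> B \<subseteq> ground M"
  using basis_indep indep_ground by metis

definition spans :: "'a matroid \<Rightarrow> 'a set \<Rightarrow> bool" where
  "spans M X \<longleftrightarrow> X \<subseteq> ground M \<and> (\<exists>B\<subseteq>X. basis M B)"

lemma finite_indeps [simp]: "finite {X. indep M X}"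
  by (rule finite_subset[of _ "Pow (ground M)"]) (auto dest: indep_ground)

lemma indep_card_le: "indep M X \<Longrightarrow> card X \<le> rank M"
  unfolding rank_def by (intro Max_ge) auto

lemma ex_indep_rank: "\<exists>X. indep M X \<and> card X = rank M"
proof -
  have "rank M \<in> card ` {X. indep M X}"
    unfolding rank_def by (intro Max_in) (auto intro: indep_empty)
  then show ?thesis by auto
qed

lemma basis_iff: "basis M B \<longleftrightarrow> indep M B \<and> card B = rank M"
proof
  assume B: "basis M B"
  obtain X where X: "indep M X" "card X = rank M" using ex_indep_rank by metis
  have "\<not> card B < card X"
    using B X(1) indep_augment[of M B X] unfolding basis_def by blast
  then show "indep M B \<and> card B = rank M"
    using B X indep_card_le[of M B] by (auto simp: basis_def)
next
  assume B: "indep M B \<and> card B = rank M"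
  then have "X = B" if "indep M X" "B \<subseteq> X" for X
    using that indep_card_le[of M X] card_seteq[of X B] indep_finite[of M X] by auto
  then show "basis M B" using B by (auto simp: basis_def)
qed

lemma extend_basis: "indep M X \<Longrightarrow> \<exists>B. basis M B \<and> X \<subseteq> B"
proof (induction "rank M - card X" arbitrary: X rule: less_induct)
  case less
  show ?case
  proof (cases "card X = rank M")
    case True
    then show ?thesis using less.prems basis_iff by blast
  next
    case False
    then have lt: "card X < rank M" using indep_card_le[OF less.prems] by simp
    obtain Y where Y: "indep M Y" "card Y = rank M" using ex_indep_rank by metis
    obtain y where y: "y \<in> Y - X" "indep M (insert y X)"
      using indep_augment[OF less.prems Y(1)] lt unfolding Y(2) by blast
    have "card (insert y X) = Suc (card X)"
      using y indep_finite[OF less.prems] by simp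
    then have "rank M - card (insert y X) < rank M - card X" using lt by simp
    from less.hyps[OF this y(2)] show ?thesis by blast
  qed
qed

lemma indep_iff_basis: "indep M X \<longleftrightarrow> (\<exists>B. basis M B \<and> X \<subseteq> B)"
  using extend_basis[of M X] indep_subset[of M _ X] unfolding basis_def by blast

lemma ex_basis: "\<exists>B. basis M B"
  using extend_basis[OF indep_empty[of M]] by blast


section \<open>Minors\<close>

definition mrestrict :: "'a matroid \<Rightarrow> 'a set \<Rightarrow> 'a matroid" where
  "mrestrict M A = Abs_matroid (A \<inter> ground M, {X. X \<subseteq> A \<and> indep M X})"

definition mcontract :: "'a matroid \<Rightarrow> 'a set \<Rightarrow> 'a matroid" where
  "mcontract M A = Abs_matroid (ground M - A,
     {X. X \<subseteq> ground M - A \<and> (\<exists>B. basis (mrestrict M A) B \<and> indep M (X \<union> B))})"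

definition mminor :: "'a matroid \<Rightarrow> 'a set \<Rightarrow> 'a set \<Rightarrow> 'a matroid" where
  "mminor M A B = mcontract (mrestrict M B) A"

lemma is_matroid_restrict: "is_matroid (A \<inter> ground M) {X. X \<subseteq> A \<and> indep M X}"
  unfolding is_matroid_def
proof (intro conjI ballI allI impI)
  show "\<exists>y\<in>Y - X. insert y X \<in> {X. X \<subseteq> A \<and> indep M X}"
    if "X \<in> {X. X \<subseteq> A \<and> indep M X}" "Y \<in> {X. X \<subseteq> A \<and> indep M X}" "card X < card Y" for X Y
    using that indep_augment[of M X Y] by blast
  show "Y \<in> {X. X \<subseteq> A \<and> indep M X}" if "X \<in> {X. X \<subseteq> A \<and> indep M X}" "Y \<subseteq> X" for X Y
    using that indep_subset[of M X Y] by blast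
qed (auto dest: indep_ground)

lemma ground_restrict [simp]: "ground (mrestrict M A) = A \<inter> ground M"
  unfolding mrestrict_def by (rule ground_Abs[OF is_matroid_restrict])

lemma indep_restrict [simp]: "indep (mrestrict M A) X \<longleftrightarrow> X \<subseteq> A \<and> indep M X"
  unfolding mrestrict_def by (simp add: indep_Abs[OF is_matroid_restrict])

lemma basis_restrict_insert:
  assumes "basis (mrestrict M A) B" "z \<in> A" "indep M (insert z B)"
  shows "z \<in> B"
proof -
  have "indep (mrestrict M A) (insert z B)"
    using assms by (auto simp: basis_def)
  then have "insert z B = B" using assms(1) unfolding basis_def by blast
  then show ?thesis by blast
qed

lemma is_matroid_contract:
  "is_matroid (ground M - A)
     {X. X \<subseteq> ground M - A \<and> (\<exists>B. basis (mrestrict M A) B \<and> indep M (X \<union> B))}"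
proof -
  let ?I = "{X. X \<subseteq> ground M - A \<and> (\<exists>B. basis (mrestrict M A) B \<and> indep M (X \<union> B))}"
  have sub: "Y \<in> ?I" if X: "X \<in> ?I" and YX: "Y \<subseteq> X" for X Y
  proof -
    obtain B where B: "basis (mrestrict M A) B" "indep M (X \<union> B)" using X by auto
    have "indep M (Y \<union> B)" using B(2) by (rule indep_subset) (use YX in blast)
    then show ?thesis using X YX B(1) by blast
  qed
  have empty: "{} \<in> ?I"
  proof -
    obtain B where B: "basis (mrestrict M A) B" using ex_basis by metis
    then have "indep M ({} \<union> B)" using basis_indep[OF B] by simp
    then show ?thesis using B by blast
  qed
  have aug: "\<exists>y\<in>Y - X. insert y X \<in> ?I" if X: "X \<in> ?I" and Y: "Y \<in> ?I" and lt: "card X < card Y" for X Y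
  proof -
    obtain B where B: "basis (mrestrict M A) B" "indep M (X \<union> B)" using X by auto
    obtain C where C: "basis (mrestrict M A) C" "indep M (Y \<union> C)" using Y by auto
    have BA: "B \<subseteq> A" "C \<subseteq> A" using B C by (auto simp: basis_def)
    have "card (X \<union> B) = card X + card B" "card (Y \<union> C) = card Y + card C"
      using BA X Y B(2) C(2) indep_finite by (auto intro!: card_Un_disjoint)
    moreover have "card B = card C" using B(1) C(1) by (simp add: basis_iff)
    ultimately have "card (X \<union> B) < card (Y \<union> C)" using lt by simp
    then obtain z where z: "z \<in> (Y \<union> C) - (X \<union> B)" "indep M (insert z (X \<union> B))"
      using indep_augment[OF B(2) C(2)] by blast
    have "z \<notin> A"
    proof
      assume "z \<in> A"
      moreover have "indep M (insert z B)" using z(2) by (rule indep_subset) blast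
      ultimately show False using basis_restrict_insert[OF B(1)] z(1) by blast
    qed
    then have "z \<in> Y - X" using z BA by blast
    moreover have "insert z X \<in> ?I"
    proof -
      have "indep M (insert z X \<union> B)" using z(2) by simp
      moreover have "insert z X \<subseteq> ground M - A" using X Y \<open>z \<in> Y - X\<close> by blast
      ultimately show ?thesis using B(1) by blast
    qed
    ultimately show ?thesis by blast
  qed
  show ?thesis
    unfolding is_matroid_def
  proof (intro conjI ballI allI impI)
    show "Y \<in> ?I" if "X \<in> ?I" "Y \<subseteq> X" for X Y using sub[OF that] .
    show "\<exists>y\<in>Y - X. insert y X \<in> ?I" if "X \<in> ?I" "Y \<in> ?I" "card X < card Y" for X Y
      using aug[OF that] .
    show "{} \<in> ?I" using empty .
  qed auto
qed

lemma ground_contract [simp]: "ground (mcontract M A) = ground M - A"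
  unfolding mcontract_def by (rule ground_Abs[OF is_matroid_contract])

lemma indep_contract:
  "indep (mcontract M A) X \<longleftrightarrow>
     X \<subseteq> ground M - A \<and> (\<exists>B. basis (mrestrict M A) B \<and> indep M (X \<union> B))"
  unfolding mcontract_def by (simp add: indep_Abs[OF is_matroid_contract])

lemma ground_minor [simp]: "ground (mminor M A B) = B \<inter> ground M - A"
  by (simp add: mminor_def)


section \<open>Free product and irreducibility\<close>

text \<open>Meaningful for disjoint ground sets only; the independent sets are the subsets of the
  prescribed bases (see \<open>basis_free_product\<close> below).\<close>

definition free_product :: "'a matroid \<Rightarrow> 'a matroid \<Rightarrow> 'a matroid" (infixr \<open>\<box>\<close> 70) where
  "M \<box> N = Abs_matroid (ground M \<union> ground N,
     {X. \<exists>B. X \<subseteq> B \<and> B \<subseteq> ground M \<union> ground N \<and> card B = rank M + rank N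
           \<and> indep M (B \<inter> ground M) \<and> spans N (B \<inter> ground N)})"

definition empty_matroid :: "'a matroid" where
  "empty_matroid = Abs_matroid ({}, {{}})"

definition irreducible_matroid :: "'a matroid \<Rightarrow> bool" where
  "irreducible_matroid M \<longleftrightarrow> ground M \<noteq> {} \<and>
     \<not> (\<exists>P Q. ground P \<noteq> {} \<and> ground Q \<noteq> {} \<and> ground P \<inter> ground Q = {} \<and> M = P \<box> Q)"

definition reducible_matroid :: "'a matroid \<Rightarrow> bool" where
  "reducible_matroid M \<longleftrightarrow> \<not> irreducible_matroid M"

lemma rank_restrict_mono:
  assumes "A \<subseteq> B"
  shows "rank (mrestrict N A) \<le> rank (mrestrict N B)"
proof -
  obtain I where "indep (mrestrict N A) I" "card I = rank (mrestrict N A)"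
    using ex_indep_rank by metis
  then show ?thesis using assms indep_card_le[of "mrestrict N B" I] by auto
qed

lemma rank_restrict_le_rank: "rank (mrestrict N A) \<le> rank N"
proof -
  obtain I where "indep (mrestrict N A) I" "card I = rank (mrestrict N A)"
    using ex_indep_rank by metis
  then show ?thesis using indep_card_le[of N I] by simp
qed

lemma rank_restrict_le:
  assumes "B \<subseteq> A" "finite A"
  shows "rank (mrestrict N A) \<le> rank (mrestrict N B) + card (A - B)"
proof -
  obtain I where I: "indep (mrestrict N A) I" "card I = rank (mrestrict N A)"
    using ex_indep_rank by metis
  have "finite I" using I(1) indep_finite by blast
  have "card I = card (I \<inter> B) + card (I - B)"
    using \<open>finite I\<close> by (metis card_Diff_subset_Int card_Int_Diff finite_Int)
  moreover have "card (I \<inter> B) \<le> rank (mrestrict N B)"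
    using I(1) indep_subset[of N I "I \<inter> B"] by (intro indep_card_le) auto
  moreover have "card (I - B) \<le> card (A - B)"
    using I(1) assms by (intro card_mono) auto
  ultimately show ?thesis using I(2) by simp
qed

lemma rank_restrict_closure:
  assumes "\<And>y. y \<in> C \<Longrightarrow> rank (mrestrict N (insert y A)) = rank (mrestrict N A)"
  shows "rank (mrestrict N (A \<union> C)) = rank (mrestrict N A)"
proof -
  obtain I where I: "basis (mrestrict N A) I" using ex_basis by metis
  have fI: "finite I" using I indep_finite by (auto simp: basis_def)
  have no: "z \<in> I" if z: "z \<in> A \<union> C" "indep N (insert z I)" for z
  proof (rule ccontr)
    assume zI: "z \<notin> I"
    show False
    proof (cases "z \<in> A")
      case True
      then show False using basis_restrict_insert[OF I] z zI by blast
    next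
      case False
      then have zC: "z \<in> C" using z by blast
      have "indep (mrestrict N (insert z A)) (insert z I)"
        using I z by (auto simp: basis_def)
      from indep_card_le[OF this] show False
        using assms[OF zC] I zI fI by (auto simp: basis_iff)
    qed
  qed
  have "basis (mrestrict N (A \<union> C)) I"
    unfolding basis_def
  proof (intro conjI allI impI)
    show "indep (mrestrict N (A \<union> C)) I" using I by (auto simp: basis_def)
  next
    fix X assume X: "indep (mrestrict N (A \<union> C)) X" "I \<subseteq> X"
    have "z \<in> I" if "z \<in> X" for z
      using no[of z] X that indep_subset[of N X "insert z I"] by auto
    then show "X = I" using X by blast
  qed
  then show ?thesis using I by (simp add: basis_iff)
qed

lemma spans_iff_rank: "spans N X \<longleftrightarrow> X \<subseteq> ground N \<and> rank (mrestrict N X) = rank N"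
proof
  assume "spans N X"
  then obtain B where B: "X \<subseteq> ground N" "B \<subseteq> X" "basis N B" by (auto simp: spans_def)
  have "rank N \<le> rank (mrestrict N X)"
    using B indep_card_le[of "mrestrict N X" B] by (auto simp: basis_iff)
  moreover have "rank (mrestrict N X) \<le> rank N"
    by (rule rank_restrict_le_rank)
  ultimately show "X \<subseteq> ground N \<and> rank (mrestrict N X) = rank N" using B by simp
next
  assume X: "X \<subseteq> ground N \<and> rank (mrestrict N X) = rank N"
  obtain B where "basis (mrestrict N X) B" using ex_basis by metis
  then show "spans N X" using X by (auto simp: spans_def basis_iff)
qed

context
  fixes M N :: "'a matroid"
  assumes disj: "ground M \<inter> ground N = {}"
begin

private abbreviation "fp_indep X \<equiv> X \<subseteq> ground M \<union> ground N \<and> indep M (X \<inter> ground M) \<and>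
  card X \<le> rank M + rank (mrestrict N (X \<inter> ground N))"

private lemma fp_subset:
  assumes X: "fp_indep X" and Y: "Y \<subseteq> X"
  shows "fp_indep Y"
proof -
  have fin: "finite X" using X by (meson finite_UnI finite_ground finite_subset)
  have "rank (mrestrict N (X \<inter> ground N))
        \<le> rank (mrestrict N (Y \<inter> ground N)) + card (X \<inter> ground N - Y \<inter> ground N)"
    using fin Y by (intro rank_restrict_le) auto
  also have "card (X \<inter> ground N - Y \<inter> ground N) \<le> card (X - Y)"
    using fin by (intro card_mono) auto
  also have "card (X - Y) = card X - card Y"
    using fin Y by (meson card_Diff_subset finite_subset)
  finally have "card Y \<le> rank M + rank (mrestrict N (Y \<inter> ground N))"
    using X card_mono[OF fin Y] by linarith
  moreover have "indep M (Y \<inter> ground M)"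
    using X Y indep_subset[of M "X \<inter> ground M" "Y \<inter> ground M"] by blast
  ultimately show ?thesis using X Y by blast
qed

private lemma fp_augment:
  assumes X: "fp_indep X" and Y: "fp_indep Y" and lt: "card X < card Y"
  shows "\<exists>y\<in>Y - X. fp_indep (insert y X)"
proof (rule ccontr)
  assume no: "\<not> (\<exists>y\<in>Y - X. fp_indep (insert y X))"
  let ?r = "\<lambda>A. rank (mrestrict N (A \<inter> ground N))"
  have fin: "finite X" "finite Y" using X Y by (meson finite_UnI finite_ground finite_subset)+
  have inT: "fp_indep (insert y X)"
    if "y \<in> Y - X" "y \<in> ground N" "card X < rank M + ?r (insert y X)" for y
  proof -
    have "insert y X \<inter> ground M = X \<inter> ground M" using that disj by auto
    then show ?thesis using that X fin by auto
  qed
  show False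
  proof (cases "card X = rank M + ?r X")
    case tight: True
    have "rank (mrestrict N (insert y (X \<inter> ground N))) = ?r X" if y: "y \<in> Y \<inter> ground N" for y
    proof (cases "y \<in> X")
      case True
      then show ?thesis using y by (simp add: insert_absorb)
    next
      case False
      have eq: "insert y (X \<inter> ground N) = insert y X \<inter> ground N" using y by auto
      have "\<not> card X < rank M + ?r (insert y X)" using inT[of y] no y False by blast
      moreover have "?r X \<le> ?r (insert y X)" by (intro rank_restrict_mono) auto
      ultimately show ?thesis unfolding eq using tight by simp
    qed
    from rank_restrict_closure[OF this]
    have "rank (mrestrict N (X \<inter> ground N \<union> Y \<inter> ground N)) = ?r X" .
    moreover have "?r Y \<le> rank (mrestrict N (X \<inter> ground N \<union> Y \<inter> ground N))"
      by (intro rank_restrict_mono) auto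
    ultimately show False using Y lt tight by simp
  next
    case False
    then have less: "card X < rank M + ?r X" using X by simp
    have sub: "Y \<inter> ground N \<subseteq> X \<inter> ground N"
    proof
      fix y assume y: "y \<in> Y \<inter> ground N"
      have "?r X \<le> ?r (insert y X)" by (intro rank_restrict_mono) auto
      then show "y \<in> X \<inter> ground N" using inT[of y] no y less by force
    qed
    have split: "card Z = card (Z \<inter> ground M) + card (Z \<inter> ground N)"
      if "finite Z" "Z \<subseteq> ground M \<union> ground N" for Z
    proof -
      have "Z = (Z \<inter> ground M) \<union> (Z \<inter> ground N)" using that by blast
      moreover have "card ((Z \<inter> ground M) \<union> (Z \<inter> ground N))
          = card (Z \<inter> ground M) + card (Z \<inter> ground N)"
        using that disj by (intro card_Un_disjoint) auto
      ultimately show ?thesis by simp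
    qed
    have "card X = card (X \<inter> ground M) + card (X \<inter> ground N)"
      "card Y = card (Y \<inter> ground M) + card (Y \<inter> ground N)"
      using split X Y fin by blast+
    moreover have "card (Y \<inter> ground N) \<le> card (X \<inter> ground N)"
      using sub fin by (intro card_mono) auto
    ultimately have "card (X \<inter> ground M) < card (Y \<inter> ground M)" using lt by linarith
    then obtain y where y: "y \<in> Y \<inter> ground M - X \<inter> ground M" "indep M (insert y (X \<inter> ground M))"
      using indep_augment[of M "X \<inter> ground M" "Y \<inter> ground M"] X Y by blast
    have "insert y X \<inter> ground M = insert y (X \<inter> ground M)"
      "insert y X \<inter> ground N = X \<inter> ground N" using y disj by auto
    then have "fp_indep (insert y X)" using y X fin less by auto
    then show False using no y by blast
  qed
qed

private lemma fp_matroid: "is_matroid (ground M \<union> ground N) {X. fp_indep X}"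
  unfolding is_matroid_def
proof (intro conjI ballI allI impI)
  fix X Y assume "X \<in> {X. fp_indep X}" "Y \<subseteq> X"
  then have "fp_indep X" "Y \<subseteq> X" by simp_all
  then have "fp_indep Y" by (rule fp_subset)
  then show "Y \<in> {X. fp_indep X}" by (rule CollectI)
next
  fix X Y assume "X \<in> {X. fp_indep X}" "Y \<in> {X. fp_indep X}" and lt: "card X < card Y"
  then have "fp_indep X" "fp_indep Y" by simp_all
  from fp_augment[OF this lt] show "\<exists>y\<in>Y - X. insert y X \<in> {X. fp_indep X}"
    unfolding mem_Collect_eq .
next
  show "{X. fp_indep X} \<subseteq> Pow (ground M \<union> ground N)" by blast
next
  show "{} \<in> {X. fp_indep X}" by simp
qed simp

private lemma fp_basis_iff:
  "fp_indep B \<and> card B = rank M + rank N \<longleftrightarrow>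
     B \<subseteq> ground M \<union> ground N \<and> card B = rank M + rank N
     \<and> indep M (B \<inter> ground M) \<and> spans N (B \<inter> ground N)"
  using rank_restrict_le_rank[of N "B \<inter> ground N"] by (auto simp: spans_iff_rank)

private lemma fp_rank: "rank (Abs_matroid (ground M \<union> ground N, {X. fp_indep X})) = rank M + rank N"
proof -
  define F where "F = Abs_matroid (ground M \<union> ground N, {X. fp_indep X})"
  have F: "indep F X \<longleftrightarrow> fp_indep X" for X
    unfolding F_def by (simp add: indep_Abs[OF fp_matroid])
  obtain B where B: "basis M B" using ex_basis by metis
  obtain C where C: "basis N C" using ex_basis by metis
  have ind: "indep M B" "indep N C" using B C by (simp_all add: basis_indep)
  have sub: "B \<subseteq> ground M" "C \<subseteq> ground N" using ind by (simp_all add: indep_ground)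
  have int: "(B \<union> C) \<inter> ground M = B" "(B \<union> C) \<inter> ground N = C" using sub disj by blast+
  have "card (B \<union> C) = card B + card C"
    using ind[THEN indep_finite] sub disj by (intro card_Un_disjoint) blast+
  then have card: "card (B \<union> C) = rank M + rank N" using B C by (simp add: basis_iff)
  have "spans N C" using C sub by (auto simp: spans_def)
  then have "B \<union> C \<subseteq> ground M \<union> ground N \<and> card (B \<union> C) = rank M + rank N
     \<and> indep M ((B \<union> C) \<inter> ground M) \<and> spans N ((B \<union> C) \<inter> ground N)"
    unfolding int using ind sub card by blast
  then have "fp_indep (B \<union> C)" using fp_basis_iff by metis
  then have "rank M + rank N \<le> rank F"
    using indep_card_le[of F "B \<union> C"] card F by simp
  moreover have "rank F \<le> rank M + rank N"
  proof -
    obtain X where X: "indep F X" "card X = rank F" using ex_indep_rank by metis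
    then have "card X \<le> rank M + rank (mrestrict N (X \<inter> ground N))" using F by blast
    then show ?thesis using rank_restrict_le_rank[of N "X \<inter> ground N"] X(2) by linarith
  qed
  ultimately show ?thesis unfolding F_def by simp
qed

private lemma fp_eq: "M \<box> N = Abs_matroid (ground M \<union> ground N, {X. fp_indep X})"
proof -
  let ?F = "Abs_matroid (ground M \<union> ground N, {X. fp_indep X})"
  have "(\<exists>B. X \<subseteq> B \<and> B \<subseteq> ground M \<union> ground N \<and> card B = rank M + rank N
           \<and> indep M (B \<inter> ground M) \<and> spans N (B \<inter> ground N)) \<longleftrightarrow> fp_indep X" for X
  proof -
    have F: "indep ?F Y \<longleftrightarrow> fp_indep Y" for Y by (simp add: indep_Abs[OF fp_matroid])
    have bF: "basis ?F Y \<longleftrightarrow> fp_indep Y \<and> card Y = rank M + rank N" for Y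
      unfolding basis_iff fp_rank F by (rule refl)
    have "fp_indep X \<longleftrightarrow> indep ?F X" unfolding F by (rule refl)
    also have "\<dots> \<longleftrightarrow> (\<exists>B. X \<subseteq> B \<and> basis ?F B)"
      unfolding indep_iff_basis by blast
    finally show ?thesis unfolding bF fp_basis_iff by (rule sym)
  qed
  then show ?thesis unfolding free_product_def by presburger
qed

lemma ground_free_product: "ground (M \<box> N) = ground M \<union> ground N"
  unfolding fp_eq by (rule ground_Abs[OF fp_matroid])

lemma rank_free_product: "rank (M \<box> N) = rank M + rank N"
  unfolding fp_eq by (rule fp_rank)

lemma basis_free_product:
  "basis (M \<box> N) B \<longleftrightarrow> B \<subseteq> ground M \<union> ground N \<and> card B = rank M + rank N
     \<and> indep M (B \<inter> ground M) \<and> spans N (B \<inter> ground N)"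
  using fp_basis_iff[of B]
  by (simp add: basis_iff rank_free_product) (simp add: fp_eq indep_Abs[OF fp_matroid])

end

lemma is_matroid_empty: "is_matroid {} {{}}"
  by (auto simp: is_matroid_def)

lemma ground_empty [simp]: "ground empty_matroid = {}"
  unfolding empty_matroid_def by (rule ground_Abs[OF is_matroid_empty])

lemma indep_empty_matroid [simp]: "indep empty_matroid X \<longleftrightarrow> X = {}"
  unfolding empty_matroid_def by (simp add: indep_Abs[OF is_matroid_empty])


section \<open>Weak order and Moebius function\<close>

definition weak_le :: "'a matroid \<Rightarrow> 'a matroid \<Rightarrow> bool" where
  "weak_le M N \<longleftrightarrow> ground M = ground N \<and> (\<forall>B. basis M B \<longrightarrow> basis N B)"

definition reducible_above :: "'a matroid \<Rightarrow> 'a matroid set" where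
  "reducible_above M = {N. reducible_matroid N \<and> weak_le M N} \<union> {M}"

definition reducible_order :: "'a matroid \<Rightarrow> 'a matroid rel" where
  "reducible_order M = {(N, P). N \<in> reducible_above M \<and> P \<in> reducible_above M \<and> weak_le N P}"

text \<open>The Moebius function of a finite poset, given as its order relation \<open>r\<close>; the first test
  only ensures termination.\<close>

function moebius :: "'b rel \<Rightarrow> 'b \<Rightarrow> 'b \<Rightarrow> int" where
  "moebius r x z =
     (if finite r \<and> Partial_order r \<and> (x, z) \<in> r then
        if x = z then 1
        else - (\<Sum>y | (x, y) \<in> r \<and> (y, z) \<in> r \<and> y \<noteq> z. moebius r x y)
      else 0)"
  by auto
termination
proof (relation "measure (\<lambda>(r, x, z). card {w. (w, z) \<in> r})")
  fix r :: "'b rel" and x z y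
  assume r: "finite r \<and> Partial_order r \<and> (x, z) \<in> r"
    and y: "y \<in> {y. (x, y) \<in> r \<and> (y, z) \<in> r \<and> y \<noteq> z}"
  have ord: "refl_on (Field r) r" "trans r" "antisym r"
    using r partial_order_onD[of "Field r" r] by simp_all
  have yz: "(y, z) \<in> r" "y \<noteq> z" using y by simp_all
  have "(z, z) \<in> r" using ord(1) r by (meson FieldI2 refl_onD)
  moreover have "(z, y) \<notin> r" using antisymD[OF ord(3) yz(1)] yz(2) by blast
  moreover have "(w, z) \<in> r" if "(w, y) \<in> r" for w using transD[OF ord(2) that yz(1)] .
  ultimately have "{w. (w, y) \<in> r} \<subset> {w. (w, z) \<in> r}" by blast
  moreover have "{w. (w, z) \<in> r} \<subseteq> fst ` r" by force
  then have "finite {w. (w, z) \<in> r}" using r finite_subset by blast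
  ultimately show "((r, x, y), (r, x, z)) \<in> measure (\<lambda>(r, x, z). card {w. (w, z) \<in> r})"
    by (simp add: psubset_card_mono)
qed simp

declare moebius.simps [simp del]

lemma weak_le_antisym: "weak_le M N \<Longrightarrow> weak_le N M \<Longrightarrow> M = N"
  by (rule matroid_eqI) (simp add: weak_le_def, unfold weak_le_def indep_iff_basis, blast)

lemma finite_matroids_on: "finite {M. ground M = S}"
proof (cases "finite S")
  case True
  have "Rep_matroid M \<in> {S} \<times> Pow (Pow S)" if "ground M = S" for M
  proof -
    have "snd (Rep_matroid M) \<subseteq> Pow S"
      using that indep_ground[of M] by (auto simp: indep_def)
    then show ?thesis using that by (simp add: mem_Times_iff ground_def)
  qed
  then have "Rep_matroid ` {M. ground M = S} \<subseteq> {S} \<times> Pow (Pow S)" by blast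
  then have "finite (Rep_matroid ` {M. ground M = S})"
    by (rule finite_subset) (use True in simp)
  then show ?thesis by (rule finite_imageD) (simp add: inj_on_def Rep_matroid_inject)
next
  case False
  then have "{M. ground M = S} = {}" using finite_ground by blast
  then show ?thesis by simp
qed

lemma finite_reducible_above: "finite (reducible_above M)"
  by (rule finite_subset[OF _ finite_matroids_on[of "ground M"]])
    (auto simp: reducible_above_def weak_le_def)

lemma finite_reducible_order: "finite (reducible_order M)"
  by (rule finite_subset[of _ "reducible_above M \<times> reducible_above M"])
    (auto simp: reducible_order_def finite_reducible_above)

lemma Field_reducible_order: "Field (reducible_order M) = reducible_above M"
  by (auto simp: Field_def reducible_order_def weak_le_def)

lemma Partial_order_reducible_order: "Partial_order (reducible_order M)"
  unfolding partial_order_on_def preorder_on_def Field_reducible_order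
proof (intro conjI)
  show "reducible_order M \<subseteq> reducible_above M \<times> reducible_above M"
    by (auto simp: reducible_order_def)
  show "refl_on (reducible_above M) (reducible_order M)"
    by (rule refl_onI) (simp add: reducible_order_def weak_le_def)
  show "trans (reducible_order M)"
    by (rule transI) (simp add: reducible_order_def weak_le_def)
  show "antisym (reducible_order M)"
    by (rule antisymI) (simp add: reducible_order_def weak_le_antisym)
qed


section \<open>Isomorphism classes\<close>

definition is_iso :: "('a \<Rightarrow> 'a) \<Rightarrow> 'a matroid \<Rightarrow> 'a matroid \<Rightarrow> bool" where
  "is_iso f M N \<longleftrightarrow> bij_betw f (ground M) (ground N)
     \<and> (\<forall>X\<subseteq>ground M. indep M X \<longleftrightarrow> indep N (f ` X))"

definition isomorphic :: "'a matroid \<Rightarrow> 'a matroid \<Rightarrow> bool" where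
  "isomorphic M N \<longleftrightarrow> (\<exists>f. is_iso f M N)"

lemma is_isoD:
  assumes "is_iso f M N"
  shows "bij_betw f (ground M) (ground N)" "inj_on f (ground M)" "f ` ground M = ground N"
    "X \<subseteq> ground M \<Longrightarrow> indep N (f ` X) \<longleftrightarrow> indep M X"
  using assms by (simp_all add: is_iso_def bij_betw_def)

lemma is_iso_refl: "is_iso id M M"
  by (simp add: is_iso_def)

lemma image_inv_into_image:
  assumes "is_iso f M N"
  shows "X \<subseteq> ground M \<Longrightarrow> inv_into (ground M) f ` f ` X = X"
    and "Y \<subseteq> ground N \<Longrightarrow> f ` inv_into (ground M) f ` Y = Y"
    and "Y \<subseteq> ground N \<Longrightarrow> inv_into (ground M) f ` Y \<subseteq> ground M"
proof -
  show "X \<subseteq> ground M \<Longrightarrow> inv_into (ground M) f ` f ` X = X"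
    using is_isoD(2)[OF assms] by (rule inv_into_image_cancel)
  show "Y \<subseteq> ground N \<Longrightarrow> f ` inv_into (ground M) f ` Y = Y"
    using is_isoD(3)[OF assms] by (rule image_inv_into_cancel)
  show "Y \<subseteq> ground N \<Longrightarrow> inv_into (ground M) f ` Y \<subseteq> ground M"
    using is_isoD(3)[OF assms] inv_into_into[of _ f "ground M"] by blast
qed

lemma is_iso_inv:
  assumes "is_iso f M N"
  shows "is_iso (inv_into (ground M) f) N M"
  unfolding is_iso_def
proof (intro conjI allI impI)
  show "bij_betw (inv_into (ground M) f) (ground N) (ground M)"
    using is_isoD(1)[OF assms] by (rule bij_betw_inv_into)
  fix X assume X: "X \<subseteq> ground N"
  show "indep N X \<longleftrightarrow> indep M (inv_into (ground M) f ` X)"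
    using is_isoD(4)[OF assms image_inv_into_image(3)[OF assms X]]
    unfolding image_inv_into_image(2)[OF assms X] .
qed

lemma is_iso_comp:
  assumes "is_iso f M N" "is_iso g N P"
  shows "is_iso (g \<circ> f) M P"
  unfolding is_iso_def
proof (intro conjI allI impI)
  show "bij_betw (g \<circ> f) (ground M) (ground P)"
    using is_isoD(1)[OF assms(1)] is_isoD(1)[OF assms(2)] by (rule bij_betw_trans)
  fix X assume X: "X \<subseteq> ground M"
  then have "f ` X \<subseteq> ground N" using is_isoD(3)[OF assms(1)] by blast
  then show "indep M X \<longleftrightarrow> indep P ((g \<circ> f) ` X)"
    using is_isoD(4)[OF assms(1) X] is_isoD(4)[OF assms(2), of "f ` X"] by (simp add: image_comp)
qed

lemma equivp_isomorphic: "equivp isomorphic"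
proof (rule equivpI)
  show "reflp isomorphic"
    by (rule reflpI) (use is_iso_refl isomorphic_def in blast)
  show "symp isomorphic"
    by (rule sympI) (use is_iso_inv isomorphic_def in blast)
  show "transp isomorphic"
    by (rule transpI) (unfold isomorphic_def, blast intro: is_iso_comp)
qed

quotient_type 'a matroid_class = "'a matroid" / isomorphic
  by (rule equivp_isomorphic)

lemma is_iso_basis:
  assumes f: "is_iso f M N" and X: "X \<subseteq> ground M"
  shows "basis N (f ` X) \<longleftrightarrow> basis M X"
proof -
  have *: "basis N (f ` X)" if f: "is_iso f M N" and X: "basis M X"
    for f :: "'a \<Rightarrow> 'a" and M N X
    unfolding basis_def
  proof (intro conjI allI impI)
    have sub: "X \<subseteq> ground M" using X by (simp add: basis_ground)
    show "indep N (f ` X)" using is_isoD(4)[OF f sub] X by (simp add: basis_indep)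
    fix Y assume Y: "indep N Y" "f ` X \<subseteq> Y"
    let ?g = "inv_into (ground M) f"
    have YN: "Y \<subseteq> ground N" using Y(1) by (rule indep_ground)
    have "indep M (?g ` Y)" using is_isoD(4)[OF is_iso_inv[OF f] YN] Y(1) by simp
    moreover have "X \<subseteq> ?g ` Y"
      using image_mono[OF Y(2), of ?g] unfolding image_inv_into_image(1)[OF f sub] .
    ultimately have "?g ` Y = X" using X unfolding basis_def by blast
    then show "Y = f ` X" using image_inv_into_image(2)[OF f YN] by simp
  qed
  show ?thesis
    using *[OF f, of X] *[OF is_iso_inv[OF f], of "f ` X"]
    unfolding image_inv_into_image(1)[OF f X] by blast
qed

lemma is_isoI_basis:
  assumes b: "bij_betw f (ground M) (ground N)"
    and bas: "\<And>B. B \<subseteq> ground M \<Longrightarrow> basis N (f ` B) \<longleftrightarrow> basis M B"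
  shows "is_iso f M N"
  unfolding is_iso_def
proof (intro conjI allI impI b)
  have inj: "inj_on f (ground M)" and im: "f ` ground M = ground N"
    using b by (simp_all add: bij_betw_def)
  fix X assume X: "X \<subseteq> ground M"
  show "indep M X \<longleftrightarrow> indep N (f ` X)"
  proof
    assume "indep M X"
    then obtain B where B: "basis M B" "X \<subseteq> B" using indep_iff_basis by metis
    then have "B \<subseteq> ground M" by (simp add: basis_ground)
    then have "basis N (f ` B)" using bas B(1) by simp
    then show "indep N (f ` X)" using image_mono[OF B(2)] indep_iff_basis by metis
  next
    assume "indep N (f ` X)"
    then obtain C where C: "basis N C" "f ` X \<subseteq> C" using indep_iff_basis by metis
    then have "C \<subseteq> f ` ground M" unfolding im by (simp add: basis_ground)
    then obtain B where B: "B \<subseteq> ground M" "C = f ` B" by (auto simp: subset_image_iff)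
    have "X \<subseteq> B"
    proof
      fix x assume "x \<in> X"
      then have "f x \<in> f ` B" "x \<in> ground M" using C(2) B(2) X by blast+
      then show "x \<in> B" using inj_on_image_mem_iff[OF inj _ B(1)] by blast
    qed
    moreover have "basis M B" using bas B C(1) by simp
    ultimately show "indep M X" using indep_iff_basis by metis
  qed
qed

lemma is_iso_rank:
  assumes f: "is_iso f M N"
  shows "rank N = rank M"
proof -
  obtain B where B: "basis M B" using ex_basis by metis
  then have sub: "B \<subseteq> ground M" by (simp add: basis_ground)
  have "card (f ` B) = card B"
    by (rule card_image[OF inj_on_subset[OF is_isoD(2)[OF f] sub]])
  moreover have "card (f ` B) = rank N" "card B = rank M"
    using is_iso_basis[OF f sub] B unfolding basis_iff by blast+
  ultimately show ?thesis by simp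
qed

lemma is_iso_spans:
  assumes f: "is_iso f M N" and X: "X \<subseteq> ground M"
  shows "spans N (f ` X) \<longleftrightarrow> spans M X"
proof -
  have *: "spans N (f ` X)" if f: "is_iso f M N" and X: "spans M X" for f :: "'a \<Rightarrow> 'a" and M N X
  proof -
    obtain B where B: "B \<subseteq> X" "basis M B" and sub: "X \<subseteq> ground M"
      using X unfolding spans_def by metis
    have "basis N (f ` B)" using is_iso_basis[OF f basis_ground[OF B(2)]] B(2) by simp
    moreover have "f ` B \<subseteq> f ` X" using B(1) by (rule image_mono)
    moreover have "f ` X \<subseteq> ground N" using image_mono[OF sub, of f] is_isoD(3)[OF f] by simp
    ultimately show ?thesis unfolding spans_def by metis
  qed
  have "spans M (inv_into (ground M) f ` f ` X)" if "spans N (f ` X)"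
    using is_iso_inv[OF f] that by (rule *)
  then show ?thesis
    using *[OF f, of X] unfolding image_inv_into_image(1)[OF f X] by iprover
qed

lemma is_iso_restrict:
  assumes f: "is_iso f M N" and A: "A \<subseteq> ground M"
  shows "is_iso f (mrestrict M A) (mrestrict N (f ` A))"
  unfolding is_iso_def
proof (intro conjI allI impI)
  have eq: "A \<inter> ground M = A" "f ` A \<inter> ground N = f ` A" using A is_isoD(3)[OF f] by blast+
  show "bij_betw f (ground (mrestrict M A)) (ground (mrestrict N (f ` A)))"
    using is_isoD(2)[OF f] A by (auto simp: eq bij_betw_def intro: inj_on_subset)
  fix X assume "X \<subseteq> ground (mrestrict M A)"
  then have "X \<subseteq> A" "X \<subseteq> ground M" by auto
  then show "indep (mrestrict M A) X \<longleftrightarrow> indep (mrestrict N (f ` A)) (f ` X)"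
    using is_isoD(4)[OF f, of X] by auto
qed

lemma is_iso_contract:
  assumes f: "is_iso f M N" and A: "A \<subseteq> ground M"
  shows "is_iso f (mcontract M A) (mcontract N (f ` A))"
proof -
  have *: "indep (mcontract N (f ` A)) (f ` X)"
    if f: "is_iso f M N" and A: "A \<subseteq> ground M" and X: "indep (mcontract M A) X"
    for f :: "'a \<Rightarrow> 'a" and M N A X
  proof -
    obtain B where B: "X \<subseteq> ground M - A" "basis (mrestrict M A) B" "indep M (X \<union> B)"
      using X by (auto simp: indep_contract)
    have "B \<subseteq> A" using basis_indep[OF B(2)] by simp
    then have "basis (mrestrict N (f ` A)) (f ` B)"
      using is_iso_basis[OF is_iso_restrict[OF f A], of B] B(2) A by simp
    moreover have "indep N (f ` X \<union> f ` B)"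
      using is_isoD(4)[OF f indep_ground[OF B(3)]] B(3) by (simp add: image_Un)
    moreover have "f ` X \<subseteq> ground N - f ` A"
      using B(1) inj_on_image_set_diff[OF is_isoD(2)[OF f], of "ground M" A] A is_isoD(3)[OF f]
      by blast
    ultimately show ?thesis unfolding indep_contract by blast
  qed
  have g: "f ` (ground M - A) = ground N - f ` A"
    using inj_on_image_set_diff[OF is_isoD(2)[OF f], of "ground M" A] A is_isoD(3)[OF f] by simp
  show ?thesis
    unfolding is_iso_def
  proof (intro conjI allI impI)
    show "bij_betw f (ground (mcontract M A)) (ground (mcontract N (f ` A)))"
      using is_isoD(2)[OF f] g by (auto simp: bij_betw_def intro: inj_on_subset)
    fix X assume "X \<subseteq> ground (mcontract M A)"
    then have X: "X \<subseteq> ground M" by auto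
    have fA: "f ` A \<subseteq> ground N" using A is_isoD(3)[OF f] by blast
    show "indep (mcontract M A) X \<longleftrightarrow> indep (mcontract N (f ` A)) (f ` X)"
      using *[OF f A, of X] *[OF is_iso_inv[OF f] fA, of "f ` X"]
      unfolding image_inv_into_image(1)[OF f X] image_inv_into_image(1)[OF f A] by blast
  qed
qed

lemma is_iso_minor:
  assumes f: "is_iso f M N" and "A \<subseteq> B" "B \<subseteq> ground M"
  shows "is_iso f (mminor M A B) (mminor N (f ` A) (f ` B))"
  unfolding mminor_def using assms
  by (intro is_iso_contract is_iso_restrict) auto

lemma is_iso_free_product:
  assumes f: "is_iso f M M'" "is_iso f N N'"
    and disj: "ground M \<inter> ground N = {}" "ground M' \<inter> ground N' = {}"
  shows "is_iso f (M \<box> N) (M' \<box> N')"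
proof (rule is_isoI_basis)
  have im: "f ` ground M = ground M'" "f ` ground N = ground N'"
    using is_isoD(3)[OF f(1)] is_isoD(3)[OF f(2)] .
  show bij: "bij_betw f (ground (M \<box> N)) (ground (M' \<box> N'))"
    unfolding ground_free_product[OF disj(1)] ground_free_product[OF disj(2)]
    using is_isoD(1)[OF f(1)] is_isoD(1)[OF f(2)] disj(2) by (rule bij_betw_combine)
  fix B assume "B \<subseteq> ground (M \<box> N)"
  then have B: "B \<subseteq> ground M \<union> ground N" by (simp add: ground_free_product[OF disj(1)])
  have inj: "inj_on f (ground M \<union> ground N)"
    using bij by (simp add: bij_betw_def ground_free_product[OF disj(1)])
  have "card (f ` B) = card B" using inj B by (meson card_image inj_on_subset)
  moreover have "f ` B \<inter> ground M' = f ` (B \<inter> ground M)" "f ` B \<inter> ground N' = f ` (B \<inter> ground N)"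
    using inj_on_image_Int[OF inj B, of "ground M"] inj_on_image_Int[OF inj B, of "ground N"]
    unfolding im by blast+
  moreover have "f ` B \<subseteq> ground M' \<union> ground N'" using B im by blast
  ultimately show "basis (M' \<box> N') (f ` B) \<longleftrightarrow> basis (M \<box> N) B"
    using B is_isoD(4)[OF f(1), of "B \<inter> ground M"] is_iso_spans[OF f(2), of "B \<inter> ground N"]
    by (simp add: basis_free_product[OF disj(1)] basis_free_product[OF disj(2)]
        is_iso_rank[OF f(1)] is_iso_rank[OF f(2)])
qed

lemma is_iso_unique:
  assumes "is_iso f M N" "is_iso f M N'"
  shows "N = N'"
proof (rule matroid_eqI)
  show g: "ground N = ground N'" using is_isoD(3)[OF assms(1)] is_isoD(3)[OF assms(2)] by simp
  fix Y
  show "indep N Y \<longleftrightarrow> indep N' Y"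
  proof (cases "Y \<subseteq> ground N")
    case True
    then have "Y \<subseteq> f ` ground M" using is_isoD(3)[OF assms(1)] by simp
    then obtain X where "X \<subseteq> ground M" "Y = f ` X" by (auto simp: subset_image_iff)
    then show ?thesis using is_isoD(4)[OF assms(1)] is_isoD(4)[OF assms(2)] by simp
  next
    case False
    then show ?thesis using g indep_ground by metis
  qed
qed

lemma ex_is_iso:
  assumes inj: "inj_on f (ground M)"
  shows "\<exists>N. is_iso f M N"
proof -
  let ?I = "(`) f ` {X. indep M X}"
  have mat: "is_matroid (f ` ground M) ?I"
    unfolding is_matroid_def
  proof (intro conjI ballI allI impI)
    show "?I \<subseteq> Pow (f ` ground M)" using indep_ground by blast
    show "{} \<in> ?I" by (rule image_eqI[of _ _ "{}"]) simp_all
    fix X assume "X \<in> ?I"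
    then obtain X' where X: "X = f ` X'" "indep M X'" by blast
    show "Y \<in> ?I" if YX: "Y \<subseteq> X" for Y
    proof -
      obtain Y' where "Y' \<subseteq> X'" "Y = f ` Y'" using YX X(1) by (auto simp: subset_image_iff)
      then show ?thesis using indep_subset[OF X(2)] by blast
    qed
    fix Y assume "Y \<in> ?I" and lt: "card X < card Y"
    then obtain Y' where Y: "Y = f ` Y'" "indep M Y'" by blast
    have "card X = card X'" "card Y = card Y'"
      unfolding X(1) Y(1) using inj indep_ground[OF X(2)] indep_ground[OF Y(2)]
      by (meson card_image inj_on_subset)+
    then obtain y where y: "y \<in> Y' - X'" "indep M (insert y X')"
      using indep_augment[OF X(2) Y(2)] lt by auto
    have "f y \<notin> X"
      using y indep_ground[OF X(2)] indep_ground[OF Y(2)] inj unfolding X(1)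
      by (auto dest: inj_onD)
    moreover have "insert (f y) X \<in> ?I"
      using y(2) unfolding X(1) by (intro image_eqI[of _ _ "insert y X'"]) simp_all
    ultimately show "\<exists>y\<in>Y - X. insert y X \<in> ?I" using y(1) Y(1) by blast
  qed simp
  have "is_iso f M (Abs_matroid (f ` ground M, ?I))"
    unfolding is_iso_def ground_Abs[OF mat] indep_Abs[OF mat]
  proof (intro conjI allI impI)
    show "bij_betw f (ground M) (f ` ground M)" using inj by (simp add: bij_betw_def)
    fix X assume X: "X \<subseteq> ground M"
    have "X = Y" if "f ` X = f ` Y" "indep M Y" for Y
      using that X inj indep_ground[of M Y] by (simp add: inj_on_image_eq_iff)
    then show "indep M X \<longleftrightarrow> f ` X \<in> ?I" by blast
  qed
  then show ?thesis by blast
qed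

lemma is_iso_irreducible:
  assumes f: "is_iso f M N"
  shows "irreducible_matroid N \<longleftrightarrow> irreducible_matroid M"
proof -
  have *: "irreducible_matroid N" if f: "is_iso f M N" and M: "irreducible_matroid M"
    for f :: "'a \<Rightarrow> 'a" and M N
  proof -
    have "ground N \<noteq> {}" using M is_isoD(3)[OF f] by (auto simp: irreducible_matroid_def)
    moreover have False
      if PQ: "ground P \<noteq> {}" "ground Q \<noteq> {}" "ground P \<inter> ground Q = {}" "N = P \<box> Q" for P Q
    proof -
      let ?g = "inv_into (ground M) f"
      have g: "is_iso ?g N M" using f by (rule is_iso_inv)
      have gN: "ground N = ground P \<union> ground Q" using PQ by (simp add: ground_free_product)
      have inj: "inj_on ?g (ground P \<union> ground Q)" using is_isoD(2)[OF g] by (simp add: gN)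
      obtain P' where P': "is_iso ?g P P'"
        using ex_is_iso[OF inj_on_subset[OF inj, of "ground P"]] by auto
      obtain Q' where Q': "is_iso ?g Q Q'"
        using ex_is_iso[OF inj_on_subset[OF inj, of "ground Q"]] by auto
      have gr: "?g ` ground P = ground P'" "?g ` ground Q = ground Q'"
        using is_isoD(3)[OF P'] is_isoD(3)[OF Q'] .
      have disj: "ground P' \<inter> ground Q' = {}"
        using inj_on_image_Int[OF inj, of "ground P" "ground Q"] PQ(3) gr by simp
      have "M = P' \<box> Q'"
        using is_iso_unique[OF g] is_iso_free_product[OF P' Q' PQ(3) disj] PQ(4) by simp
      moreover have "ground P' \<noteq> {}" "ground Q' \<noteq> {}" using PQ gr by auto
      ultimately show False using M disj unfolding irreducible_matroid_def by blast
    qed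
    ultimately show ?thesis unfolding irreducible_matroid_def by blast
  qed
  show ?thesis using *[OF f] *[OF is_iso_inv[OF f]] by blast
qed


section \<open>Irreducible chains\<close>

definition irreducible_chains :: "'a matroid \<Rightarrow> 'a set list set" where
  "irreducible_chains M = {D. D \<noteq> [] \<and> hd D = {} \<and> last D = ground M
     \<and> successively (\<lambda>A B. A \<subset> B \<and> irreducible_matroid (mminor M A B)) D}"

text \<open>The trailing factor is the empty matroid, the unit of the free product.\<close>

fun chain_product :: "'a matroid \<Rightarrow> 'a set list \<Rightarrow> 'a matroid" where
  "chain_product M (A # B # D) = mminor M A B \<box> chain_product M (B # D)"
| "chain_product M _ = empty_matroid"

lemma successively_psubset:
  "successively (\<lambda>A B. A \<subset> B \<and> P A B) (A # D) \<Longrightarrow> A \<subseteq> last (A # D) \<and> (\<forall>B\<in>set D. A \<subset> B \<and> B \<subseteq> last (A # D))"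
proof (induction D arbitrary: A)
  case (Cons B D)
  have AB: "A \<subset> B" and s: "successively (\<lambda>A B. A \<subset> B \<and> P A B) (B # D)"
    using Cons.prems unfolding successively.simps by blast+
  from s have "B \<subseteq> last (B # D) \<and> (\<forall>C\<in>set D. B \<subset> C \<and> C \<subseteq> last (B # D))"
    by (rule Cons.IH)
  moreover have "last (A # B # D) = last (B # D)" "set (B # D) = insert B (set D)" by simp_all
  ultimately show ?case using AB by (metis insert_iff psubset_imp_subset subset_trans psubset_subset_trans)
qed simp

lemma ground_chain_product:
  "successively (\<lambda>A B. A \<subset> B \<and> P A B) (A # D) \<Longrightarrow> last (A # D) \<subseteq> ground M \<Longrightarrow>
     ground (chain_product M (A # D)) = last (A # D) - A"
proof (induction D arbitrary: A)
  case (Cons B D)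
  have AB: "A \<subset> B" and D: "successively (\<lambda>A B. A \<subset> B \<and> P A B) (B # D)"
    using Cons.prems(1) unfolding successively.simps by blast+
  have BL: "B \<subseteq> last (B # D)" using successively_psubset[OF D] by blast
  have L: "last (B # D) \<subseteq> ground M" using Cons.prems(2) by simp
  have g: "ground (chain_product M (B # D)) = last (B # D) - B"
    using D L by (rule Cons.IH)
  have m: "ground (mminor M A B) = B - A" using BL L by auto
  have "ground (mminor M A B \<box> chain_product M (B # D)) = (B - A) \<union> (last (B # D) - B)"
    by (subst ground_free_product) (unfold g m, blast+)
  also have "\<dots> = last (B # D) - A" using AB BL by blast
  finally show ?case by simp
qed simp

lemma irreducible_chainsE:
  assumes "D \<in> irreducible_chains M"
  obtains E where "D = {} # E" "last ({} # E) = ground M"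
    "successively (\<lambda>A B. A \<subset> B \<and> irreducible_matroid (mminor M A B)) ({} # E)"
proof -
  obtain A E where E: "D = A # E"
    using assms unfolding irreducible_chains_def by (cases D) blast+
  then have "A = {}" using assms unfolding irreducible_chains_def by simp
  then show thesis
    using that[of E] assms unfolding irreducible_chains_def E mem_Collect_eq by blast
qed

lemma irreducible_chains_subset:
  assumes "D \<in> irreducible_chains M"
  shows "set D \<subseteq> Pow (ground M)"
proof -
  obtain E where E: "D = {} # E" "last ({} # E) = ground M"
    "successively (\<lambda>A B. A \<subset> B \<and> irreducible_matroid (mminor M A B)) ({} # E)"
    using assms by (rule irreducible_chainsE)
  show ?thesis using successively_psubset[OF E(3)] unfolding E(2) E(1) by auto
qed

lemma finite_irreducible_chains: "finite (irreducible_chains M)"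
proof -
  have *: "distinct E" if "successively (\<lambda>A B. A \<subset> B \<and> irreducible_matroid (mminor M A B)) E" for E
    using that
  proof (induction E)
    case (Cons A E)
    have "distinct E" using Cons by (cases E) simp_all
    moreover have "A \<notin> set E" using successively_psubset[OF Cons.prems] by blast
    ultimately show ?case by simp
  qed simp
  have "distinct D" if "D \<in> irreducible_chains M" for D
    using that by (rule irreducible_chainsE) (use * in blast)
  then have "irreducible_chains M \<subseteq> {D. set D \<subseteq> Pow (ground M) \<and> distinct D}"
    using irreducible_chains_subset by blast
  then show ?thesis by (rule finite_subset) (simp add: finite_subset_distinct)
qed

lemma is_iso_chain_product:
  assumes f: "is_iso f M N"
  shows "successively (\<lambda>A B. A \<subset> B \<and> irreducible_matroid (mminor M A B)) (A # D) \<Longrightarrow>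
     last (A # D) \<subseteq> ground M \<Longrightarrow>
     successively (\<lambda>A B. A \<subset> B \<and> irreducible_matroid (mminor N A B)) (map ((`) f) (A # D)) \<and>
     is_iso f (chain_product M (A # D)) (chain_product N (map ((`) f) (A # D)))"
proof (induction D arbitrary: A)
  case Nil
  show ?case by (simp add: is_iso_def bij_betw_def)
next
  case (Cons B D)
  let ?P = "\<lambda>M A B. A \<subset> B \<and> irreducible_matroid (mminor M A B)"
  let ?g = "(`) f"
  have AB: "A \<subset> B" and irr: "irreducible_matroid (mminor M A B)"
    and D: "successively (?P M) (B # D)"
    using Cons.prems(1) unfolding successively.simps by blast+
  have BL: "B \<subseteq> last (B # D)" using successively_psubset[OF D] by blast
  have L: "last (B # D) \<subseteq> ground M" using Cons.prems(2) by simp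
  have IH: "successively (?P N) (map ?g (B # D))"
    "is_iso f (chain_product M (B # D)) (chain_product N (map ?g (B # D)))"
    using Cons.IH[OF D L] by blast+
  have BM: "B \<subseteq> ground M" using BL L by blast
  have min: "is_iso f (mminor M A B) (mminor N (f ` A) (f ` B))"
    by (rule is_iso_minor[OF f _ BM]) (use AB in blast)
  have fAB: "f ` A \<subset> f ` B"
  proof -
    have "A \<subseteq> ground M" using AB BM by blast
    then have "f ` A \<noteq> f ` B"
      using inj_on_image_eq_iff[OF is_isoD(2)[OF f] _ BM] AB by blast
    then show ?thesis using image_mono[of A B f] AB by blast
  qed
  have succ: "successively (?P N) (map ?g (A # B # D))"
    using IH(1) fAB irr is_iso_irreducible[OF min] by simp
  have last: "last (map ?g (B # D)) = f ` last (B # D)" by (rule last_map) simp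
  have "f ` last (B # D) \<subseteq> ground N" using image_mono[OF L, of f] is_isoD(3)[OF f] by simp
  then have gN: "ground (chain_product N (map ?g (B # D))) = f ` last (B # D) - f ` B"
    using ground_chain_product[of "\<lambda>A B. irreducible_matroid (mminor N A B)" "f ` B" "map ?g D" N]
      IH(1) last by simp
  have "is_iso f (mminor M A B \<box> chain_product M (B # D))
      (mminor N (f ` A) (f ` B) \<box> chain_product N (map ?g (B # D)))"
  proof (rule is_iso_free_product[OF min IH(2)])
    show "ground (mminor M A B) \<inter> ground (chain_product M (B # D)) = {}"
      unfolding ground_chain_product[OF D L] ground_minor by blast
    show "ground (mminor N (f ` A) (f ` B)) \<inter> ground (chain_product N (map ?g (B # D))) = {}"
      unfolding gN ground_minor by blast
  qed
  then show ?case using succ by simp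
qed

lemma is_iso_irreducible_chains:
  assumes f: "is_iso f M N" and D: "D \<in> irreducible_chains M"
  shows "map ((`) f) D \<in> irreducible_chains N"
    and "is_iso f (chain_product M D) (chain_product N (map ((`) f) D))"
    and "map ((`) (inv_into (ground M) f)) (map ((`) f) D) = D"
proof -
  obtain E where E: "D = {} # E" "last ({} # E) = ground M"
    "successively (\<lambda>A B. A \<subset> B \<and> irreducible_matroid (mminor M A B)) ({} # E)"
    using D by (rule irreducible_chainsE)
  have L: "last ({} # E) \<subseteq> ground M" unfolding E(2) by (rule subset_refl)
  note iso = is_iso_chain_product[OF f E(3) L, folded E(1)]
  have "last (map ((`) f) D) = f ` last D" by (rule last_map) (simp add: E(1))
  then have "last (map ((`) f) D) = ground N" using E(1,2) is_isoD(3)[OF f] by simp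
  moreover have "map ((`) f) D \<noteq> []" "hd (map ((`) f) D) = {}" by (simp_all add: E(1))
  ultimately show "map ((`) f) D \<in> irreducible_chains N"
    using iso unfolding irreducible_chains_def by blast
  show "is_iso f (chain_product M D) (chain_product N (map ((`) f) D))"
    using iso by (rule conjunct2)
  have "C \<subseteq> ground M" if "C \<in> set D" for C
    using irreducible_chains_subset[OF D] that by blast
  then show "map ((`) (inv_into (ground M) f)) (map ((`) f) D) = D"
    unfolding map_map by (intro map_idI) (simp only: o_apply image_inv_into_image(1)[OF f])
qed


section \<open>The vector space on isomorphism classes\<close>

text \<open>The vector space with basis \<open>'b\<close> is \<open>'b \<Rightarrow>\<^sub>0 'k\<close>; in particular the tensor square of
  \<open>'b \<Rightarrow>\<^sub>0 'k\<close> is \<open>('b \<times> 'b) \<Rightarrow>\<^sub>0 'k\<close>.\<close>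

definition scale :: "'k::field \<Rightarrow> ('b \<Rightarrow>\<^sub>0 'k) \<Rightarrow> ('b \<Rightarrow>\<^sub>0 'k)" where
  "scale c x = Poly_Mapping.map ((*) c) x"

definition linear_extension :: "('b \<Rightarrow> ('c \<Rightarrow>\<^sub>0 'k)) \<Rightarrow> ('b \<Rightarrow>\<^sub>0 'k::field) \<Rightarrow> ('c \<Rightarrow>\<^sub>0 'k)" where
  "linear_extension g x = (\<Sum>b\<in>Poly_Mapping.keys x. scale (Poly_Mapping.lookup x b) (g b))"

definition tensor :: "('b \<Rightarrow>\<^sub>0 'k::field) \<Rightarrow> ('b \<Rightarrow>\<^sub>0 'k) \<Rightarrow> ('b \<times> 'b \<Rightarrow>\<^sub>0 'k)" where
  "tensor x y = (\<Sum>b\<in>Poly_Mapping.keys x. \<Sum>c\<in>Poly_Mapping.keys y.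
     Poly_Mapping.single (b, c) (Poly_Mapping.lookup x b * Poly_Mapping.lookup y c))"

lemma lookup_scale: "Poly_Mapping.lookup (scale c x) b = c * Poly_Mapping.lookup x b"
  by (simp add: scale_def map.rep_eq when_def)

lemma vector_space_scale: "vector_space scale"
  by unfold_locales
    (auto intro!: poly_mapping_eqI simp: lookup_scale lookup_add algebra_simps)

definition class_vec :: "'a matroid_class \<Rightarrow> ('a matroid_class \<Rightarrow>\<^sub>0 'k::field)" where
  "class_vec c = Poly_Mapping.single c 1"

definition matroid_vec :: "'a matroid \<Rightarrow> ('a matroid_class \<Rightarrow>\<^sub>0 'k::field)" where
  "matroid_vec M = class_vec (abs_matroid_class M)"

lemma abs_class_eq: "is_iso f M N \<Longrightarrow> abs_matroid_class M = abs_matroid_class N"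
  unfolding matroid_class.abs_eq_iff isomorphic_def by blast

lift_definition class_coproduct ::
    "'a matroid_class \<Rightarrow> ('a matroid_class \<times> 'a matroid_class \<Rightarrow>\<^sub>0 'k::field)" is
  "\<lambda>M. \<Sum>A\<in>Pow (ground M).
     tensor (matroid_vec (mrestrict M A)) (matroid_vec (mcontract M A))"
proof -
  fix M N :: "'a matroid" assume "isomorphic M N"
  then obtain f where f: "is_iso f M N" unfolding isomorphic_def by blast
  let ?g = "inv_into (ground M) f"
  show "(\<Sum>A\<in>Pow (ground M). tensor (matroid_vec (mrestrict M A)) (matroid_vec (mcontract M A)))
      = (\<Sum>A\<in>Pow (ground N). tensor (matroid_vec (mrestrict N A)) (matroid_vec (mcontract N A))
          :: 'a matroid_class \<times> 'a matroid_class \<Rightarrow>\<^sub>0 'k)"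
  proof (rule sum.reindex_bij_witness[of _ "(`) ?g" "(`) f"])
    fix A assume "A \<in> Pow (ground M)"
    then have A: "A \<subseteq> ground M" by simp
    show "?g ` f ` A = A" by (rule image_inv_into_image(1)[OF f A])
    show "f ` A \<in> Pow (ground N)" using image_mono[OF A, of f] is_isoD(3)[OF f] by simp
    show "tensor (matroid_vec (mrestrict N (f ` A))) (matroid_vec (mcontract N (f ` A)))
        = (tensor (matroid_vec (mrestrict M A)) (matroid_vec (mcontract M A))
            :: 'a matroid_class \<times> 'a matroid_class \<Rightarrow>\<^sub>0 'k)"
      unfolding matroid_vec_def abs_class_eq[OF is_iso_restrict[OF f A]]
        abs_class_eq[OF is_iso_contract[OF f A]] by (rule refl)
  next
    fix A assume "A \<in> Pow (ground N)"
    then have A: "A \<subseteq> ground N" by simp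
    show "f ` ?g ` A = A" by (rule image_inv_into_image(2)[OF f A])
    show "?g ` A \<in> Pow (ground M)" using image_inv_into_image(3)[OF f A] by simp
  qed
qed

lift_definition class_phi :: "'a matroid_class \<Rightarrow> ('a matroid_class \<Rightarrow>\<^sub>0 'k::field)" is
  "\<lambda>M. \<Sum>D\<in>irreducible_chains M. matroid_vec (chain_product M D)"
proof -
  fix M N :: "'a matroid" assume "isomorphic M N"
  then obtain f where f: "is_iso f M N" unfolding isomorphic_def by blast
  let ?g = "inv_into (ground M) f"
  have g: "is_iso ?g N M" using f by (rule is_iso_inv)
  have inv: "map ((`) f) (map ((`) ?g) D) = D" if D: "D \<in> irreducible_chains N" for D
  proof -
    have "C \<subseteq> ground N" if "C \<in> set D" for C
      using irreducible_chains_subset[OF D] that by blast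
    then show ?thesis
      unfolding map_map by (intro map_idI) (simp only: o_apply image_inv_into_image(2)[OF f])
  qed
  show "(\<Sum>D\<in>irreducible_chains M. matroid_vec (chain_product M D))
      = (\<Sum>D\<in>irreducible_chains N. matroid_vec (chain_product N D)
          :: 'a matroid_class \<Rightarrow>\<^sub>0 'k)"
  proof (rule sum.reindex_bij_witness[of _ "map ((`) ?g)" "map ((`) f)"])
    fix D assume D: "D \<in> irreducible_chains M"
    show "map ((`) ?g) (map ((`) f) D) = D" "map ((`) f) D \<in> irreducible_chains N"
      using is_iso_irreducible_chains[OF f D] by blast+
    show "matroid_vec (chain_product N (map ((`) f) D))
        = (matroid_vec (chain_product M D) :: 'a matroid_class \<Rightarrow>\<^sub>0 'k)"
      unfolding matroid_vec_def abs_class_eq[OF is_iso_irreducible_chains(2)[OF f D]] by (rule refl)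
  next
    fix D assume D: "D \<in> irreducible_chains N"
    show "map ((`) f) (map ((`) ?g) D) = D" using D by (rule inv)
    show "map ((`) ?g) D \<in> irreducible_chains M"
      using is_iso_irreducible_chains[OF g D] by blast
  qed
qed

definition coproduct ::
    "('a matroid_class \<Rightarrow>\<^sub>0 'k::field) \<Rightarrow> ('a matroid_class \<times> 'a matroid_class \<Rightarrow>\<^sub>0 'k)" where
  "coproduct = linear_extension class_coproduct"

definition unit_vec :: "'a matroid_class \<Rightarrow>\<^sub>0 'k::field" where
  "unit_vec = matroid_vec empty_matroid"

definition primitives :: "('a matroid_class \<Rightarrow>\<^sub>0 'k::field) set" where
  "primitives = {x. coproduct x = tensor unit_vec x + tensor x unit_vec}"

definition phi :: "('a matroid_class \<Rightarrow>\<^sub>0 'k::field) \<Rightarrow> ('a matroid_class \<Rightarrow>\<^sub>0 'k)" where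
  "phi = linear_extension class_phi"

text \<open>In characteristic zero \<open>phi\<close> is bijective, so that \<open>inv phi\<close> is its genuine inverse.\<close>

definition primitive_vec :: "'a matroid_class \<Rightarrow> ('a matroid_class \<Rightarrow>\<^sub>0 'k::field_char_0)" where
  "primitive_vec c = inv phi (class_vec c)"

definition is_basis_family :: "('i \<Rightarrow> ('b \<Rightarrow>\<^sub>0 'k::field)) \<Rightarrow> 'i set \<Rightarrow> ('b \<Rightarrow>\<^sub>0 'k) set \<Rightarrow> bool" where
  "is_basis_family v I V \<longleftrightarrow>
     inj_on v I \<and> \<not> module.dependent scale (v ` I) \<and> module.span scale (v ` I) = V"

lemma linear_extension_single:
  "linear_extension g (Poly_Mapping.single b 1) = g b"
  by (auto intro!: poly_mapping_eqI simp: linear_extension_def lookup_scale)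

lemma tensor_matroid_vec:
  "tensor (matroid_vec M) (matroid_vec N)
     = Poly_Mapping.single (abs_matroid_class M, abs_matroid_class N) (1 :: 'k::field)"
  by (simp add: tensor_def matroid_vec_def class_vec_def)

lemma coproduct_matroid_vec:
  "coproduct (matroid_vec M) = (\<Sum>A\<in>Pow (ground M).
     tensor (matroid_vec (mrestrict M A)) (matroid_vec (mcontract M A)))"
  by (simp add: coproduct_def matroid_vec_def class_vec_def linear_extension_single
      class_coproduct.abs_eq)

lemma phi_matroid_vec:
  "phi (matroid_vec M) = (\<Sum>D\<in>irreducible_chains M. matroid_vec (chain_product M D))"
  by (simp add: phi_def matroid_vec_def class_vec_def linear_extension_single class_phi.abs_eq)

end

theory Submission
  imports Defs
begin

text \<open>
  A set \<open>A\<close> satisfies \<open>M = M|A \<box> M/A\<close> iff every circuit of \<open>M\<close> lies in \<open>A\<close> or spans \<open>A\<close>; a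
  Jordan--Hoelder argument on such sets gives unique factorization into irreducible matroids up to
  isomorphism. Hence \<open>phi\<close> counts, for each word of irreducible classes, the chains of minors with
  that word, and these counts turn the coproduct into deconcatenation of words. So \<open>x\<close> is primitive
  iff \<open>phi x\<close> is supported on one-letter words. As \<open>phi\<close> is triangular with respect to the number of
  bases, it is bijective, which gives the basis of the primitive elements.

  For the Moebius formula, the coefficient of a word with first letter \<open>a\<close> in the image under \<open>phi\<close> of
  the right-hand side is a sum over \<open>A\<close> of terms that depend on \<open>N\<close> only through \<open>N|A \<box> N/A\<close>. For
  proper nonempty \<open>A\<close>, the map \<open>N \<mapsto> N|A \<box> N/A\<close> is a closure operator on the poset above \<open>M\<close> that
  moves \<open>M\<close>, so these terms cancel.
\<close>

section \<open>Rank functions and minors\<close>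

text \<open>The sum defining \<open>phi\<close> runs over chains, but its terms are classes of free
  products, so a coefficient is computable only once it is known which chains give the same class.
  Unique factorization settles this: the class of M(D) is replaced by the word of classes of the
  minors along D, and words, unlike classes, can be cut into pieces. In the Moebius formula the
  delicate point is that the poset is not the full weak-order interval above M: apart from M it
  contains reducible matroids only. Splitting along a proper nonempty set always yields a reducible
  matroid, so the closure operator stays inside the poset, and for the same reason it never takes
  the value M. The one set at which no cancellation is available, the whole ground set, sees only
  irreducible members of the poset, hence M alone. Leaving the other irreducible matroids out is
  thus exactly what reduces the image under \<open>phi\<close> to a single basis vector.\<close>

abbreviation rk :: "'a matroid \<Rightarrow> 'a set \<Rightarrow> nat" where
  "rk M X \<equiv> rank (mrestrict M X)"

lemma mrestrict_ground [simp]: "mrestrict M (ground M) = M"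
  by (rule matroid_eqI) (auto dest: indep_ground)

lemma mrestrict_mrestrict [simp]: "mrestrict (mrestrict M A) B = mrestrict M (A \<inter> B)"
  by (rule matroid_eqI) auto

lemma indep_iff_rk: "indep M X \<longleftrightarrow> finite X \<and> card X \<le> rk M X"
proof
  assume "indep M X"
  then show "finite X \<and> card X \<le> rk M X"
    using indep_card_le[of "mrestrict M X" X] by (simp add: indep_finite)
next
  assume X: "finite X \<and> card X \<le> rk M X"
  obtain I where I: "indep (mrestrict M X) I" "card I = rk M X" using ex_indep_rank by metis
  then have "I = X" using X by (intro card_seteq) auto
  then show "indep M X" using I(1) by simp
qed

lemma rk_indep: "indep M X \<Longrightarrow> rk M X = card X"
proof (rule antisym)
  assume X: "indep M X"
  show "card X \<le> rk M X" using X by (simp add: indep_iff_rk)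
  obtain I where "indep (mrestrict M X) I" "card I = rk M X" using ex_indep_rank by metis
  then show "rk M X \<le> card X" using X by (metis card_mono indep_finite indep_restrict)
qed

lemma rk_empty [simp]: "rk M {} = 0"
  using rk_indep[of M "{}"] by simp

text \<open>Stated additively because subtraction of natural numbers truncates. Both inequalities
  come from a basis of \<open>M\<close> restricted to A that is extended to an independent set in
  \<open>X \<union> A\<close>.\<close>

lemma rk_contract:
  assumes X: "X \<subseteq> ground M - A"
  shows "rk (mcontract M A) X + rk M A = rk M (X \<union> A)"
proof (rule antisym)
  obtain J where J: "basis (mrestrict (mcontract M A) X) J" using ex_basis by metis
  then obtain I where I: "basis (mrestrict M A) I" "indep M (J \<union> I)" and JX: "J \<subseteq> X"
    using basis_indep[OF J] by (auto simp: indep_contract)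
  have IA: "I \<subseteq> A" using basis_indep[OF I(1)] by simp
  have "card (J \<union> I) = card J + card I"
    using JX IA X I(2) by (intro card_Un_disjoint) (auto dest: indep_finite)
  moreover have "card (J \<union> I) \<le> rk M (X \<union> A)"
    using I(2) JX IA by (intro indep_card_le) auto
  ultimately show "rk (mcontract M A) X + rk M A \<le> rk M (X \<union> A)"
    using J I(1) by (simp add: basis_iff)
next
  obtain I where I: "basis (mrestrict M A) I" using ex_basis by metis
  then have "indep (mrestrict M (X \<union> A)) I" using basis_indep[OF I] by auto
  then obtain K where K: "basis (mrestrict M (X \<union> A)) K" "I \<subseteq> K"
    using extend_basis by metis
  have KI: "indep M K" "K \<subseteq> X \<union> A" using basis_indep[OF K(1)] by auto
  have IA: "I \<subseteq> A" using basis_indep[OF I] by simp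
  have KA: "K \<inter> A = I"
  proof
    show "K \<inter> A \<subseteq> I"
    proof
      fix z assume "z \<in> K \<inter> A"
      moreover have "indep M (insert z I)"
        using KI(1) by (rule indep_subset) (use K(2) \<open>z \<in> K \<inter> A\<close> in auto)
      ultimately show "z \<in> I" using basis_restrict_insert[OF I] by blast
    qed
  qed (use IA K(2) in auto)
  have "(K - A) \<union> I = K" using KA by blast
  then have "indep (mrestrict (mcontract M A) X) (K - A)"
    using I KI X by (auto simp: indep_contract)
  from indep_card_le[OF this] have "card (K - A) \<le> rk (mcontract M A) X" .
  moreover have "card K = card (K - A) + card I"
    using KA indep_finite[OF KI(1)] by (metis card_Diff_subset_Int card_Int_Diff finite_Int add.commute)
  ultimately show "rk M (X \<union> A) \<le> rk (mcontract M A) X + rk M A"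
    using K(1) I by (simp add: basis_iff)
qed

text \<open>Trades the basis of the contracted set, existentially quantified in the definition of
  contraction, for a numerical condition, so that iterated contractions can be compared by rank
  alone.\<close>

lemma indep_contract_iff_rk:
  "indep (mcontract M A) X \<longleftrightarrow> X \<subseteq> ground M - A \<and> card X + rk M A \<le> rk M (X \<union> A)"
proof (cases "X \<subseteq> ground M - A")
  case True
  then have "finite X" by (meson finite_Diff finite_ground finite_subset)
  then show ?thesis using rk_contract[OF True] True
    unfolding indep_iff_rk[of "mcontract M A"] by linarith
next
  case False
  then show ?thesis using indep_ground[of "mcontract M A" X] by auto
qed

lemma mcontract_empty [simp]: "mcontract M {} = M"
proof (rule matroid_eqI)
  fix X
  have "basis (mrestrict M {}) B \<longleftrightarrow> B = {}" for B
    by (auto simp: basis_def)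
  then show "indep (mcontract M {}) X \<longleftrightarrow> indep M X"
    by (auto simp: indep_contract dest: indep_ground)
qed simp

lemma mcontract_mcontract:
  assumes "B \<subseteq> ground M"  "A \<inter> B = {}"
  shows "mcontract (mcontract M A) B = mcontract M (A \<union> B)"
proof (rule matroid_eqI)
  show g: "ground (mcontract (mcontract M A) B) = ground (mcontract M (A \<union> B))" by auto
  fix X
  show "indep (mcontract (mcontract M A) B) X \<longleftrightarrow> indep (mcontract M (A \<union> B)) X"
  proof (cases "X \<subseteq> ground M - (A \<union> B)")
    case True
    have "rk (mcontract M A) (X \<union> B) + rk M A = rk M (X \<union> (A \<union> B))"
      "rk (mcontract M A) B + rk M A = rk M (A \<union> B)"
      using rk_contract[of "X \<union> B" M A] rk_contract[of B M A] True assms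
      by (auto simp: ac_simps)
    then show ?thesis using True assms
      unfolding indep_contract_iff_rk by auto
  next
    case False
    then show ?thesis unfolding indep_contract_iff_rk by auto
  qed
qed

lemma mrestrict_mcontract:
  assumes "A \<subseteq> B"
  shows "mrestrict (mcontract M A) (B - A) = mcontract (mrestrict M B) A"
proof (rule matroid_eqI)
  show "ground (mrestrict (mcontract M A) (B - A)) = ground (mcontract (mrestrict M B) A)" by auto
  fix X
  have "B \<inter> A = A" using assms by blast
  moreover have "I \<subseteq> B" if "basis (mrestrict M A) I" for I
    using basis_indep[OF that] assms by auto
  ultimately show "indep (mrestrict (mcontract M A) (B - A)) X \<longleftrightarrow> indep (mcontract (mrestrict M B) A) X"
    unfolding indep_restrict indep_contract mrestrict_mrestrict ground_restrict by auto
qed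

lemma rank_contract: "A \<subseteq> ground M \<Longrightarrow> rank (mcontract M A) + rk M A = rank M"
proof -
  assume A: "A \<subseteq> ground M"
  have *: "(ground M - A) \<union> A = ground M" using A by blast
  have "mrestrict (mcontract M A) (ground M - A) = mcontract M A"
    using mrestrict_ground[of "mcontract M A"] by simp
  then show ?thesis using rk_contract[of "ground M - A" M A] unfolding * by simp
qed

section \<open>Free products and free separators\<close>

lemma indep_free_product:
  assumes disj: "ground M \<inter> ground N = {}"
  shows "indep (M \<box> N) X \<longleftrightarrow> X \<subseteq> ground M \<union> ground N \<and> indep M (X \<inter> ground M)
    \<and> card X \<le> rank M + rk N (X \<inter> ground N)"
proof
  assume X: "indep (M \<box> N) X"
  then obtain B where B: "basis (M \<box> N) B" "X \<subseteq> B" using extend_basis by metis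
  have b: "B \<subseteq> ground M \<union> ground N" "card B = rank M + rank N" "indep M (B \<inter> ground M)"
    "rk N (B \<inter> ground N) = rank N"
    using B(1) unfolding basis_free_product[OF disj] spans_iff_rank by auto
  have fB: "finite B" using b(1) by (meson finite_UnI finite_ground finite_subset)
  have "rk N (B \<inter> ground N) \<le> rk N (X \<inter> ground N) + card (B \<inter> ground N - X \<inter> ground N)"
    using fB B(2) by (intro rank_restrict_le) auto
  also have "card (B \<inter> ground N - X \<inter> ground N) \<le> card (B - X)"
    using fB by (intro card_mono) auto
  also have "\<dots> = card B - card X" using fB B(2) by (meson card_Diff_subset finite_subset)
  finally have "card X \<le> rank M + rk N (X \<inter> ground N)"
    using b card_mono[OF fB B(2)] by simp
  moreover have "indep M (X \<inter> ground M)" using b(3) by (rule indep_subset) (use B(2) in auto)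
  ultimately show "X \<subseteq> ground M \<union> ground N \<and> indep M (X \<inter> ground M)
    \<and> card X \<le> rank M + rk N (X \<inter> ground N)" using B(2) b(1) by blast
next
  assume X: "X \<subseteq> ground M \<union> ground N \<and> indep M (X \<inter> ground M)
    \<and> card X \<le> rank M + rk N (X \<inter> ground N)"
  obtain I where I: "basis M I" "X \<inter> ground M \<subseteq> I" using X extend_basis by metis
  obtain J where J: "basis (mrestrict N (X \<inter> ground N)) J" using ex_basis by metis
  have JX: "J \<subseteq> X \<inter> ground N" "indep N J" using basis_indep[OF J] by auto
  obtain K where K: "basis N K" "J \<subseteq> K" using JX(2) extend_basis by metis
  have IM: "I \<subseteq> ground M" "K \<subseteq> ground N" using I K by (auto dest: basis_ground)
  have fin: "finite I" "finite K" "finite X"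
    using I K X by (auto dest: basis_indep indep_finite intro: finite_subset)
  have KX: "K \<inter> X = J"
  proof
    show "K \<inter> X \<subseteq> J"
    proof
      fix z assume z: "z \<in> K \<inter> X"
      have "indep N (insert z J)"
        using basis_indep[OF K(1)] by (rule indep_subset) (use K(2) z in auto)
      then show "z \<in> J" using basis_restrict_insert[OF J] z IM by blast
    qed
  qed (use JX K in auto)
  have "card (X \<union> K) = card X + card (K - X)"
    using fin by (metis Un_Diff_cancel card_Un_disjoint Diff_disjoint finite_Diff)
  also have "card (K - X) = card K - card J"
    using KX fin by (metis card_Diff_subset_Int Int_commute finite_Int)
  finally have "card (X \<union> K) = card X + (rank N - rk N (X \<inter> ground N))"
    using K J by (simp add: basis_iff)
  then have le: "card (X \<union> K) \<le> rank M + rank N"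
    using X rank_restrict_le_rank[of N "X \<inter> ground N"] by linarith
  have "rank M + rank N = card (I \<union> K)"
    using I(1) K(1) IM fin disj by (subst card_Un_disjoint) (auto simp: basis_iff)
  also have "\<dots> \<le> card (I \<union> X \<union> K)" using fin by (intro card_mono) auto
  finally have ge: "rank M + rank N \<le> card (I \<union> X \<union> K)" .
  \<comment> \<open>Containing K makes the part of B in \<open>N\<close> spanning, and lying inside
    \<open>I \<union> X \<union> K\<close> keeps the part in \<open>M\<close> within I. Only the
    size is left to adjust, and \<open>le\<close> and \<open>ge\<close> say that the required size
    fits between the two bounds.\<close>
  obtain B where B: "X \<union> K \<subseteq> B" "B \<subseteq> I \<union> X \<union> K" "card B = rank M + rank N"
    using exists_subset_between[OF le ge] fin by blast
  have "B \<inter> ground M \<subseteq> I"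
  proof
    fix x assume x: "x \<in> B \<inter> ground M"
    then have "x \<notin> K" using IM(2) disj by auto
    then show "x \<in> I" using x B(2) I(2) by auto
  qed
  with basis_indep[OF I(1)] have "indep M (B \<inter> ground M)" by (rule indep_subset)
  moreover have "spans N (B \<inter> ground N)"
    unfolding spans_def using K(1) B(1) IM(2) by (intro conjI exI[of _ K]) auto
  moreover have "B \<subseteq> ground M \<union> ground N" using B(2) X IM by auto
  ultimately have "basis (M \<box> N) B"
    unfolding basis_free_product[OF disj] using B(3) by simp
  then show "indep (M \<box> N) X" using B(1) indep_iff_basis by (metis Un_subset_iff)
qed

lemma rk_mono: "A \<subseteq> B \<Longrightarrow> rk M A \<le> rk M B"
  by (rule rank_restrict_mono)

lemma weak_le_ground: "weak_le M N \<Longrightarrow> ground M = ground N"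
  by (simp add: weak_le_def)

lemma weak_le_rank: "weak_le M N \<Longrightarrow> rank M = rank N"
  using ex_basis[of M] unfolding weak_le_def basis_iff by metis

lemma weak_le_indep: "weak_le M N \<Longrightarrow> indep M X \<Longrightarrow> indep N X"
  unfolding weak_le_def indep_iff_basis by blast

lemma weak_leI:
  "ground M = ground N \<Longrightarrow> rank M = rank N \<Longrightarrow> (\<And>X. indep M X \<Longrightarrow> indep N X) \<Longrightarrow> weak_le M N"
  unfolding weak_le_def basis_iff by simp

lemma weak_le_refl: "weak_le M M"
  by (simp add: weak_le_def)

lemma weak_le_trans: "weak_le M N \<Longrightarrow> weak_le N P \<Longrightarrow> weak_le M P"
  by (simp add: weak_le_def)

lemma weak_le_rk:
  assumes "weak_le M N"
  shows "rk M X \<le> rk N X"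
proof -
  obtain I where "indep (mrestrict M X) I" "card I = rk M X" using ex_indep_rank by metis
  then show ?thesis
    using indep_card_le[of "mrestrict N X" I] weak_le_indep[OF assms, of I] by simp
qed

lemma mrestrict_free_product:
  assumes "ground M \<inter> ground N = {}"
  shows "mrestrict (M \<box> N) (ground M) = M"
proof (rule matroid_eqI)
  show "ground (mrestrict (M \<box> N) (ground M)) = ground M"
    by (auto simp: ground_free_product[OF assms])
  fix X
  have "indep M X \<Longrightarrow> card X \<le> rank M + n" for n using indep_card_le[of M X] by simp
  then show "indep (mrestrict (M \<box> N) (ground M)) X \<longleftrightarrow> indep M X"
    using indep_ground[of M X] by (auto simp: indep_free_product[OF assms] Int_absorb2)
qed

lemma mcontract_free_product:
  assumes "ground M \<inter> ground N = {}"
  shows "mcontract (M \<box> N) (ground M) = N"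
proof (rule matroid_eqI)
  show g: "ground (mcontract (M \<box> N) (ground M)) = ground N"
    using assms by (auto simp: ground_free_product[OF assms])
  fix X
  show "indep (mcontract (M \<box> N) (ground M)) X \<longleftrightarrow> indep N X"
  proof (cases "X \<subseteq> ground N")
    case True
    have "indep (mcontract (M \<box> N) (ground M)) X \<longleftrightarrow> (\<exists>B. basis M B \<and> indep (M \<box> N) (X \<union> B))"
      using True assms
      by (auto simp: indep_contract ground_free_product[OF assms] mrestrict_free_product[OF assms])
    also have "\<dots> \<longleftrightarrow> (\<exists>B. basis M B \<and> card X \<le> rk N X)"
    proof (intro ex_cong1 conj_cong refl)
      fix B assume B: "basis M B"
      have BM: "B \<subseteq> ground M" using B by (rule basis_ground)
      have e: "(X \<union> B) \<inter> ground M = B" "(X \<union> B) \<inter> ground N = X" using BM True assms by auto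
      have "card (X \<union> B) = card X + card B"
        using True BM assms by (intro card_Un_disjoint) (auto intro: finite_subset[OF _ finite_ground])
      then show "indep (M \<box> N) (X \<union> B) \<longleftrightarrow> card X \<le> rk N X"
        using B True BM unfolding indep_free_product[OF assms] e basis_iff by auto
    qed
    also have "\<dots> \<longleftrightarrow> indep N X"
      using ex_basis[of M] True finite_subset[OF True] by (simp add: indep_iff_rk[of N])
    finally show ?thesis .
  next
    case False
    then show ?thesis using g indep_ground by metis
  qed
qed

lemma weak_le_free_product:
  assumes "ground M \<inter> ground N = {}" "weak_le N N'"
  shows "weak_le (M \<box> N) (M \<box> N')"
proof (rule weak_leI)
  have d: "ground M \<inter> ground N' = {}" using assms weak_le_ground[OF assms(2)] by simp
  show "ground (M \<box> N) = ground (M \<box> N')" "rank (M \<box> N) = rank (M \<box> N')"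
    using weak_le_ground[OF assms(2)] weak_le_rank[OF assms(2)]
    by (simp_all add: ground_free_product rank_free_product d assms(1))
  show "indep (M \<box> N') X" if "indep (M \<box> N) X" for X
    using that weak_le_rk[OF assms(2), of "X \<inter> ground N"] weak_le_ground[OF assms(2)]
    unfolding indep_free_product[OF d] indep_free_product[OF assms(1)] by auto
qed

section \<open>Splitting a matroid along a set\<close>

text \<open>The set comes first so that \<open>separation A\<close> is an operator on matroids, the
  future closure operator.\<close>

definition separation :: "'a set \<Rightarrow> 'a matroid \<Rightarrow> 'a matroid" where
  "separation A M = mrestrict M A \<box> mcontract M A"

definition free_separator :: "'a matroid \<Rightarrow> 'a set \<Rightarrow> bool" where
  "free_separator M A \<longleftrightarrow> A \<subseteq> ground M \<and> separation A M = M"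

lemma minors_disjoint: "ground (mrestrict M A) \<inter> ground (mcontract M A) = {}"
  by auto

lemma ground_separation: "A \<subseteq> ground M \<Longrightarrow> ground (separation A M) = ground M"
  by (auto simp: separation_def ground_free_product[OF minors_disjoint])

lemma rank_separation: "A \<subseteq> ground M \<Longrightarrow> rank (separation A M) = rank M"
  using rank_contract[of A M]
  by (simp add: separation_def rank_free_product[OF minors_disjoint])

text \<open>Only ranks and independence in \<open>M\<close> itself occur on the right, so that
  \<open>separation A\<close> is seen to be extensive and monotone from the monotonicity of rank in
  the set and along the weak order.\<close>

lemma indep_separation:
  assumes "A \<subseteq> ground M"
  shows "indep (separation A M) X
    \<longleftrightarrow> X \<subseteq> ground M \<and> indep M (X \<inter> A) \<and> card X \<le> rk M (X \<union> A)"
proof (cases "X \<subseteq> ground M")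
  case True
  then have "rk (mcontract M A) (X - A) + rk M A = rk M (X - A \<union> A)"
    by (intro rk_contract) auto
  moreover have "A \<inter> ground M = A" "X - A \<union> A = X \<union> A" "X \<inter> (ground M - A) = X - A"
    using assms True by auto
  ultimately show ?thesis
    using True assms unfolding separation_def indep_free_product[OF minors_disjoint]
    by (auto simp: add.commute)
next
  case False
  then show ?thesis
    using ground_separation[OF assms] indep_ground[of "separation A M" X] by auto
qed

lemma separation_weak_ge: "A \<subseteq> ground M \<Longrightarrow> weak_le M (separation A M)"
proof (rule weak_leI)
  fix X assume A: "A \<subseteq> ground M" and X: "indep M X"
  have "card X \<le> rk M X" using X by (simp add: indep_iff_rk)
  also have "\<dots> \<le> rk M (X \<union> A)" by (rule rk_mono) simp
  finally show "indep (separation A M) X"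
    using X A indep_subset[OF X, of "X \<inter> A"] indep_ground[OF X] by (simp add: indep_separation)
qed (simp_all add: ground_separation rank_separation)

lemma separation_mono:
  assumes "A \<subseteq> ground M" "weak_le M N"
  shows "weak_le (separation A M) (separation A N)"
proof (rule weak_leI)
  have A: "A \<subseteq> ground N" using assms weak_le_ground by blast
  show "ground (separation A M) = ground (separation A N)" "rank (separation A M) = rank (separation A N)"
    using assms A weak_le_ground[OF assms(2)] weak_le_rank[OF assms(2)]
    by (simp_all add: ground_separation rank_separation)
  show "indep (separation A N) X" if "indep (separation A M) X" for X
    using that weak_le_rk[OF assms(2), of "X \<union> A"] weak_le_indep[OF assms(2), of "X \<inter> A"]
      weak_le_ground[OF assms(2)]
    unfolding indep_separation[OF A] indep_separation[OF assms(1)] by auto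
qed

lemma mrestrict_separation: "A \<subseteq> ground M \<Longrightarrow> mrestrict (separation A M) A = mrestrict M A"
  using mrestrict_free_product[OF minors_disjoint, of M A]
  by (simp add: separation_def Int_absorb2)

lemma mcontract_separation: "A \<subseteq> ground M \<Longrightarrow> mcontract (separation A M) A = mcontract M A"
  using mcontract_free_product[OF minors_disjoint, of M A]
  by (simp add: separation_def Int_absorb2)

lemma separation_idem: "A \<subseteq> ground M \<Longrightarrow> separation A (separation A M) = separation A M"
  by (simp add: separation_def[of A "separation A M"] mrestrict_separation mcontract_separation)
    (simp add: separation_def)

lemma free_separator_ground: "free_separator M A \<Longrightarrow> A \<subseteq> ground M"
  by (simp add: free_separator_def)

lemma free_separator_product:
  "ground M \<inter> ground N = {} \<Longrightarrow> free_separator (M \<box> N) (ground M)"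
  by (simp add: free_separator_def separation_def ground_free_product mrestrict_free_product
      mcontract_free_product)

text \<open>\<open>M\<close> always lies below its separation, so only the opposite inclusion of
  independent sets is a condition.\<close>

lemma free_separator_iff:
  "free_separator M A \<longleftrightarrow> A \<subseteq> ground M
    \<and> (\<forall>X\<subseteq>ground M. indep M (X \<inter> A) \<longrightarrow> card X \<le> rk M (X \<union> A) \<longrightarrow> indep M X)"
proof (cases "A \<subseteq> ground M")
  case True
  have "separation A M = M \<longleftrightarrow> (\<forall>X. indep (separation A M) X \<longrightarrow> indep M X)"
    using weak_le_indep[OF separation_weak_ge[OF True]] ground_separation[OF True]
    by (metis matroid_eqI)
  then show ?thesis using True by (auto simp: free_separator_def indep_separation)
qed (simp add: free_separator_def)

text \<open>The factors of a free product are recovered as the restriction to, and the contraction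
  by, the first ground set; a proper factorization is therefore the same datum as a proper nonempty
  free separator.\<close>

lemma irreducible_iff:
  "irreducible_matroid M \<longleftrightarrow>
    ground M \<noteq> {} \<and> (\<forall>A. free_separator M A \<longrightarrow> A = {} \<or> A = ground M)"
proof -
  have "(\<exists>P Q. ground P \<noteq> {} \<and> ground Q \<noteq> {} \<and> ground P \<inter> ground Q = {} \<and> M = P \<box> Q)
    \<longleftrightarrow> (\<exists>A. free_separator M A \<and> A \<noteq> {} \<and> A \<noteq> ground M)" (is "?L \<longleftrightarrow> ?R")
  proof
    assume ?L
    then obtain P Q where PQ: "ground P \<noteq> {}" "ground Q \<noteq> {}" "ground P \<inter> ground Q = {}" "M = P \<box> Q"
      by blast
    then have "free_separator M (ground P)" using free_separator_product by blast
    moreover have "ground P \<noteq> ground M" using PQ(2,3) by (auto simp: PQ(4) ground_free_product[OF PQ(3)])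
    ultimately show ?R using PQ(1) by blast
  next
    assume ?R
    then obtain A where A: "A \<subseteq> ground M" "M = mrestrict M A \<box> mcontract M A" "A \<noteq> {}" "A \<noteq> ground M"
      unfolding free_separator_def separation_def by metis
    moreover have "ground (mrestrict M A) \<noteq> {}" "ground (mcontract M A) \<noteq> {}"
      using A(1,3,4) by auto
    ultimately show ?L using minors_disjoint by metis
  qed
  then show ?thesis unfolding irreducible_matroid_def by blast
qed

lemma irreducible_nonempty: "irreducible_matroid M \<Longrightarrow> ground M \<noteq> {}"
  by (simp add: irreducible_matroid_def)

lemma irreducible_singleton: "ground M = {a} \<Longrightarrow> irreducible_matroid M"
  unfolding irreducible_iff using free_separator_ground[of M] by force

section \<open>Circuits, closures and the calculus of free separators\<close>

definition circuit :: "'a matroid \<Rightarrow> 'a set \<Rightarrow> bool" where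
  "circuit M C \<longleftrightarrow> C \<subseteq> ground M \<and> \<not> indep M C \<and> (\<forall>x\<in>C. indep M (C - {x}))"

lemma circuit_nonempty: "circuit M C \<Longrightarrow> C \<noteq> {}"
  unfolding circuit_def by force

lemma circuit_psubset: "circuit M C \<Longrightarrow> X \<subset> C \<Longrightarrow> indep M X"
proof -
  assume C: "circuit M C" and X: "X \<subset> C"
  then obtain x where "x \<in> C" "X \<subseteq> C - {x}" by blast
  then show ?thesis using C indep_subset unfolding circuit_def by blast
qed

lemma ex_circuit:
  assumes "X \<subseteq> ground M" "\<not> indep M X"
  shows "\<exists>C\<subseteq>X. circuit M C"
proof -
  have "finite X" using assms(1) finite_ground by (rule finite_subset)
  then show ?thesis using assms
  proof (induction X rule: finite_psubset_induct)
    case (psubset X)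
    show ?case
    proof (cases "\<forall>x\<in>X. indep M (X - {x})")
      case True
      then show ?thesis using psubset.prems unfolding circuit_def by blast
    next
      case False
      then obtain x where "x \<in> X" "\<not> indep M (X - {x})" by blast
      then show ?thesis using psubset.IH[of "X - {x}"] psubset.prems by blast
    qed
  qed
qed

lemma circuit_finite: "circuit M C \<Longrightarrow> finite C"
  unfolding circuit_def using finite_ground finite_subset by blast

lemma rk_circuit:
  assumes "circuit M C"
  shows "Suc (rk M C) = card C"
proof -
  obtain x where x: "x \<in> C" using circuit_nonempty[OF assms] by blast
  have "card (C - {x}) \<le> rk M (C - {x})"
    using assms x by (auto simp: circuit_def indep_iff_rk)
  also have "\<dots> \<le> rk M C" by (rule rk_mono) blast
  finally have "card C - 1 \<le> rk M C" using x by simp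
  moreover have "\<not> card C \<le> rk M C"
    using assms circuit_finite[OF assms] by (auto simp: circuit_def indep_iff_rk)
  ultimately show ?thesis by simp
qed

lemma circuit_restrict: "circuit (mrestrict M A) C \<longleftrightarrow> circuit M C \<and> C \<subseteq> A"
  unfolding circuit_def by auto

text \<open>The equation \<open>rk M (C \<union> A) = rk M C\<close> stands for A lying in the
  closure of C. This lemma and the next two are the rules of closure needed below.\<close>

lemma rk_closure_Un:
  assumes "rk M (C \<union> A) = rk M C" "rk M (C \<union> B) = rk M C"
  shows "rk M (C \<union> (A \<union> B)) = rk M C"
proof (rule rank_restrict_closure)
  fix y assume "y \<in> A \<union> B"
  then have "rk M (insert y C) \<le> rk M (C \<union> A) \<or> rk M (insert y C) \<le> rk M (C \<union> B)"
    by (auto intro: rk_mono)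
  moreover have "rk M C \<le> rk M (insert y C)" by (rule rk_mono) blast
  ultimately show "rk M (insert y C) = rk M C" using assms by linarith
qed

lemma rk_closure_subset:
  assumes "rk M (C \<union> A) = rk M C" "B \<subseteq> A"
  shows "rk M (C \<union> B) = rk M C"
  using rk_mono[of "C \<union> B" "C \<union> A" M] rk_mono[of C "C \<union> B" M] assms by force

text \<open>If some y in A raised the rank of D, it could be added to a basis of D that extends a
  basis I of C. Then \<open>insert y I\<close> would be independent in \<open>C \<union> A\<close>,
  whose rank is only \<open>card I\<close>.\<close>

lemma rk_closure_mono:
  assumes CA: "rk M (C \<union> A) = rk M C" and CD: "C \<subseteq> D"
  shows "rk M (D \<union> A) = rk M D"
proof (rule rank_restrict_closure)
  fix y assume y: "y \<in> A"
  show "rk M (insert y D) = rk M D"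
  proof (rule ccontr)
    assume ne: "rk M (insert y D) \<noteq> rk M D"
    obtain I where I: "basis (mrestrict M C) I" using ex_basis by metis
    then have "indep (mrestrict M D) I" using basis_indep[OF I] CD by auto
    then obtain J where J: "basis (mrestrict M D) J" "I \<subseteq> J" using extend_basis by metis
    then have "indep (mrestrict M (insert y D)) J" using basis_indep[OF J(1)] by auto
    then obtain K where K: "basis (mrestrict M (insert y D)) K" "J \<subseteq> K" using extend_basis by metis
    have "J \<noteq> K" using ne J(1) K(1) by (auto simp: basis_iff)
    then obtain z where z: "z \<in> K" "z \<notin> J" using K(2) by blast
    have KM: "K \<subseteq> insert y D" "indep M K" using basis_indep[OF K(1)] by auto
    have "indep M (insert z J)" using KM(2) by (rule indep_subset) (use z K in auto)
    then have "z = y" using basis_restrict_insert[OF J(1), of z] z KM(1) by blast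
    have "indep M (insert y I)"
      using KM(2) by (rule indep_subset) (use z K J \<open>z = y\<close> in auto)
    then have "indep (mrestrict M (insert y C)) (insert y I)"
      using basis_indep[OF I] by auto
    from indep_card_le[OF this] have "card (insert y I) \<le> rk M (insert y C)" .
    also have "\<dots> \<le> rk M (C \<union> A)" by (rule rk_mono) (use y in blast)
    also have "\<dots> = card I" using I CA by (simp add: basis_iff)
    finally have "card (insert y I) \<le> card I" .
    moreover have "y \<notin> I" using z(2) \<open>z = y\<close> J(2) by blast
    ultimately show False
      using indep_finite[OF basis_indep[OF I]] by simp
  qed
qed

text \<open>In terms of closures: every circuit lies in the separator or spans it. In this form
  intersections are immediate.\<close>

lemma free_separator_iff_circuits:
  "free_separator M A \<longleftrightarrow> A \<subseteq> ground M
    \<and> (\<forall>C. circuit M C \<longrightarrow> C \<subseteq> A \<or> rk M (C \<union> A) = rk M C)"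
proof (cases "A \<subseteq> ground M")
  case A: True
  show ?thesis
  proof (intro iffI conjI A allI impI)
    fix C assume sep: "free_separator M A" and C: "circuit M C"
    show "C \<subseteq> A \<or> rk M (C \<union> A) = rk M C"
    proof (cases "C \<subseteq> A")
      case False
      then have "indep M (C \<inter> A)" using C by (intro circuit_psubset[of M C]) auto
      \<comment> \<open>Otherwise the separator condition would make the circuit independent. As the
        rank of C is one less than its size, this bound leaves no room for A to raise it.\<close>
      then have "\<not> card C \<le> rk M (C \<union> A)"
        using sep C unfolding free_separator_iff circuit_def by blast
      then show ?thesis
        using rk_circuit[OF C] rk_mono[of C "C \<union> A" M] by simp
    qed simp
  next
    assume R: "A \<subseteq> ground M \<and> (\<forall>C. circuit M C \<longrightarrow> C \<subseteq> A \<or> rk M (C \<union> A) = rk M C)"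
    have "indep M X"
      if X: "X \<subseteq> ground M" "indep M (X \<inter> A)" "card X \<le> rk M (X \<union> A)" for X
    proof (rule ccontr)
      assume dep: "\<not> indep M X"
      then obtain C where C: "C \<subseteq> X" "circuit M C" using ex_circuit X(1) by metis
      have "\<not> C \<subseteq> A" using C indep_subset[OF X(2), of C] by (auto simp: circuit_def)
      then have "rk M (C \<union> A) = rk M C" using R C by blast
      then have "rk M (X \<union> A) = rk M X" using C(1) by (rule rk_closure_mono)
      then show False
        using dep X finite_subset[OF X(1)] by (simp add: indep_iff_rk)
    qed
    then show "free_separator M A" using A by (simp add: free_separator_iff)
  qed
qed (simp add: free_separator_def)

lemma free_separator_Int:
  assumes "free_separator M A" "free_separator M B"
  shows "free_separator M (A \<inter> B)"
  unfolding free_separator_iff_circuits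
proof (intro conjI allI impI)
  show "A \<inter> B \<subseteq> ground M" using free_separator_ground[OF assms(1)] by blast
  fix C assume C: "circuit M C"
  have "C \<subseteq> A \<or> rk M (C \<union> A) = rk M C" "C \<subseteq> B \<or> rk M (C \<union> B) = rk M C"
    using assms C by (auto simp: free_separator_iff_circuits)
  then show "C \<subseteq> A \<inter> B \<or> rk M (C \<union> A \<inter> B) = rk M C"
    using rk_closure_subset[of M C _ "A \<inter> B"] by blast
qed

lemma free_separator_restrict:
  assumes "free_separator M A" "A \<subseteq> B"
  shows "free_separator (mrestrict M B) A"
  unfolding free_separator_iff_circuits
proof (intro conjI allI impI)
  show "A \<subseteq> ground (mrestrict M B)" using assms free_separator_ground by auto
  fix C assume C: "circuit (mrestrict M B) C"
  then have "B \<inter> C = C" "B \<inter> (C \<union> A) = C \<union> A" using assms by (auto simp: circuit_restrict)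
  then show "C \<subseteq> A \<or> rk (mrestrict M B) (C \<union> A) = rk (mrestrict M B) C"
    using assms(1) C by (simp add: circuit_restrict free_separator_iff_circuits)
qed

lemma free_separator_trans:
  assumes "free_separator M A" "free_separator (mrestrict M A) B"
  shows "free_separator M B"
  unfolding free_separator_iff_circuits
proof (intro conjI allI impI)
  have BA: "B \<subseteq> A" "B \<subseteq> ground M" using free_separator_ground[OF assms(2)] by auto
  show "B \<subseteq> ground M" by fact
  fix C assume C: "circuit M C"
  consider "C \<subseteq> A" | "rk M (C \<union> A) = rk M C"
    using assms(1) C by (auto simp: free_separator_iff_circuits)
  then show "C \<subseteq> B \<or> rk M (C \<union> B) = rk M C"
  proof cases
    case 1
    then have "A \<inter> C = C" "A \<inter> (C \<union> B) = C \<union> B" using BA by auto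
    moreover have "C \<subseteq> B \<or> rk (mrestrict M A) (C \<union> B) = rk (mrestrict M A) C"
      using assms(2) C 1 by (simp add: circuit_restrict free_separator_iff_circuits)
    ultimately show ?thesis by simp
  next
    case 2
    then show ?thesis using BA(1) rk_closure_subset by blast
  qed
qed

text \<open>Proved from independent sets because circuits of a contraction need not be circuits of
  \<open>M\<close>; adding a basis I of the contracted set carries X over to
  \<open>M\<close>.\<close>

lemma free_separator_contract:
  assumes "free_separator M B" "A \<subseteq> B"
  shows "free_separator (mcontract M A) (B - A)"
  unfolding free_separator_iff
proof (intro conjI allI impI)
  show "B - A \<subseteq> ground (mcontract M A)" using free_separator_ground[OF assms(1)] by auto
  fix X assume X: "X \<subseteq> ground (mcontract M A)" "indep (mcontract M A) (X \<inter> (B - A))"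
    "card X \<le> rk (mcontract M A) (X \<union> (B - A))"
  obtain I where I: "basis (mrestrict M A) I" "indep M (X \<inter> (B - A) \<union> I)"
    using X(2) by (auto simp: indep_contract)
  have IA: "I \<subseteq> A" using basis_indep[OF I(1)] by simp
  have IM: "I \<subseteq> ground M" using indep_ground[OF I(2)] by blast
  have e: "(X \<union> I) \<inter> B = X \<inter> (B - A) \<union> I" using IA assms(2) X(1) by auto
  have XB: "X \<union> (B - A) \<subseteq> ground M - A" using X(1) free_separator_ground[OF assms(1)] by auto
  have "(X \<union> (B - A)) \<union> A = X \<union> B" using assms(2) by blast
  then have "card X + rk M A \<le> rk M (X \<union> B)" using X(3) rk_contract[OF XB] by simp
  also have "X \<union> B = (X \<union> I) \<union> B" using IA assms(2) by blast
  finally have "card (X \<union> I) \<le> rk M ((X \<union> I) \<union> B)"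
    using I(1) card_Un_le[of X I] by (simp add: basis_iff)
  moreover have "X \<union> I \<subseteq> ground M" using X(1) IM by auto
  ultimately have "indep M (X \<union> I)"
    using assms(1) I(2)[folded e] unfolding free_separator_iff by blast
  then show "indep (mcontract M A) X" using I(1) X(1) by (auto simp: indep_contract)
qed

text \<open>A circuit C that fails to span A lies in A, hence not in B, hence spans B. For b in B
  there is a circuit through b inside \<open>C \<union> {b}\<close>; it leaves A, so it spans A. As
  b is already in the closure of C, so is A.\<close>

lemma free_separator_disjoint_closure:
  assumes A: "free_separator M A" and B: "free_separator M B" and disj: "A \<inter> B = {}"
    and ne: "B \<noteq> {}" and C: "circuit M C"
  shows "rk M (C \<union> A) = rk M C"
proof (rule ccontr)
  assume no: "rk M (C \<union> A) \<noteq> rk M C"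
  then have CA: "C \<subseteq> A" using A C by (auto simp: free_separator_iff_circuits)
  then have "\<not> C \<subseteq> B" using disj circuit_nonempty[OF C] by blast
  then have CB: "rk M (C \<union> B) = rk M C" using B C by (auto simp: free_separator_iff_circuits)
  obtain b where b: "b \<in> B" using ne by blast
  have bC: "rk M (C \<union> {b}) = rk M C" using CB by (rule rk_closure_subset) (use b in blast)
  obtain I where I: "basis (mrestrict M C) I" using ex_basis by metis
  have IC: "I \<subseteq> C" "indep M I" using basis_indep[OF I] by auto
  have bI: "b \<notin> I" using IC(1) CA b disj by blast
  have "\<not> indep M (insert b I)"
  proof
    assume "indep M (insert b I)"
    then have "indep (mrestrict M (C \<union> {b})) (insert b I)" using IC by auto
    from indep_card_le[OF this] show False
      using bC I bI indep_finite[OF IC(2)] by (simp add: basis_iff)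
  qed
  moreover have "insert b I \<subseteq> ground M"
    using b free_separator_ground[OF B] indep_ground[OF IC(2)] by blast
  ultimately obtain C' where C': "C' \<subseteq> insert b I" "circuit M C'" using ex_circuit by metis
  have "b \<in> C'" using C' indep_subset[OF IC(2), of C'] by (auto simp: circuit_def)
  then have "\<not> C' \<subseteq> A" using b disj by blast
  then have "rk M (C' \<union> A) = rk M C'" using A C'(2) by (auto simp: free_separator_iff_circuits)
  moreover have "C' \<subseteq> C \<union> {b}" using C'(1) IC(1) by blast
  ultimately have "rk M (C \<union> {b} \<union> A) = rk M (C \<union> {b})" by (rule rk_closure_mono)
  moreover have "rk M (C \<union> A) \<le> rk M (C \<union> {b} \<union> A)" by (rule rk_mono) blast
  moreover have "rk M C \<le> rk M (C \<union> A)" by (rule rk_mono) blast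
  ultimately show False using no bC by simp
qed

text \<open>Since every circuit spans the whole union, the circuit criterion holds for each subset
  of it by the second alternative alone.\<close>

lemma disjoint_free_separators:
  assumes A: "free_separator M A" and B: "free_separator M B" and disj: "A \<inter> B = {}"
    and ne: "A \<noteq> {}" "B \<noteq> {}"
  shows "circuit M C \<Longrightarrow> rk M (C \<union> (A \<union> B)) = rk M C"
    and "X \<subseteq> A \<union> B \<Longrightarrow> free_separator M X"
proof -
  show *: "rk M (C \<union> (A \<union> B)) = rk M C" if "circuit M C" for C
    using free_separator_disjoint_closure[OF A B disj ne(2) that]
      free_separator_disjoint_closure[OF B A _ ne(1) that] disj
    by (intro rk_closure_Un) auto
  show "free_separator M X" if "X \<subseteq> A \<union> B"
    using that * rk_closure_subset[of M _ "A \<union> B" X] free_separator_ground[OF A]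
      free_separator_ground[OF B]
    by (auto simp: free_separator_iff_circuits)
qed

section \<open>Unique factorization\<close>

text \<open>A relation, since the word is not yet known to be unique. The order of the letters
  matters: the free product is not commutative, for a coloop times a loop is a pair of parallel
  elements and the reverse product is not.\<close>

primrec factor_word :: "'a matroid_class list \<Rightarrow> 'a matroid \<Rightarrow> bool" where
  "factor_word [] M \<longleftrightarrow> ground M = {}"
| "factor_word (a # w) M \<longleftrightarrow> (\<exists>A. free_separator M A \<and> irreducible_matroid (mrestrict M A)
     \<and> abs_matroid_class (mrestrict M A) = a \<and> factor_word w (mcontract M A))"

lemma factor_word_free_product:
  assumes "irreducible_matroid M" "factor_word w N" "ground M \<inter> ground N = {}"
  shows "factor_word (abs_matroid_class M # w) (M \<box> N)"
  using assms free_separator_product[OF assms(3)] mrestrict_free_product[OF assms(3)]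
    mcontract_free_product[OF assms(3)]
  by auto

lemma factor_word_irreducible:
  assumes "factor_word w M" "c \<in> set w"
  shows "c \<in> abs_matroid_class ` {M. irreducible_matroid M}"
  using assms by (induction w arbitrary: M) auto

text \<open>A nonempty free separator of least size restricts to an irreducible matroid, because
  free separators of the restriction are free separators of \<open>M\<close>. Contracting it gives
  the rest of the word.\<close>

lemma ex_factor_word: "\<exists>w. factor_word w M"
proof (induction "card (ground M)" arbitrary: M rule: less_induct)
  case less
  show ?case
  proof (cases "ground M = {}")
    case True
    then have "factor_word [] M" by simp
    then show ?thesis by blast
  next
    case False
    let ?P = "\<lambda>A. free_separator M A \<and> A \<noteq> {}"
    have "?P (ground M)" using False by (auto simp: free_separator_iff Int_absorb2)
    then obtain A where A: "?P A" and min: "\<And>B. ?P B \<Longrightarrow> \<not> card B < card A"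
      using exists_least_iff[of "\<lambda>n. \<exists>A. ?P A \<and> card A = n"] by blast
    have AM: "A \<subseteq> ground M" using A free_separator_ground by blast
    have "irreducible_matroid (mrestrict M A)"
      unfolding irreducible_iff
    proof (intro conjI allI impI)
      show "ground (mrestrict M A) \<noteq> {}" using A AM by (auto simp: Int_absorb2)
      fix B assume B: "free_separator (mrestrict M A) B"
      then have "free_separator M B" using A free_separator_trans by blast
      moreover have "B \<subseteq> A" "finite A"
        using free_separator_ground[OF B] finite_subset[OF AM] by auto
      ultimately show "B = {} \<or> B = ground (mrestrict M A)"
        using min[of B] AM psubset_card_mono[of A B] by (auto simp: Int_absorb2)
    qed
    moreover have "ground M - A \<subset> ground M" using A AM by blast
    then have "card (ground (mcontract M A)) < card (ground M)" by (simp add: psubset_card_mono)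
    then obtain w where "factor_word w (mcontract M A)" using less by blast
    ultimately have "factor_word (abs_matroid_class (mrestrict M A) # w) M" using A by auto
    then show ?thesis by blast
  qed
qed

lemma is_iso_singleton:
  assumes "ground M = {a}" "ground N = {b}" "rank M = rank N"
  shows "is_iso (\<lambda>_. b) M N"
  unfolding is_iso_def
proof (intro conjI allI impI)
  show "bij_betw (\<lambda>_. b) (ground M) (ground N)" using assms by (simp add: bij_betw_def)
  fix X assume "X \<subseteq> ground M"
  then consider "X = {}" | "X = {a}" using assms(1) subset_singletonD[of X a] by auto
  moreover have "indep M {a} \<longleftrightarrow> indep N {b}"
    using assms mrestrict_ground[of M] mrestrict_ground[of N] by (simp add: indep_iff_rk)
  ultimately show "indep M X \<longleftrightarrow> indep N ((\<lambda>_. b) ` X)" by cases auto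
qed

text \<open>Two distinct first separators are disjoint, so every circuit spans both of them. Then both are
  single elements of equal rank, and either can be split off first.\<close>

lemma factor_word_unique: "factor_word u M \<Longrightarrow> factor_word v M \<Longrightarrow> u = v"
proof (induction "card (ground M)" arbitrary: M u v rule: less_induct)
  case less
  have empty: "w = []" if w: "factor_word w M" "ground M = {}" for w
  proof (cases w)
    case (Cons a w')
    then obtain A where "irreducible_matroid (mrestrict M A)" using w by auto
    then show ?thesis using w(2) irreducible_nonempty by force
  qed
  show ?case
  proof (cases "ground M = {}")
    case True
    then show ?thesis using empty less.prems by blast
  next
    case False
    obtain a u' where u: "u = a # u'" using False less.prems by (cases u) auto
    obtain b v' where v: "v = b # v'" using False less.prems by (cases v) auto
    obtain A where A: "free_separator M A" "irreducible_matroid (mrestrict M A)"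
      "abs_matroid_class (mrestrict M A) = a" "factor_word u' (mcontract M A)"
      using less.prems(1) u by auto
    obtain B where B: "free_separator M B" "irreducible_matroid (mrestrict M B)"
      "abs_matroid_class (mrestrict M B) = b" "factor_word v' (mcontract M B)"
      using less.prems(2) v by auto
    have sub: "A \<subseteq> ground M" "B \<subseteq> ground M" using A B free_separator_ground by blast+
    have gr: "ground (mrestrict M A) = A" "ground (mrestrict M B) = B" using sub by auto
    have ne: "A \<noteq> {}" "B \<noteq> {}" using A(2) B(2) irreducible_nonempty gr by metis+
    have IH: "u = v" if "factor_word u (mcontract M C)" "factor_word v (mcontract M C)"
      "C \<subseteq> ground M" "C \<noteq> {}" for u v C
    proof -
      have "ground M - C \<subset> ground M" using that by blast
      then have "card (ground (mcontract M C)) < card (ground M)" by (simp add: psubset_card_mono)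
      then show ?thesis using less.hyps that by blast
    qed
    have AB: "free_separator M (A \<inter> B)" using A(1) B(1) by (rule free_separator_Int)
    \<comment> \<open>The intersection is a free separator of both irreducible restrictions, so in
      each of them it is empty or everything.\<close>
    have "A \<inter> B = {} \<or> A \<inter> B = A"
      using free_separator_restrict[OF AB, of A] A(2) gr unfolding irreducible_iff by auto
    moreover have "A \<inter> B = {} \<or> A \<inter> B = B"
      using free_separator_restrict[OF AB, of B] B(2) gr unfolding irreducible_iff by auto
    ultimately consider "A = B" | "A \<inter> B = {}" by blast
    then show ?thesis
    proof cases
      case 1
      then show ?thesis using IH[of u' A v'] A B sub ne u v by simp
    next
      case disj: 2
      note sep = disjoint_free_separators[OF A(1) B(1) disj ne]
      have single: "\<exists>x. C = {x}"
        if C: "C \<subseteq> A \<union> B" "C \<noteq> {}" "irreducible_matroid (mrestrict M C)" for C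
      proof -
        obtain x where x: "x \<in> C" using C by blast
        have "free_separator (mrestrict M C) {x}"
          using sep(2)[of "{x}"] x C(1) by (intro free_separator_restrict) auto
        moreover have "ground (mrestrict M C) = C" using C(1) sub by auto
        ultimately show ?thesis using C(3) unfolding irreducible_iff by auto
      qed
      obtain x where x: "A = {x}" using single[of A] A(2) ne by auto
      obtain y where y: "B = {y}" using single[of B] B(2) ne by auto
      have xy: "x \<noteq> y" "{x, y} \<subseteq> ground M" using disj sub x y by auto
      \<comment> \<open>A loop is a circuit and so spans the pair: if one of x, y is a loop, both
        are.\<close>
      have dep: "rk M {z} = rk M {x, y}" if "z \<in> {x, y}" "\<not> indep M {z}" for z
      proof -
        have "circuit M {z}" using that xy by (auto simp: circuit_def)
        from sep(1)[OF this] show ?thesis using that(1) by (auto simp: x y insert_commute)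
      qed
      have rk1: "rk M {x} = rk M {y}"
      proof (cases "indep M {x} \<and> indep M {y}")
        case True
        then show ?thesis by (simp add: rk_indep)
      next
        case False
        then obtain z where z: "z \<in> {x, y}" "\<not> indep M {z}" by blast
        have "rk M {z} = 0" using z(2) by (simp add: indep_iff_rk)
        then have "rk M {x, y} = 0" using dep[OF z] by simp
        then show ?thesis using rk_mono[of "{x}" "{x, y}" M] rk_mono[of "{y}" "{x, y}" M] by simp
      qed
      have iso1: "abs_matroid_class (mrestrict M {x}) = abs_matroid_class (mrestrict M {y})"
        using xy rk1 by (intro abs_class_eq[OF is_iso_singleton]) auto
      have rk2: "rk (mcontract M {x}) {y} = rk (mcontract M {y}) {x}"
        using rk_contract[of "{y}" M "{x}"] rk_contract[of "{x}" M "{y}"] xy rk1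
        by (simp add: insert_commute)
      have iso2: "abs_matroid_class (mrestrict (mcontract M {x}) {y})
          = abs_matroid_class (mrestrict (mcontract M {y}) {x})"
        using xy rk2 by (intro abs_class_eq[OF is_iso_singleton]) auto
      let ?N = "mcontract M {x, y}"
      \<comment> \<open>A common tail for both words. Since x and y can be split off in either
        order, each word must be two letters followed by w, and the letters agree by
        \<open>iso1\<close> and \<open>iso2\<close>.\<close>
      obtain w where w: "factor_word w ?N" using ex_factor_word by blast
      have fw: "factor_word (abs_matroid_class (mrestrict (mcontract M {z}) {t}) # w) (mcontract M {z})"
        if zt: "{z, t} = {x, y}" for z t
      proof -
        have "z \<noteq> t" "z \<in> {x, y}" using zt xy(1) by auto
        have "free_separator M {z, t}" using sep(2) x y zt by auto
        from free_separator_contract[OF this, of "{z}"]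
        have "free_separator (mcontract M {z}) {t}" using \<open>z \<noteq> t\<close> by (simp add: insert_Diff_if)
        moreover have "ground (mrestrict (mcontract M {z}) {t}) = {t}"
          using zt xy by auto
        then have "irreducible_matroid (mrestrict (mcontract M {z}) {t})"
          by (rule irreducible_singleton)
        moreover have "mcontract (mcontract M {z}) {t} = ?N"
        proof -
          have "{z} \<union> {t} = {x, y}" "t \<in> {x, y}" using zt by auto
          then show ?thesis
            using mcontract_mcontract[of "{t}" M "{z}"] xy(2) \<open>z \<noteq> t\<close> by auto
        qed
        ultimately show ?thesis using w by auto
      qed
      have "u' = abs_matroid_class (mrestrict (mcontract M {x}) {y}) # w"
        by (rule IH[of _ A]) (use A(4) fw[of x y] x sub ne in auto)
      moreover have "v' = abs_matroid_class (mrestrict (mcontract M {y}) {x}) # w"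
        by (rule IH[of _ B]) (use B(4) fw[of y x] y sub ne in auto)
      ultimately show ?thesis using u v A(3) B(3) iso1 iso2 x y by simp
    qed
  qed
qed

section \<open>The word as a complete invariant of the isomorphism class\<close>

lemma is_iso_separation:
  assumes f: "is_iso f M N" and A: "A \<subseteq> ground M"
  shows "is_iso f (separation A M) (separation (f ` A) N)"
  unfolding separation_def
  by (intro is_iso_free_product is_iso_restrict is_iso_contract f A minors_disjoint)

lemma is_iso_free_separator:
  assumes f: "is_iso f M N" and A: "free_separator M A"
  shows "free_separator N (f ` A)"
proof -
  have AM: "A \<subseteq> ground M" using A by (rule free_separator_ground)
  have "is_iso f M (separation (f ` A) N)"
    using is_iso_separation[OF f AM] A by (simp add: free_separator_def)
  then have "separation (f ` A) N = N" using f by (rule is_iso_unique)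
  moreover have "f ` A \<subseteq> ground N" using AM is_isoD(3)[OF f] by blast
  ultimately show ?thesis by (simp add: free_separator_def)
qed

lemma is_iso_factor_word: "is_iso f M N \<Longrightarrow> factor_word w M \<Longrightarrow> factor_word w N"
proof (induction w arbitrary: M N)
  case Nil
  then show ?case using is_isoD(3)[OF Nil.prems(1)] by simp
next
  case (Cons a w)
  then obtain A where A: "free_separator M A" "irreducible_matroid (mrestrict M A)"
      "abs_matroid_class (mrestrict M A) = a" "factor_word w (mcontract M A)" by auto
  have AM: "A \<subseteq> ground M" using A(1) by (rule free_separator_ground)
  note r = is_iso_restrict[OF Cons.prems(1) AM] and c = is_iso_contract[OF Cons.prems(1) AM]
  show ?case
    using is_iso_free_separator[OF Cons.prems(1) A(1)] A(2,3) is_iso_irreducible[OF r]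
      abs_class_eq[OF r] Cons.IH[OF c A(4)]
    by auto
qed

lemma is_iso_cong: "(\<And>x. x \<in> ground M \<Longrightarrow> f x = g x) \<Longrightarrow> is_iso f M N \<Longrightarrow> is_iso g M N"
proof -
  assume e: "\<And>x. x \<in> ground M \<Longrightarrow> f x = g x" and f: "is_iso f M N"
  have "f ` X = g ` X" if "X \<subseteq> ground M" for X using e that by (intro image_cong) auto
  moreover have "bij_betw g (ground M) (ground N)"
    using is_isoD(1)[OF f] e by (metis bij_betw_cong)
  ultimately show ?thesis using f unfolding is_iso_def by simp
qed

lemma factor_word_isomorphic: "factor_word w M \<Longrightarrow> factor_word w N \<Longrightarrow> isomorphic M N"
proof (induction w arbitrary: M N)
  case Nil
  then have "M = N" by (intro matroid_eqI) (auto dest: indep_ground)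
  then show ?case using is_iso_refl unfolding isomorphic_def by blast
next
  case (Cons a w)
  obtain A where A: "separation A M = M"
    "abs_matroid_class (mrestrict M A) = a" "factor_word w (mcontract M A)"
    using Cons.prems(1) by (auto simp: free_separator_def)
  obtain B where B: "separation B N = N"
    "abs_matroid_class (mrestrict N B) = a" "factor_word w (mcontract N B)"
    using Cons.prems(2) by (auto simp: free_separator_def)
  have "isomorphic (mrestrict M A) (mrestrict N B)"
    using A(2) B(2) matroid_class.abs_eq_iff by metis
  then obtain f where f: "is_iso f (mrestrict M A) (mrestrict N B)"
    unfolding isomorphic_def by blast
  obtain g where g: "is_iso g (mcontract M A) (mcontract N B)"
    using Cons.IH[OF A(3) B(3)] unfolding isomorphic_def by blast
  let ?h = "\<lambda>x. if x \<in> A then f x else g x"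
  have "is_iso ?h (mrestrict M A) (mrestrict N B)" using f by (rule is_iso_cong[rotated]) auto
  moreover have "is_iso ?h (mcontract M A) (mcontract N B)" using g by (rule is_iso_cong[rotated]) auto
  ultimately have "is_iso ?h (separation A M) (separation B N)"
    unfolding separation_def by (intro is_iso_free_product minors_disjoint)
  then show ?case using A(1) B(1) unfolding isomorphic_def by auto
qed

text \<open>The description is meaningful by existence and uniqueness of factor words, and
  independent of the chosen representative because isomorphisms preserve them.\<close>

definition class_word :: "'a matroid_class \<Rightarrow> 'a matroid_class list" where
  "class_word c = (THE w. factor_word w (rep_matroid_class c))"

lemma class_word_eq_iff: "class_word (abs_matroid_class M) = w \<longleftrightarrow> factor_word w M"
proof -
  let ?N = "rep_matroid_class (abs_matroid_class M)"
  have iso: "isomorphic ?N M"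
    using Quotient3_matroid_class equivp_isomorphic
    by (metis Quotient3_abs_rep matroid_class.abs_eq_iff)
  then obtain f where f: "is_iso f ?N M" unfolding isomorphic_def by blast
  have eq: "factor_word w ?N \<longleftrightarrow> factor_word w M" for w
    using is_iso_factor_word[OF f] is_iso_factor_word[OF is_iso_inv[OF f]] by blast
  obtain v where v: "factor_word v M" using ex_factor_word by blast
  have "class_word (abs_matroid_class M) = v"
    unfolding class_word_def eq using v factor_word_unique by blast
  then show ?thesis using v factor_word_unique by blast
qed

lemma factor_word_class_word: "factor_word (class_word (abs_matroid_class M)) M"
  using class_word_eq_iff by blast

lemma inj_class_word: "inj class_word"
proof (rule injI)
  fix c d :: "'a matroid_class"
  assume e: "class_word c = class_word d"
  obtain M N where MN: "c = abs_matroid_class M" "d = abs_matroid_class N"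
    by (metis Quotient3_matroid_class Quotient3_abs_rep)
  have "isomorphic M N"
    using factor_word_isomorphic factor_word_class_word e unfolding MN by metis
  then show "c = d" unfolding MN matroid_class.abs_eq_iff .
qed

lemma class_cases: obtains M where "c = abs_matroid_class M"
  by (metis Quotient3_matroid_class Quotient3_abs_rep)

section \<open>Counting chains of minors\<close>

text \<open>The number of chains of sets in \<open>M\<close> whose successive minors have the
  classes listed in the word. Strict inclusions are not imposed; they are automatic for irreducible
  letters, whose ground sets are nonempty.\<close>

primrec word_count :: "'a matroid_class list \<Rightarrow> 'a matroid \<Rightarrow> nat" where
  "word_count [] M = (if ground M = {} then 1 else 0)"
| "word_count (a # w) M = (\<Sum>A\<in>Pow (ground M).
     if abs_matroid_class (mrestrict M A) = a then word_count w (mcontract M A) else 0)"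

lemma sum_if_Pow_empty:
  assumes "finite S"
  shows "(\<Sum>A\<in>Pow S. if A = {} then f A else 0) = (f {} :: 'b::comm_monoid_add)"
  using assms by (simp add: sum.delta)

text \<open>Cut a chain for \<open>u @ v\<close> at the set A reached after u: what precedes is a
  chain of the restriction to A, what follows a chain of the contraction by A.\<close>

lemma word_count_append:
  "word_count (u @ v) M
    = (\<Sum>A\<in>Pow (ground M). word_count u (mrestrict M A) * word_count v (mcontract M A))"
proof (induction u arbitrary: M)
  case Nil
  have "(\<Sum>A\<in>Pow (ground M). word_count [] (mrestrict M A) * word_count v (mcontract M A))
      = (\<Sum>A\<in>Pow (ground M). if A = {} then word_count v (mcontract M A) else 0)"
    by (intro sum.cong) auto
  then show ?case by (simp add: sum_if_Pow_empty)
next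
  case (Cons a u)
  let ?S = "ground M"
  let ?c = "\<lambda>B. abs_matroid_class (mrestrict M B) = a"
  let ?f = "\<lambda>A B. if ?c B then word_count u (mcontract (mrestrict M A) B) * word_count v (mcontract M A) else 0"
  have "word_count ((a # u) @ v) M
      = (\<Sum>B\<in>Pow ?S. \<Sum>C\<in>Pow (?S - B). if ?c B then
          word_count u (mrestrict (mcontract M B) C) * word_count v (mcontract (mcontract M B) C) else 0)"
    by (auto simp: Cons.IH intro!: sum.cong)
  also have "\<dots> = (\<Sum>(B, C)\<in>Sigma (Pow ?S) (\<lambda>B. Pow (?S - B)). if ?c B then
          word_count u (mrestrict (mcontract M B) C) * word_count v (mcontract (mcontract M B) C) else 0)"
    by (rule sum.Sigma) auto
  \<comment> \<open>B is the first set of the chain and A the set where the first word ends. The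
    left side records A through its difference \<open>C = A - B\<close>.\<close>
  also have "\<dots> = (\<Sum>(A, B)\<in>Sigma (Pow ?S) Pow. ?f A B)"
  proof (rule sum.reindex_bij_witness[of _ "\<lambda>(A, B). (B, A - B)" "\<lambda>(B, C). (B \<union> C, B)"])
    fix p assume "p \<in> Sigma (Pow ?S) (\<lambda>B. Pow (?S - B))"
    then obtain B C where p: "p = (B, C)" "B \<subseteq> ?S" "C \<subseteq> ?S" "B \<inter> C = {}" by auto
    have "B \<union> C - B = C" using p(4) by blast
    then have "mrestrict (mcontract M B) C = mcontract (mrestrict M (B \<union> C)) B"
      using mrestrict_mcontract[of B "B \<union> C" M] by simp
    moreover have "mcontract (mcontract M B) C = mcontract M (B \<union> C)"
      using p by (intro mcontract_mcontract)
    ultimately show "(case case p of (B, C) \<Rightarrow> (B \<union> C, B) of (A, B) \<Rightarrow> ?f A B)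
      = (case p of (B, C) \<Rightarrow> if ?c B then word_count u (mrestrict (mcontract M B) C)
          * word_count v (mcontract (mcontract M B) C) else 0)"
      unfolding p(1) by simp
  qed auto
  also have "\<dots> = (\<Sum>A\<in>Pow ?S. \<Sum>B\<in>Pow A. ?f A B)"
    by (rule sum.Sigma[symmetric]) (auto intro: finite_subset[OF _ finite_ground])
  also have "\<dots> = (\<Sum>A\<in>Pow ?S. word_count (a # u) (mrestrict M A) * word_count v (mcontract M A))"
  proof (rule sum.cong)
    fix A assume A: "A \<in> Pow ?S"
    then have "ground (mrestrict M A) = A" by auto
    moreover have "mrestrict (mrestrict M A) B = mrestrict M B" if "B \<in> Pow A" for B
      using that by (simp add: Int_absorb1)
    ultimately show "(\<Sum>B\<in>Pow A. ?f A B)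
        = word_count (a # u) (mrestrict M A) * word_count v (mcontract M A)"
      by (auto simp: sum_distrib_right intro!: sum.cong)
  qed simp
  finally show ?case .
qed

lemma is_iso_word_count: "is_iso f M N \<Longrightarrow> word_count w M = word_count w N"
proof (induction w arbitrary: M N)
  case Nil
  then show ?case using is_isoD(3)[OF Nil] by auto
next
  case (Cons a w)
  note f = Cons.prems
  let ?g = "inv_into (ground M) f"
  show ?case unfolding word_count.simps
  proof (rule sum.reindex_bij_witness[of _ "(`) ?g" "(`) f"])
    fix A assume "A \<in> Pow (ground M)"
    then have A: "A \<subseteq> ground M" by simp
    show "?g ` f ` A = A" by (rule image_inv_into_image(1)[OF f A])
    show "f ` A \<in> Pow (ground N)" using image_mono[OF A, of f] is_isoD(3)[OF f] by simp
    show "(if abs_matroid_class (mrestrict N (f ` A)) = a then word_count w (mcontract N (f ` A)) else 0)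
      = (if abs_matroid_class (mrestrict M A) = a then word_count w (mcontract M A) else 0)"
      using abs_class_eq[OF is_iso_restrict[OF f A]] Cons.IH[OF is_iso_contract[OF f A]] by simp
  next
    fix A assume "A \<in> Pow (ground N)"
    then have A: "A \<subseteq> ground N" by simp
    show "f ` ?g ` A = A" by (rule image_inv_into_image(2)[OF f A])
    show "?g ` A \<in> Pow (ground M)" using image_inv_into_image(3)[OF f A] by simp
  qed
qed

abbreviation irreducible_classes :: "'a matroid_class set" where
  "irreducible_classes \<equiv> abs_matroid_class ` {M. irreducible_matroid M}"

lemma irreducible_class_iff:
  "abs_matroid_class M \<in> irreducible_classes \<longleftrightarrow> irreducible_matroid M"
proof
  assume "abs_matroid_class M \<in> irreducible_classes"
  then obtain N where "irreducible_matroid N" "isomorphic M N"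
    using matroid_class.abs_eq_iff by fastforce
  then show "irreducible_matroid M" using is_iso_irreducible unfolding isomorphic_def by blast
qed blast

text \<open>Irreducibility of the letters matters: the class of the empty matroid, used as a letter,
  could be repeated at no cost.\<close>

lemma word_count_empty:
  assumes "w \<noteq> []" "set w \<subseteq> irreducible_classes" "ground M = {}"
  shows "word_count w M = 0"
proof (cases w)
  case (Cons a v)
  have "\<not> irreducible_matroid (mrestrict M {})" using irreducible_nonempty by force
  then have "abs_matroid_class (mrestrict M {}) \<noteq> a"
    using assms(2) irreducible_class_iff[of "mrestrict M {}"] unfolding Cons by auto
  then show ?thesis using assms(3) Cons by simp
qed (use assms in simp)

lemma factor_word_count_nonzero: "factor_word w M \<Longrightarrow> word_count w M \<noteq> 0"
proof (induction w arbitrary: M)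
  case (Cons a w)
  then obtain A where A: "A \<subseteq> ground M" "abs_matroid_class (mrestrict M A) = a"
    "factor_word w (mcontract M A)" by (auto dest: free_separator_ground)
  have "word_count w (mcontract M A) \<noteq> 0" using Cons.IH A(3) .
  moreover have "word_count w (mcontract M A) \<le> word_count (a # w) M"
    using A(1,2) member_le_sum[of A "Pow (ground M)"
      "\<lambda>A. if abs_matroid_class (mrestrict M A) = a then word_count w (mcontract M A) else 0"]
    by simp
  ultimately show ?case by linarith
qed simp

text \<open>The free product of the minors along a chain lies above \<open>M\<close>: separation at
  the first set moves \<open>M\<close> up, and replacing the contraction in the right factor by
  something larger moves it up further.\<close>

lemma word_count_weak_ge:
  "word_count w M \<noteq> 0 \<Longrightarrow> set w \<subseteq> irreducible_classes \<Longrightarrow> \<exists>N. weak_le M N \<and> factor_word w N"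
proof (induction w arbitrary: M)
  case Nil
  then have "factor_word [] M" by (simp split: if_splits)
  then show ?case using weak_le_refl by blast
next
  case (Cons a w)
  have "\<exists>A\<in>Pow (ground M).
      (if abs_matroid_class (mrestrict M A) = a then word_count w (mcontract M A) else 0) \<noteq> 0"
  proof (rule ccontr)
    assume "\<not> ?thesis"
    then have "word_count (a # w) M = 0" unfolding word_count.simps by (intro sum.neutral) blast
    then show False using Cons.prems(1) by blast
  qed
  then obtain A where A: "A \<subseteq> ground M" "abs_matroid_class (mrestrict M A) = a"
    "word_count w (mcontract M A) \<noteq> 0"
    by (auto split: if_splits)
  obtain N where N: "weak_le (mcontract M A) N" "factor_word w N"
    using Cons.IH[OF A(3)] Cons.prems(2) by (meson set_subset_Cons subset_trans)
  have irr: "irreducible_matroid (mrestrict M A)"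
    using Cons.prems(2) A(2) irreducible_class_iff[of "mrestrict M A"] by simp
  have disj: "ground (mrestrict M A) \<inter> ground N = {}"
    using weak_le_ground[OF N(1)] minors_disjoint by metis
  have "weak_le M (mrestrict M A \<box> N)"
    using separation_weak_ge[OF A(1)] weak_le_free_product[OF minors_disjoint N(1)]
      weak_le_trans unfolding separation_def by blast
  then show ?case using factor_word_free_product[OF irr N(2) disj] A(2) by blast
qed

section \<open>Irreducible chains with a prescribed word\<close>

fun chain_word :: "'a matroid \<Rightarrow> 'a set list \<Rightarrow> 'a matroid_class list" where
  "chain_word M (A # B # D) = abs_matroid_class (mminor M A B) # chain_word M (B # D)"
| "chain_word M _ = []"

lemma factor_word_chain_product:
  "successively (\<lambda>A B. A \<subset> B \<and> irreducible_matroid (mminor M A B)) (A # D) \<Longrightarrow>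
    last (A # D) \<subseteq> ground M \<Longrightarrow>
    factor_word (chain_word M (A # D)) (chain_product M (A # D))"
proof (induction D arbitrary: A)
  case (Cons B D)
  have irr: "irreducible_matroid (mminor M A B)"
    and D: "successively (\<lambda>A B. A \<subset> B \<and> irreducible_matroid (mminor M A B)) (B # D)"
    using Cons.prems(1) unfolding successively.simps by blast+
  have L: "last (B # D) \<subseteq> ground M" using Cons.prems(2) by simp
  have "ground (mminor M A B) \<inter> ground (chain_product M (B # D)) = {}"
    unfolding ground_chain_product[OF D L] ground_minor by blast
  then show ?case
    using factor_word_free_product[OF irr Cons.IH[OF D L]] by simp
qed simp

text \<open>The starting set is kept out of the list and left variable, so that induction on the
  word can move it to the next set of the chain.\<close>

definition chains_from :: "'a matroid \<Rightarrow> 'a set \<Rightarrow> 'a matroid_class list \<Rightarrow> 'a set list set" where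
  "chains_from M A w = {D.
     successively (\<lambda>A B. A \<subset> B \<and> irreducible_matroid (mminor M A B)) (A # D)
     \<and> last (A # D) = ground M \<and> chain_word M (A # D) = w}"

lemma card_chains_from:
  assumes "A \<subseteq> ground M" "set w \<subseteq> irreducible_classes"
  shows "finite (chains_from M A w) \<and> card (chains_from M A w) = word_count w (mcontract M A)"
  using assms
proof (induction w arbitrary: A)
  case Nil
  have "D = []" if "chain_word M (A # D) = []" for D using that by (cases D) auto
  then have "chains_from M A [] = (if A = ground M then {[]} else {})"
    unfolding chains_from_def by auto
  then show ?case using Nil.prems by auto
next
  case (Cons a w)
  let ?S = "ground M"
  define X where "X = {B. A \<subseteq> B \<and> B \<subseteq> ?S \<and> abs_matroid_class (mminor M A B) = a}"
  have finX: "finite X" unfolding X_def by (rule finite_subset[of _ "Pow ?S"]) auto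
  have minor: "mminor M A B = mrestrict (mcontract M A) (B - A)" if "A \<subseteq> B" for B
    using that by (simp add: mminor_def mrestrict_mcontract)
  have eq: "chains_from M A (a # w) = (\<Union>B\<in>X. (#) B ` chains_from M B w)"
  proof (intro equalityI subsetI)
    fix D assume D: "D \<in> chains_from M A (a # w)"
    then obtain B E where E: "D = B # E" by (cases D) (auto simp: chains_from_def)
    have s: "successively (\<lambda>A B. A \<subset> B \<and> irreducible_matroid (mminor M A B)) (A # D)"
      "last (A # D) = ?S" "chain_word M (A # D) = a # w"
      using D by (auto simp: chains_from_def)
    have "A \<subseteq> B" "B \<subseteq> ?S"
      using successively_psubset[OF s(1)] s(2) unfolding E by auto
    then have "B \<in> X" using s(3) unfolding X_def E by simp
    moreover have "E \<in> chains_from M B w" using s unfolding E chains_from_def by simp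
    ultimately show "D \<in> (\<Union>B\<in>X. (#) B ` chains_from M B w)" unfolding E by blast
  next
    fix D assume "D \<in> (\<Union>B\<in>X. (#) B ` chains_from M B w)"
    then obtain B E where E: "D = B # E" "B \<in> X" "E \<in> chains_from M B w" by blast
    have irr: "irreducible_matroid (mminor M A B)"
      using E(2) Cons.prems(2) irreducible_class_iff[of "mminor M A B"] unfolding X_def by simp
    \<comment> \<open>\<open>X\<close> asks only for \<open>A \<subseteq> B\<close>; strictness
      comes back from the nonempty ground set of an irreducible minor.\<close>
    have "A \<noteq> B" using irreducible_nonempty[OF irr] by auto
    then show "D \<in> chains_from M A (a # w)"
      using irr E unfolding X_def chains_from_def by auto
  qed
  have IH: "finite (chains_from M B w)" "card (chains_from M B w) = word_count w (mcontract M B)"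
    if "B \<in> X" for B using Cons.IH[of B] Cons.prems(2) that unfolding X_def by auto
  have "card (chains_from M A (a # w)) = (\<Sum>B\<in>X. card ((#) B ` chains_from M B w))"
    unfolding eq using finX IH(1) by (intro card_UN_disjoint) auto
  also have "\<dots> = (\<Sum>B\<in>X. word_count w (mcontract M B))"
    using IH(2) by (intro sum.cong refl) (simp add: card_image)
  also have "\<dots> = (\<Sum>C\<in>{C \<in> Pow (?S - A). abs_matroid_class (mrestrict (mcontract M A) C) = a}.
      word_count w (mcontract (mcontract M A) C))"
  proof (rule sum.reindex_bij_witness[of _ "\<lambda>C. A \<union> C" "\<lambda>B. B - A"])
    fix B assume B: "B \<in> X"
    then show "A \<union> (B - A) = B" unfolding X_def by blast
    show "B - A \<in> {C \<in> Pow (?S - A). abs_matroid_class (mrestrict (mcontract M A) C) = a}"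
      using B minor[of B] unfolding X_def by auto
    have "mcontract (mcontract M A) (B - A) = mcontract M (A \<union> (B - A))"
      using B unfolding X_def by (intro mcontract_mcontract) auto
    then show "word_count w (mcontract (mcontract M A) (B - A)) = word_count w (mcontract M B)"
      using \<open>A \<union> (B - A) = B\<close> by simp
  next
    fix C assume C: "C \<in> {C \<in> Pow (?S - A). abs_matroid_class (mrestrict (mcontract M A) C) = a}"
    then show e: "A \<union> C - A = C" by blast
    show "A \<union> C \<in> X" using C minor[of "A \<union> C"] e Cons.prems(1) unfolding X_def by auto
  qed
  also have "\<dots> = word_count (a # w) (mcontract M A)"
    unfolding word_count.simps ground_contract by (rule sum.inter_filter) simp
  finally show ?case using IH(1) finX unfolding eq by blast
qed

text \<open>Unique factorization enters here: the product of a chain has class c exactly when the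
  word of its minors is \<open>class_word c\<close>.\<close>

lemma card_irreducible_chains:
  "card {D \<in> irreducible_chains M. abs_matroid_class (chain_product M D) = c}
    = word_count (class_word c) M"
proof -
  let ?w = "class_word c"
  obtain N where N: "c = abs_matroid_class N" by (rule class_cases)
  have "factor_word ?w N" unfolding N by (rule factor_word_class_word)
  then have irr: "set ?w \<subseteq> irreducible_classes" using factor_word_irreducible by blast
  have cw: "abs_matroid_class (chain_product M D) = c \<longleftrightarrow> chain_word M D = ?w"
    if D: "D \<in> irreducible_chains M" for D
  proof -
    obtain E where E: "D = {} # E" "last ({} # E) = ground M"
      "successively (\<lambda>A B. A \<subset> B \<and> irreducible_matroid (mminor M A B)) ({} # E)"
      using D by (rule irreducible_chainsE)
    have "factor_word (chain_word M D) (chain_product M D)"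
      unfolding E(1) using factor_word_chain_product[OF E(3)] E(2) by simp
    then have "class_word (abs_matroid_class (chain_product M D)) = chain_word M D"
      unfolding class_word_eq_iff .
    then show ?thesis using inj_class_word by (metis injD)
  qed
  have "{D \<in> irreducible_chains M. abs_matroid_class (chain_product M D) = c}
      = (#) {} ` chains_from M {} ?w" (is "?L = ?R")
  proof (intro equalityI subsetI)
    fix D assume D: "D \<in> ?L"
    then have D': "D \<in> irreducible_chains M" "abs_matroid_class (chain_product M D) = c" by simp_all
    then obtain E where E: "D = {} # E" "last ({} # E) = ground M"
      "successively (\<lambda>A B. A \<subset> B \<and> irreducible_matroid (mminor M A B)) ({} # E)"
      by (elim irreducible_chainsE)
    have "chain_word M D = ?w" using cw[OF D'(1)] D'(2) by simp
    then have "E \<in> chains_from M {} ?w"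
      using E(2,3) unfolding E(1) chains_from_def mem_Collect_eq by (intro conjI)
    then show "D \<in> ?R" unfolding E(1) by (rule imageI)
  next
    fix D assume "D \<in> ?R"
    then obtain E where E: "D = {} # E" "E \<in> chains_from M {} ?w" by (rule imageE)
    note chain = E(2)[unfolded chains_from_def mem_Collect_eq]
    have D: "D \<in> irreducible_chains M"
      using chain unfolding irreducible_chains_def E(1) mem_Collect_eq
      by (intro conjI) simp_all
    have "abs_matroid_class (chain_product M D) = c" using cw[OF D] chain unfolding E(1) by simp
    then show "D \<in> ?L" using D by simp
  qed
  then have "card ?L = card (chains_from M {} ?w)" by (simp add: card_image)
  then show ?thesis using card_chains_from[of "{}" M ?w] irr by simp
qed

section \<open>The linear map phi\<close>

text \<open>The weak order compares labeled matroids, whereas \<open>phi\<close> acts on isomorphism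
  classes. The number of bases survives the passage to classes and still grows strictly along the
  weak order.\<close>

definition num_bases :: "'a matroid \<Rightarrow> nat" where
  "num_bases M = card {B. basis M B}"

lemma finite_bases: "finite {B. basis M B}"
  by (rule finite_subset[OF _ finite_indeps[of M]]) (auto dest: basis_indep)

lemma is_iso_num_bases:
  assumes "is_iso f M N"
  shows "num_bases M = num_bases N"
proof -
  have le: "num_bases M \<le> num_bases N" if f: "is_iso f M N" for f :: "'a \<Rightarrow> 'a" and M N
    unfolding num_bases_def
  proof (rule card_inj_on_le[of "(`) f"])
    show "inj_on ((`) f) {B. basis M B}"
      by (rule inj_onI) (simp add: basis_ground inj_on_image_eq_iff[OF is_isoD(2)[OF f]])
    show "(`) f ` {B. basis M B} \<subseteq> {B. basis N B}"
      using is_iso_basis[OF f] basis_ground by auto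
  qed (rule finite_bases)
  show ?thesis using le[OF assms] le[OF is_iso_inv[OF assms]] by simp
qed

lemma weak_le_num_bases: "weak_le M N \<Longrightarrow> M \<noteq> N \<Longrightarrow> num_bases M < num_bases N"
proof -
  assume "weak_le M N" "M \<noteq> N"
  then have "\<not> weak_le N M" using weak_le_antisym by blast
  then have "{B. basis M B} \<subset> {B. basis N B}"
    using \<open>weak_le M N\<close> unfolding weak_le_def by auto
  then show ?thesis unfolding num_bases_def by (intro psubset_card_mono finite_bases)
qed

text \<open>A bound in terms of the size alone, which makes the upward induction in
  \<open>class_vec_in_range\<close> well founded.\<close>

lemma num_bases_le: "num_bases M \<le> 2 ^ card (ground M)"
proof -
  have "num_bases M \<le> card (Pow (ground M))"
    unfolding num_bases_def by (rule card_mono) (auto dest: basis_ground)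
  then show ?thesis by (simp add: card_Pow)
qed

definition class_count :: "'a matroid_class list \<Rightarrow> 'a matroid_class \<Rightarrow> 'k::field_char_0" where
  "class_count w c = of_nat (word_count w (rep_matroid_class c))"

lemma class_invariant:
  assumes "\<And>f M N. is_iso f M N \<Longrightarrow> h M = h N"
  shows "h (rep_matroid_class (abs_matroid_class M)) = h M"
proof -
  have "isomorphic (rep_matroid_class (abs_matroid_class M)) M"
    by (metis Quotient3_matroid_class Quotient3_abs_rep matroid_class.abs_eq_iff)
  then show ?thesis using assms unfolding isomorphic_def by blast
qed

lemma class_count_abs: "class_count w (abs_matroid_class M) = of_nat (word_count w M)"
  unfolding class_count_def
  using class_invariant[of "\<lambda>M. of_nat (word_count w M)" M] is_iso_word_count by metis

definition class_bases :: "'a matroid_class \<Rightarrow> nat" where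
  "class_bases c = num_bases (rep_matroid_class c)"

definition class_size :: "'a matroid_class \<Rightarrow> nat" where
  "class_size c = card (ground (rep_matroid_class c))"

lemma class_bases_abs: "class_bases (abs_matroid_class M) = num_bases M"
  unfolding class_bases_def by (rule class_invariant) (rule is_iso_num_bases)

lemma class_size_abs: "class_size (abs_matroid_class M) = card (ground M)"
  unfolding class_size_def by (rule class_invariant) (metis bij_betw_same_card is_isoD(1))

lemma class_word_letters: "set (class_word c) \<subseteq> irreducible_classes"
proof -
  obtain M where "c = abs_matroid_class M" by (rule class_cases)
  then show ?thesis using factor_word_irreducible[OF factor_word_class_word[of M]] by blast
qed

text \<open>Characteristic zero enters here: the diagonal entries of \<open>phi\<close> are positive
  integers but need not be 1. Two parallel elements, for instance, have two chains with the word of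
  a coloop followed by a loop.\<close>

lemma class_count_self: "(class_count (class_word c) c :: 'k::field_char_0) \<noteq> 0"
proof -
  obtain M where M: "c = abs_matroid_class M" by (rule class_cases)
  show ?thesis unfolding M class_count_abs of_nat_eq_0_iff
    by (rule factor_word_count_nonzero) (rule factor_word_class_word)
qed

lemma class_count_triangular:
  assumes "(class_count (class_word d) c :: 'k::field_char_0) \<noteq> 0" "c \<noteq> d"
  shows "class_bases c < class_bases d" "class_size c = class_size d"
proof -
  obtain M where M: "c = abs_matroid_class M" by (rule class_cases)
  have "word_count (class_word d) M \<noteq> 0"
    using assms(1) unfolding M class_count_abs of_nat_eq_0_iff .
  then obtain N where N: "weak_le M N" "factor_word (class_word d) N"
    using word_count_weak_ge class_word_letters by blast
  have d: "d = abs_matroid_class N"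
    using N(2) inj_class_word unfolding class_word_eq_iff[symmetric] by (metis injD)
  then have "M \<noteq> N" using assms(2) M by blast
  then show "class_bases c < class_bases d" "class_size c = class_size d"
    using weak_le_num_bases[OF N(1)] weak_le_ground[OF N(1)]
    unfolding M d class_bases_abs class_size_abs by auto
qed

section \<open>Linear functionals on finitely supported functions\<close>

text \<open>The linear functional with values g on the basis. Identities about \<open>phi\<close>
  and the coproduct are tested with such functionals.\<close>

definition pairing :: "('b \<Rightarrow> 'k::field) \<Rightarrow> ('b \<Rightarrow>\<^sub>0 'k) \<Rightarrow> 'k" where
  "pairing g x = (\<Sum>b\<in>Poly_Mapping.keys x. Poly_Mapping.lookup x b * g b)"

lemma pairing_superset:
  "finite A \<Longrightarrow> Poly_Mapping.keys x \<subseteq> A \<Longrightarrow> pairing g x = (\<Sum>b\<in>A. Poly_Mapping.lookup x b * g b)"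
  unfolding pairing_def by (rule sum.mono_neutral_left) (auto simp: in_keys_iff)

lemma pairing_zero [simp]: "pairing g 0 = 0"
  by (simp add: pairing_def)

lemma pairing_add: "pairing g (x + y) = pairing g x + pairing g y"
proof -
  let ?A = "Poly_Mapping.keys x \<union> Poly_Mapping.keys y"
  have "Poly_Mapping.keys (x + y) \<subseteq> ?A" by (rule Poly_Mapping.keys_add)
  then show ?thesis
    using pairing_superset[of ?A x g] pairing_superset[of ?A y g] pairing_superset[of ?A "x + y" g]
    by (simp add: lookup_add distrib_right sum.distrib)
qed

lemma pairing_scale: "pairing g (scale c x) = c * pairing g x"
proof -
  have "Poly_Mapping.keys (scale c x) \<subseteq> Poly_Mapping.keys x"
    by (auto simp: in_keys_iff lookup_scale)
  then show ?thesis
    using pairing_superset[of "Poly_Mapping.keys x" "scale c x" g]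
    by (simp add: lookup_scale pairing_def sum_distrib_left mult.assoc)
qed

lemma pairing_sum: "pairing g (\<Sum>i\<in>A. f i) = (\<Sum>i\<in>A. pairing g (f i))"
  by (induction A rule: infinite_finite_induct) (simp_all add: pairing_add)

lemma pairing_diff: "pairing g (x - y) = pairing g x - pairing g y"
  using pairing_add[of g "x - y" y] by simp

lemma pairing_single [simp]: "pairing g (Poly_Mapping.single b c) = c * g b"
  by (simp add: pairing_def)

lemma pairing_class_vec [simp]: "pairing g (class_vec c) = g c"
  by (simp add: class_vec_def)

lemma pairing_linear_extension:
  "pairing g (linear_extension f x) = pairing (\<lambda>b. pairing g (f b)) x"
  unfolding linear_extension_def pairing_sum pairing_scale pairing_def[of _ x] ..

lemma lookup_linear_extension:
  "Poly_Mapping.lookup (linear_extension f x) c = pairing (\<lambda>b. Poly_Mapping.lookup (f b) c) x"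
  by (simp add: linear_extension_def pairing_def lookup_sum lookup_scale)

lemma pairing_tensor:
  "pairing (\<lambda>(a, b). g a * h b) (tensor x y) = pairing g x * pairing h y"
  by (simp add: tensor_def pairing_sum sum_product)
    (simp add: pairing_def sum_product algebra_simps)

lemma poly_mapping_decomposition:
  "x = (\<Sum>b\<in>Poly_Mapping.keys x. scale (Poly_Mapping.lookup x b) (class_vec b))"
proof (rule poly_mapping_eqI)
  fix c
  have "(\<Sum>b\<in>Poly_Mapping.keys x. Poly_Mapping.lookup x b * (1 when b = c))
      = (\<Sum>b\<in>Poly_Mapping.keys x. if b = c then Poly_Mapping.lookup x b else 0)"
    by (intro sum.cong) (auto simp: when_def)
  also have "\<dots> = Poly_Mapping.lookup x c" by (simp add: in_keys_iff)
  finally show "Poly_Mapping.lookup x c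
      = Poly_Mapping.lookup (\<Sum>b\<in>Poly_Mapping.keys x. scale (Poly_Mapping.lookup x b) (class_vec b)) c"
    by (simp add: lookup_sum lookup_scale class_vec_def lookup_single)
qed

section \<open>Bijectivity of \<open>phi\<close>\<close>

lemma lookup_phi:
  "Poly_Mapping.lookup (phi x) n = pairing (class_count (class_word n)) (x :: _ \<Rightarrow>\<^sub>0 'k::field_char_0)"
proof -
  have "Poly_Mapping.lookup (class_phi c) n = (class_count (class_word n) c :: 'k)" for c
  proof -
    obtain M where M: "c = abs_matroid_class M" by (rule class_cases)
    have "Poly_Mapping.lookup (class_phi c) n
        = (\<Sum>D\<in>irreducible_chains M. if abs_matroid_class (chain_product M D) = n then 1 else 0 :: 'k)"
      unfolding M class_phi.abs_eq
      by (simp add: lookup_sum matroid_vec_def class_vec_def lookup_single when_def)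
    also have "\<dots> = of_nat (card {D \<in> irreducible_chains M. abs_matroid_class (chain_product M D) = n})"
      by (simp add: finite_irreducible_chains flip: sum.inter_filter)
    finally show ?thesis unfolding card_irreducible_chains M class_count_abs .
  qed
  then show ?thesis by (simp add: phi_def lookup_linear_extension)
qed

lemma phi_scale: "phi (scale c x) = scale c (phi (x :: _ \<Rightarrow>\<^sub>0 'k::field_char_0))"
  by (rule poly_mapping_eqI) (simp add: lookup_phi lookup_scale pairing_scale)

lemma phi_diff: "phi (x - y) = phi x - phi (y :: _ \<Rightarrow>\<^sub>0 'k::field_char_0)"
  by (rule poly_mapping_eqI) (simp add: lookup_phi lookup_minus pairing_diff)

lemma phi_sum: "phi (\<Sum>i\<in>A. f i) = (\<Sum>i\<in>A. phi (f i :: _ \<Rightarrow>\<^sub>0 'k::field_char_0))"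
  by (rule poly_mapping_eqI) (simp add: lookup_phi lookup_sum pairing_sum)

text \<open>A different class d contributes to the coefficient of c only if it has fewer bases than
  c. Hence at a class of the support with fewest bases the diagonal entry stands alone.\<close>

lemma phi_eq_0:
  assumes "phi x = (0 :: _ \<Rightarrow>\<^sub>0 'k::field_char_0)"
  shows "x = 0"
proof (rule ccontr)
  assume "x \<noteq> 0"
  then have ne: "Poly_Mapping.keys x \<noteq> {}" by simp
  define c where "c = arg_min_on class_bases (Poly_Mapping.keys x)"
  have c: "c \<in> Poly_Mapping.keys x" unfolding c_def using ne by (intro arg_min_if_finite) simp_all
  have min: "class_bases c \<le> class_bases d" if "d \<in> Poly_Mapping.keys x" for d
    unfolding c_def using ne that by (intro arg_min_least) simp_all
  have "Poly_Mapping.lookup x d * class_count (class_word c) d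
      = (if d = c then Poly_Mapping.lookup x c * class_count (class_word c) c else 0)"
    if d: "d \<in> Poly_Mapping.keys x" for d
  proof (cases "d = c")
    case False
    then have "(class_count (class_word c) d :: 'k) = 0"
      using class_count_triangular(1)[of c d, where 'k = 'k] min[OF d] by linarith
    then show ?thesis using False by simp
  qed simp
  then have "Poly_Mapping.lookup (phi x) c = (\<Sum>d\<in>Poly_Mapping.keys x.
      if d = c then Poly_Mapping.lookup x c * class_count (class_word c) c else 0)"
    unfolding lookup_phi pairing_def by (intro sum.cong refl)
  also have "\<dots> = Poly_Mapping.lookup x c * class_count (class_word c) c" using c by simp
  finally show False using assms class_count_self[of c, where 'k = 'k] c by (simp add: in_keys_iff)
qed

text \<open>The image of a basis vector is a nonzero multiple of that vector plus classes of the
  same size with more bases. These are treated first, by induction on the distance to the bound on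
  the number of bases.\<close>

lemma class_vec_in_range: "class_vec c \<in> range (phi :: _ \<Rightarrow> (_ \<Rightarrow>\<^sub>0 'k::field_char_0))"
proof (induction "2 ^ class_size c - class_bases c" arbitrary: c rule: less_induct)
  case less
  have bases: "class_bases d \<le> 2 ^ class_size d" for d :: "'a matroid_class"
    unfolding class_bases_def class_size_def by (rule num_bases_le)
  let ?e = "class_vec c :: _ \<Rightarrow>\<^sub>0 'k"
  let ?k = "Poly_Mapping.lookup (phi ?e)"
  have k: "?k d = class_count (class_word d) c" for d by (simp add: lookup_phi)
  have "\<exists>x. phi x = (class_vec d :: _ \<Rightarrow>\<^sub>0 'k)" if d: "d \<in> Poly_Mapping.keys (phi ?e) - {c}" for d
  proof -
    have "(class_count (class_word d) c :: 'k) \<noteq> 0" "c \<noteq> d" using d k by (auto simp: in_keys_iff)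
    from class_count_triangular[OF this]
    have "2 ^ class_size d - class_bases d < (2 ^ class_size c - class_bases c :: nat)"
      using bases[of d] by simp
    from less[OF this] show ?thesis by (metis imageE)
  qed
  then obtain g where g: "\<And>d. d \<in> Poly_Mapping.keys (phi ?e) - {c} \<Longrightarrow> phi (g d) = (class_vec d :: _ \<Rightarrow>\<^sub>0 'k)"
    by metis
  have kc: "?k c \<noteq> 0" unfolding k by (rule class_count_self)
  then have "phi ?e = scale (?k c) ?e
      + (\<Sum>d\<in>Poly_Mapping.keys (phi ?e) - {c}. scale (?k d) (class_vec d))"
    using poly_mapping_decomposition[of "phi ?e"]
    by (subst (asm) sum.remove[of _ c]) (auto simp: in_keys_iff)
  also have "\<dots> = scale (?k c) ?e + phi (\<Sum>d\<in>Poly_Mapping.keys (phi ?e) - {c}. scale (?k d) (g d))"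
    by (simp add: phi_sum phi_scale g)
  finally have e: "phi (?e - (\<Sum>d\<in>Poly_Mapping.keys (phi ?e) - {c}. scale (?k d) (g d)))
      = scale (?k c) ?e"
    unfolding phi_diff by (simp only: diff_eq_eq)
  have "phi (scale (1 / ?k c) (?e - (\<Sum>d\<in>Poly_Mapping.keys (phi ?e) - {c}. scale (?k d) (g d)))) = ?e"
    unfolding phi_scale e using kc by (intro poly_mapping_eqI) (simp add: lookup_scale)
  then show ?case by (metis rangeI)
qed

lemma bij_phi: "bij (phi :: ('a matroid_class \<Rightarrow>\<^sub>0 'k::field_char_0) \<Rightarrow> _)"
proof (rule bijI)
  show "inj (phi :: ('a matroid_class \<Rightarrow>\<^sub>0 'k) \<Rightarrow> _)"
    by (rule injI) (metis phi_diff phi_eq_0 right_minus_eq)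
  have "y \<in> range phi" for y :: "'a matroid_class \<Rightarrow>\<^sub>0 'k"
  proof -
    have "phi (inv phi (class_vec b)) = (class_vec b :: _ \<Rightarrow>\<^sub>0 'k)" for b :: "'a matroid_class"
      using class_vec_in_range by (rule f_inv_into_f)
    then have "phi (\<Sum>b\<in>Poly_Mapping.keys y. scale (Poly_Mapping.lookup y b) (inv phi (class_vec b))) = y"
      using poly_mapping_decomposition[of y] by (simp add: phi_sum phi_scale)
    then show ?thesis by (rule range_eqI[OF sym])
  qed
  then show "surj (phi :: ('a matroid_class \<Rightarrow>\<^sub>0 'k) \<Rightarrow> _)" by blast
qed

lemma phi_primitive_vec: "phi (primitive_vec c) = (class_vec c :: _ \<Rightarrow>\<^sub>0 'k::field_char_0)"
  unfolding primitive_vec_def by (rule surj_f_inv_f[OF bij_is_surj[OF bij_phi]])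

section \<open>Primitive elements\<close>

lemma class_count_nil_empty: "class_count [] (abs_matroid_class empty_matroid) = 1"
  by (simp add: class_count_abs)

lemma class_count_empty:
  assumes "w \<noteq> []" "set w \<subseteq> irreducible_classes"
  shows "class_count w (abs_matroid_class empty_matroid) = 0"
  using word_count_empty[OF assms, of empty_matroid] by (simp add: class_count_abs)

lemma pairing_class_coproduct:
  "pairing (\<lambda>(a, b). class_count u a * class_count v b) (class_coproduct c)
    = (class_count (u @ v) c :: 'k::field_char_0)"
proof -
  obtain M where M: "c = abs_matroid_class M" by (rule class_cases)
  show ?thesis
    unfolding M class_coproduct.abs_eq class_count_abs word_count_append of_nat_sum of_nat_mult
      pairing_sum pairing_tensor
    by (simp add: matroid_vec_def class_count_abs)
qed

lemma pairing_coproduct: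
  "pairing (\<lambda>(a, b). class_count u a * class_count v b) (coproduct x)
    = pairing (class_count (u @ v)) (x :: _ \<Rightarrow>\<^sub>0 'k::field_char_0)"
  by (simp add: coproduct_def pairing_linear_extension pairing_class_coproduct)

lemma ex_disjoint_copy:
  fixes M :: "'a::infinite matroid"
  assumes "finite S"
  shows "\<exists>N. isomorphic M N \<and> ground N \<inter> S = {}"
proof -
  have "infinite (UNIV - S)" using assms by (simp add: infinite_UNIV)
  then obtain T where T: "finite T" "card T = card (ground M)" "T \<subseteq> UNIV - S"
    using infinite_arbitrarily_large by metis
  obtain f where f: "bij_betw f (ground M) T"
    using finite_same_card_bij[of "ground M" T] T by auto
  obtain N where N: "is_iso f M N" using ex_is_iso[of f M] f by (auto simp: bij_betw_def)
  then have "ground N = T" using is_isoD(3)[OF N] f by (simp add: bij_betw_def)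
  then show ?thesis using N T(3) unfolding isomorphic_def by blast
qed

text \<open>The infinite label set enters here: each new factor needs a copy disjoint from the
  ground set already used.\<close>

lemma ex_class_word:
  fixes w :: "'a::infinite matroid_class list"
  assumes "set w \<subseteq> irreducible_classes"
  shows "\<exists>c. class_word c = w"
proof -
  have "\<exists>M. factor_word w M" using assms
  proof (induction w)
    case Nil
    have "factor_word [] empty_matroid" by simp
    then show ?case by blast
  next
    case (Cons a w)
    then obtain N where N: "factor_word w N" by auto
    obtain P where P: "a = abs_matroid_class P" "irreducible_matroid P" using Cons.prems by auto
    obtain Q where Q: "isomorphic P Q" "ground Q \<inter> ground N = {}"
      using ex_disjoint_copy[of "ground N" P] by auto
    have "irreducible_matroid Q" using Q(1) P(2) is_iso_irreducible unfolding isomorphic_def by blast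
    moreover have "a = abs_matroid_class Q" using P(1) Q(1) matroid_class.abs_eq_iff by metis
    ultimately show ?case using factor_word_free_product[OF _ N Q(2)] by blast
  qed
  then show ?thesis using class_word_eq_iff by blast
qed

text \<open>Injectivity of the tensor square of \<^const>\<open>phi\<close>, one tensor factor at a time.\<close>

lemma tensor_eq_0:
  fixes t :: "'a matroid_class \<times> 'a matroid_class \<Rightarrow>\<^sub>0 'k::field_char_0"
  assumes "\<And>m n. pairing (\<lambda>(a, b). class_count (class_word m) a * class_count (class_word n) b) t = 0"
  shows "t = 0"
proof (rule poly_mapping_eqI)
  fix p :: "'a matroid_class \<times> 'a matroid_class"
  obtain a b where p: "p = (a, b)" by (cases p)
  \<comment> \<open>Evaluates the second tensor factor at the word of n and keeps the first. All
    coordinates of \<open>phi\<close> of the result vanish by assumption.\<close>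
  define f :: "'a matroid_class \<Rightarrow> 'a matroid_class \<times> 'a matroid_class \<Rightarrow> _ \<Rightarrow>\<^sub>0 'k"
    where "f n = (\<lambda>(a, b). scale (class_count (class_word n) b) (class_vec a))" for n
  have "linear_extension (f n) t = 0" for n
  proof (rule phi_eq_0, rule poly_mapping_eqI)
    fix m
    show "Poly_Mapping.lookup (phi (linear_extension (f n) t)) m = Poly_Mapping.lookup 0 m"
      using assms[of m n]
      by (simp add: lookup_phi pairing_linear_extension f_def pairing_scale case_prod_unfold mult.commute)
  qed
  then have f: "pairing (\<lambda>b. Poly_Mapping.lookup (f n b) a) t = 0" for n
    unfolding lookup_linear_extension[symmetric] by simp
  \<comment> \<open>Keeps the second factors standing next to a. The coordinate of
    \<open>phi\<close> of the result at n is the coefficient of a in the vector obtained from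
    \<open>f n\<close>, which has just been shown to vanish.\<close>
  define g :: "'a matroid_class \<times> 'a matroid_class \<Rightarrow> _ \<Rightarrow>\<^sub>0 'k"
    where "g = (\<lambda>(c, d). scale (if c = a then 1 else 0) (class_vec d))"
  have "linear_extension g t = 0"
  proof (rule phi_eq_0, rule poly_mapping_eqI)
    fix n
    have "(\<lambda>b. Poly_Mapping.lookup (f n b) a) = (\<lambda>b. pairing (class_count (class_word n)) (g b))"
      by (auto simp: f_def g_def pairing_scale lookup_scale class_vec_def lookup_single when_def)
    then show "Poly_Mapping.lookup (phi (linear_extension g t)) n = Poly_Mapping.lookup 0 n"
      using f[of n] by (simp add: lookup_phi pairing_linear_extension)
  qed
  then have "0 = pairing (\<lambda>q. Poly_Mapping.lookup (g q) b) t"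
    unfolding lookup_linear_extension[symmetric] by simp
  also have "(\<lambda>q. Poly_Mapping.lookup (g q) b) = (\<lambda>q. if q = p then 1 else 0)"
    by (auto simp: g_def p lookup_scale class_vec_def lookup_single when_def)
  also have "pairing \<dots> t = (\<Sum>q\<in>Poly_Mapping.keys t. if q = p then Poly_Mapping.lookup t q else 0)"
    unfolding pairing_def by (intro sum.cong) auto
  also have "\<dots> = Poly_Mapping.lookup t p" by (simp add: in_keys_iff)
  finally show "Poly_Mapping.lookup t p = Poly_Mapping.lookup 0 p" by simp
qed

lemma class_word_irreducible:
  assumes "a \<in> irreducible_classes"
  shows "class_word c = [a] \<longleftrightarrow> c = a"
proof -
  obtain M where M: "a = abs_matroid_class M" "irreducible_matroid M" using assms by blast
  have "factor_word [a] M"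
    using M by (auto simp: free_separator_iff Int_absorb2 intro!: exI[of _ "ground M"])
  then have "class_word a = [a]" unfolding M(1) class_word_eq_iff .
  then show ?thesis using inj_class_word by (metis injD)
qed

lemma irreducible_class_word: "c \<in> irreducible_classes \<longleftrightarrow> length (class_word c) = 1"
proof
  assume "length (class_word c) = 1"
  then obtain a where a: "class_word c = [a]" by (cases "class_word c") auto
  then have "a \<in> irreducible_classes" using class_word_letters[of c] by simp
  then show "c \<in> irreducible_classes" using a class_word_irreducible by metis
next
  assume "c \<in> irreducible_classes"
  then have "class_word c = [c]" using class_word_irreducible by metis
  then show "length (class_word c) = 1" by simp
qed

lemma pairing_unit_vec: "pairing g unit_vec = g (abs_matroid_class empty_matroid)"
  by (simp add: unit_vec_def matroid_vec_def)

text \<open>Tested on two words u and v, the primitivity equation relates the functional of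
  \<open>u @ v\<close> to two boundary terms, which vanish unless u or v is empty. It thus
  constrains exactly the empty word and the words that split into two nonempty pieces.\<close>

lemma primitive_iff_keys_phi:
  fixes x :: "'a::infinite matroid_class \<Rightarrow>\<^sub>0 'k::field_char_0"
  shows "x \<in> primitives \<longleftrightarrow> Poly_Mapping.keys (phi x) \<subseteq> irreducible_classes"
proof
  assume "x \<in> primitives"
  then have x: "pairing (class_count (u @ v)) x
      = pairing (class_count u) unit_vec * pairing (class_count v) x
        + pairing (class_count u) x * pairing (class_count v) unit_vec" for u v
    unfolding pairing_coproduct[symmetric] primitives_def mem_Collect_eq
    by (simp add: pairing_add pairing_tensor)
  show "Poly_Mapping.keys (phi x) \<subseteq> irreducible_classes"
  proof (rule subsetI, rule ccontr)
    fix c assume c: "c \<in> Poly_Mapping.keys (phi x)" "c \<notin> irreducible_classes"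
    have letters: "set (class_word c) \<subseteq> irreducible_classes" by (rule class_word_letters)
    have len: "length (class_word c) \<noteq> 1" using c(2) irreducible_class_word by blast
    have "pairing (class_count (class_word c)) x = 0"
    proof (cases "class_word c")
      \<comment> \<open>For two empty words the equation reads p = p + p.\<close>
      case Nil
      then show ?thesis using x[of "[]" "[]"] by (simp add: pairing_unit_vec class_count_nil_empty)
    next
      case (Cons a w)
      then have "w \<noteq> []" using len by auto
      then show ?thesis
        using x[of "[a]" w] letters class_count_empty[of "[a]", where 'b = 'k]
          class_count_empty[of w, where 'b = 'k] Cons
        by (simp add: pairing_unit_vec)
    qed
    then show False using c(1) by (simp add: in_keys_iff lookup_phi)
  qed
next
  assume keys: "Poly_Mapping.keys (phi x) \<subseteq> irreducible_classes"
  let ?p = "\<lambda>c. pairing (class_count (class_word c)) x"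
  have zero: "?p c = 0" if "length (class_word c) \<noteq> 1" for c
    using keys that irreducible_class_word by (metis in_keys_iff lookup_phi subsetD)
  have "coproduct x - (tensor unit_vec x + tensor x unit_vec) = 0"
  proof (rule tensor_eq_0)
    fix m n :: "'a matroid_class"
    let ?u = "class_word m" and ?v = "class_word n"
    let ?e = "abs_matroid_class empty_matroid"
    \<comment> \<open>The hypothesis speaks of coordinates of \<open>phi x\<close>, which are
      indexed by classes; the concatenated word must therefore be the word of an actual
      class.\<close>
    obtain k where k: "class_word k = ?u @ ?v"
      using ex_class_word[of "?u @ ?v"] class_word_letters[of m] class_word_letters[of n] by auto
    have "?p k = class_count ?u ?e * ?p n + ?p m * class_count ?v ?e"
    proof (cases "?u = [] \<or> ?v = []")
      case True
      then consider "?u = []" "?v = []" | "?u = []" "?v \<noteq> []" | "?u \<noteq> []" "?v = []" by blast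
      then show ?thesis
      proof cases
        case 1
        then show ?thesis using zero[of m] zero[of n] zero[of k] k by simp
      next
        case 2
        then show ?thesis using zero[of m] k by (simp add: class_count_nil_empty)
      next
        case 3
        then show ?thesis using zero[of n] k by (simp add: class_count_nil_empty)
      qed
    next
      case False
      then have "length ?u > 0" "length ?v > 0" by simp_all
      then have "length (class_word k) \<noteq> 1" unfolding k length_append by linarith
      moreover have "(class_count ?u ?e :: 'k) = 0" "(class_count ?v ?e :: 'k) = 0"
        using False class_count_empty class_word_letters by blast+
      ultimately show ?thesis using zero[of k] by simp
    qed
    then show "pairing (\<lambda>(a, b). class_count ?u a * class_count ?v b)
        (coproduct x - (tensor unit_vec x + tensor x unit_vec)) = 0"
      by (simp add: pairing_diff pairing_add pairing_coproduct pairing_tensor pairing_unit_vec k)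
  qed
  then show "x \<in> primitives" unfolding primitives_def by simp
qed

text \<open>\<open>phi\<close> carries the family to the unit vectors of the irreducible classes,
  and the primitive elements to the vectors supported on those classes; independence and spanning
  are read off there.\<close>

lemma is_basis_family_primitive_vec:
  "is_basis_family primitive_vec irreducible_classes
    (primitives :: ('a::infinite matroid_class \<Rightarrow>\<^sub>0 'k::field_char_0) set)"
proof -
  interpret vector_space "scale :: 'k \<Rightarrow> ('a matroid_class \<Rightarrow>\<^sub>0 'k) \<Rightarrow> _" by (rule vector_space_scale)
  let ?p = "primitive_vec :: 'a matroid_class \<Rightarrow> _ \<Rightarrow>\<^sub>0 'k"
  have inj: "inj ?p"
  proof (rule injI)
    fix c d assume "?p c = ?p d"
    then have "Poly_Mapping.lookup (class_vec c) c = (Poly_Mapping.lookup (class_vec d) c :: 'k)"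
      using phi_primitive_vec by metis
    then show "c = d" by (simp add: class_vec_def lookup_single when_def split: if_splits)
  qed
  have "independent (?p ` irreducible_classes)"
    unfolding dependent_explicit
  proof (rule notI, elim exE conjE bexE)
    fix S :: "('a matroid_class \<Rightarrow>\<^sub>0 'k) set" and u v
    assume S: "finite S" "S \<subseteq> ?p ` irreducible_classes" "v \<in> S" "u v \<noteq> 0"
      and sum: "(\<Sum>v\<in>S. scale (u v) v) = 0"
    obtain c where c: "v = ?p c" using S by blast
    have "Poly_Mapping.lookup (phi w) c = (if w = v then 1 else 0)" if w: "w \<in> S" for w
    proof -
      obtain d where "w = ?p d" using S(2) w by blast
      then show ?thesis using c injD[OF inj, of d c]
        by (auto simp: phi_primitive_vec class_vec_def lookup_single when_def)
    qed
    then have "(\<Sum>w\<in>S. u w * Poly_Mapping.lookup (phi w) c) = (\<Sum>w\<in>S. if w = v then u w else 0)"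
      by (intro sum.cong) auto
    also have "\<dots> = u v" using S by simp
    finally have "Poly_Mapping.lookup (phi (\<Sum>v\<in>S. scale (u v) v)) c = u v"
      by (simp add: phi_sum phi_scale lookup_sum lookup_scale)
    moreover have "phi 0 = (0 :: 'a matroid_class \<Rightarrow>\<^sub>0 'k)"
      using phi_diff[of 0 "0 :: 'a matroid_class \<Rightarrow>\<^sub>0 'k"] by simp
    ultimately show False using S(4) sum by simp
  qed
  moreover have "span (?p ` irreducible_classes) = primitives"
  proof
    have "x \<in> primitives \<longleftrightarrow> (\<forall>c. c \<notin> irreducible_classes \<longrightarrow> pairing (class_count (class_word c)) x = 0)"
      for x :: "'a matroid_class \<Rightarrow>\<^sub>0 'k"
      unfolding primitive_iff_keys_phi by (auto simp: in_keys_iff lookup_phi)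
    then have "subspace (primitives :: ('a matroid_class \<Rightarrow>\<^sub>0 'k) set)"
      by (simp add: subspace_def pairing_add pairing_scale)
    moreover have "?p c \<in> primitives" if "c \<in> irreducible_classes" for c
      using that by (simp add: primitive_iff_keys_phi phi_primitive_vec class_vec_def)
    ultimately show "span (?p ` irreducible_classes) \<subseteq> primitives"
      by (intro span_minimal) auto
  next
    show "primitives \<subseteq> span (?p ` irreducible_classes)"
    proof
      fix x :: "'a matroid_class \<Rightarrow>\<^sub>0 'k" assume x: "x \<in> primitives"
      let ?k = "Poly_Mapping.keys (phi x)"
      have "phi (\<Sum>c\<in>?k. scale (Poly_Mapping.lookup (phi x) c) (?p c)) = phi x"
        using poly_mapping_decomposition[of "phi x"] by (simp add: phi_sum phi_scale phi_primitive_vec)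
      then have "x = (\<Sum>c\<in>?k. scale (Poly_Mapping.lookup (phi x) c) (?p c))"
        using bij_is_inj[OF bij_phi] by (metis injD)
      also have "\<dots> \<in> span (?p ` irreducible_classes)"
        using x[unfolded primitive_iff_keys_phi]
        by (intro span_sum span_scale span_base) auto
      finally show "x \<in> span (?p ` irreducible_classes)" .
    qed
  qed
  ultimately show ?thesis
    unfolding is_basis_family_def using inj_on_subset[OF inj] by blast
qed

section \<open>The Moebius function\<close>

lemma reducible_above_ground: "N \<in> reducible_above M \<Longrightarrow> ground N = ground M"
  by (auto simp: reducible_above_def weak_le_def)

lemma moebius_refl: "moebius (reducible_order M) M M = 1"
proof -
  have "(M, M) \<in> reducible_order M"
    by (simp add: reducible_order_def reducible_above_def weak_le_refl)
  then show ?thesis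
    by (simp add: moebius.simps finite_reducible_order Partial_order_reducible_order)
qed

text \<open>M is the least element of the poset, so the interval from M to z consists of all
  elements below z.\<close>

lemma sum_moebius:
  assumes z: "z \<in> reducible_above M" "z \<noteq> M"
  shows "(\<Sum>y | y \<in> reducible_above M \<and> weak_le y z. moebius (reducible_order M) M y) = 0"
proof -
  let ?r = "reducible_order M" and ?R = "reducible_above M"
  have le: "weak_le M y" if "y \<in> ?R" for y
    using that weak_le_refl by (auto simp: reducible_above_def)
  have M: "M \<in> ?R" by (simp add: reducible_above_def)
  have r: "(M, z) \<in> ?r" using z M le by (simp add: reducible_order_def)
  have eq: "{y. (M, y) \<in> ?r \<and> (y, z) \<in> ?r \<and> y \<noteq> z} = {y. y \<in> ?R \<and> weak_le y z} - {z}"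
    using z M le by (auto simp: reducible_order_def)
  have "moebius ?r M z = - (\<Sum>y\<in>{y. y \<in> ?R \<and> weak_le y z} - {z}. moebius ?r M y)"
    using r z(2)
    by (subst moebius.simps) (simp add: eq finite_reducible_order Partial_order_reducible_order)
  moreover have "finite {y. y \<in> ?R \<and> weak_le y z}"
    by (rule finite_subset[OF _ finite_reducible_above[of M]]) blast
  then have "(\<Sum>y | y \<in> ?R \<and> weak_le y z. moebius ?r M y)
      = moebius ?r M z + (\<Sum>y\<in>{y. y \<in> ?R \<and> weak_le y z} - {z}. moebius ?r M y)"
    using z weak_le_refl by (intro sum.remove) auto
  ultimately show ?thesis by simp
qed

text \<open>Separation along a proper set is a closure operator on the poset that moves its least
  element, so the Moebius function sums to zero over each of its fibres.\<close>

lemma sum_moebius_separation: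
  assumes M: "irreducible_matroid M" and A: "A \<subseteq> ground M" "A \<noteq> {}" "A \<noteq> ground M"
  shows "(\<Sum>N | N \<in> reducible_above M \<and> separation A N = z. moebius (reducible_order M) M N) = 0"
proof (induction "num_bases z" arbitrary: z rule: less_induct)
  case less
  let ?R = "reducible_above M" and ?f = "separation A" and ?mu = "moebius (reducible_order M) M"
  show ?case
  proof (cases "\<exists>N. N \<in> ?R \<and> ?f N = z")
    case False
    then have "{N. N \<in> ?R \<and> ?f N = z} = {}" by blast
    then show ?thesis by (simp only: sum.empty)
  next
    case True
    then obtain N where N: "N \<in> ?R" "?f N = z" by blast
    have sub: "A \<subseteq> ground N" if "N \<in> ?R" for N using A(1) reducible_above_ground[OF that] by simp
    have ge: "weak_le N (?f N)" if "N \<in> ?R" for N using sub[OF that] by (rule separation_weak_ge)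
    have Ag: "A \<noteq> ground z" "A \<subseteq> ground z"
      using A reducible_above_ground[OF N(1)] ground_separation[OF sub[OF N(1)]] N(2) by auto
    have fz: "?f z = z" using separation_idem[OF sub[OF N(1)]] N(2) by simp
    then have "free_separator z A" using Ag by (simp add: free_separator_def)
    \<comment> \<open>Reducibility is used twice: it puts z into the poset, and it keeps z apart
      from the irreducible M, so that the defining recursion applies at z.\<close>
    then have red: "\<not> irreducible_matroid z" using A(2) Ag unfolding irreducible_iff by blast
    then have zM: "z \<noteq> M" using M by blast
    have "weak_le M N" using N(1) weak_le_refl by (auto simp: reducible_above_def)
    then have "weak_le M z" using ge[OF N(1)] N(2) weak_le_trans by blast
    then have zR: "z \<in> ?R" using red by (simp add: reducible_above_def reducible_matroid_def)
    let ?S = "{N. N \<in> ?R \<and> weak_le N z}"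
    have finS: "finite ?S" by (rule finite_subset[OF _ finite_reducible_above[of M]]) blast
    have fle: "weak_le (?f N) z" if "N \<in> ?S" for N
      using that separation_mono[OF sub, of N z] fz by simp
    \<comment> \<open>N lies below its separation y, hence below z as well; so the fibre over y is
      contained in \<open>?S\<close> entirely, and the induction hypothesis can be applied to
      it.\<close>
    have fibre: "{N. N \<in> ?S \<and> ?f N = y} = {N. N \<in> ?R \<and> ?f N = y}" if "weak_le y z" for y
      using that ge weak_le_trans by blast
    have "0 = (\<Sum>N\<in>?S. ?mu N)" using sum_moebius[OF zR zM] by simp
    also have "\<dots> = (\<Sum>y\<in>?f ` ?S. \<Sum>N | N \<in> ?S \<and> ?f N = y. ?mu N)"
      using finS by (rule sum.image_gen)
    also have "\<dots> = (\<Sum>y\<in>?f ` ?S. if y = z then \<Sum>N | N \<in> ?R \<and> ?f N = z. ?mu N else 0)"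
    proof (rule sum.cong)
      fix y assume "y \<in> ?f ` ?S"
      then have yz: "weak_le y z" using fle by blast
      show "(\<Sum>N | N \<in> ?S \<and> ?f N = y. ?mu N) = (if y = z then \<Sum>N | N \<in> ?R \<and> ?f N = z. ?mu N else 0)"
        using fibre[OF yz] less[of y] weak_le_num_bases[OF yz] by (cases "y = z") simp_all
    qed simp
    also have "\<dots> = (\<Sum>N | N \<in> ?R \<and> ?f N = z. ?mu N)"
    proof -
      have "z \<in> ?S" using zR weak_le_refl by blast
      then have "z \<in> ?f ` ?S" using fz by (metis imageI)
      then show ?thesis using finS by simp
    qed
    finally show ?thesis by simp
  qed
qed

text \<open>The function is constant on the fibres of \<open>separation A\<close>, and over each
  fibre the Moebius values sum to zero.\<close>

lemma sum_moebius_separation_function: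
  fixes F :: "'a matroid \<Rightarrow> 'k::comm_ring_1"
  assumes "irreducible_matroid M" "A \<subseteq> ground M" "A \<noteq> {}" "A \<noteq> ground M"
    and F: "\<And>N. N \<in> reducible_above M \<Longrightarrow> F (separation A N) = F N"
  shows "(\<Sum>N\<in>reducible_above M. of_int (moebius (reducible_order M) M N) * F N) = 0"
proof -
  let ?R = "reducible_above M" and ?f = "separation A"
  let ?mu = "\<lambda>N. of_int (moebius (reducible_order M) M N) :: 'k"
  have "(\<Sum>N\<in>?R. ?mu N * F N) = (\<Sum>y\<in>?f ` ?R. \<Sum>N | N \<in> ?R \<and> ?f N = y. ?mu N * F N)"
    by (rule sum.image_gen) (rule finite_reducible_above)
  also have "\<dots> = (\<Sum>y\<in>?f ` ?R. of_int (\<Sum>N | N \<in> ?R \<and> ?f N = y. moebius (reducible_order M) M N) * F y)"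
    unfolding of_int_sum sum_distrib_right by (intro sum.cong refl) (use F in auto)
  also have "\<dots> = 0" using sum_moebius_separation[OF assms(1-4)] by simp
  finally show ?thesis .
qed

text \<open>Once the proper nonempty sets have cancelled, the empty set contributes nothing because
  the first letter is irreducible. The ground set requires N itself to be irreducible, which in this
  poset leaves N = M with Moebius value 1.\<close>

lemma phi_moebius_sum:
  fixes M :: "'a matroid"
  assumes M: "irreducible_matroid M"
  shows "phi (\<Sum>N\<in>reducible_above M. scale (of_int (moebius (reducible_order M) M N)) (matroid_vec N))
    = (class_vec (abs_matroid_class M) :: 'a matroid_class \<Rightarrow>\<^sub>0 'k::field_char_0)"
proof (rule poly_mapping_eqI)
  fix n :: "'a matroid_class"
  let ?R = "reducible_above M" and ?mu = "\<lambda>N. of_int (moebius (reducible_order M) M N) :: 'k"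
  let ?w = "class_word n"
  have "Poly_Mapping.lookup (phi (\<Sum>N\<in>?R. scale (?mu N) (matroid_vec N))) n
      = (\<Sum>N\<in>?R. ?mu N * of_nat (word_count ?w N))"
    by (simp add: lookup_phi pairing_sum pairing_scale matroid_vec_def class_count_abs)
  also have "\<dots> = Poly_Mapping.lookup (class_vec (abs_matroid_class M)) n"
  proof (cases ?w)
    case Nil
    have "n \<noteq> abs_matroid_class M"
      using M irreducible_class_word[of n] Nil by auto
    moreover have "word_count ?w N = 0" if "N \<in> ?R" for N
      using irreducible_nonempty[OF M] reducible_above_ground[OF that] Nil by simp
    ultimately show ?thesis by (simp add: class_vec_def lookup_single)
  next
    case (Cons a v)
    have letters: "a \<in> irreducible_classes" "set v \<subseteq> irreducible_classes"
      using class_word_letters[of n] Cons by auto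
    have not_empty: "abs_matroid_class (mrestrict N {}) \<noteq> a" for N
      using letters(1) irreducible_class_iff[of "mrestrict N {}"]
        irreducible_nonempty[of "mrestrict N {}"] by auto
    let ?G = "\<lambda>A N. if abs_matroid_class (mrestrict N A) = a then word_count v (mcontract N A) else 0"
    have count: "word_count ?w N = (\<Sum>A\<in>Pow (ground M). ?G A N)" if "N \<in> ?R" for N
      using reducible_above_ground[OF that] Cons by simp
    have "(\<Sum>N\<in>?R. ?mu N * of_nat (word_count ?w N))
        = (\<Sum>N\<in>?R. \<Sum>A\<in>Pow (ground M). ?mu N * of_nat (?G A N))"
      by (simp add: count sum_distrib_left del: word_count.simps)
    also have "\<dots> = (\<Sum>A\<in>Pow (ground M). \<Sum>N\<in>?R. ?mu N * of_nat (?G A N))"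
      by (rule sum.swap)
    also have "\<dots> = (\<Sum>A\<in>Pow (ground M). if A = ground M then \<Sum>N\<in>?R. ?mu N * of_nat (?G (ground M) N) else 0)"
    proof (rule sum.cong)
      fix A assume A: "A \<in> Pow (ground M)"
      show "(\<Sum>N\<in>?R. ?mu N * of_nat (?G A N))
          = (if A = ground M then \<Sum>N\<in>?R. ?mu N * of_nat (?G (ground M) N) else 0)"
      proof (cases "A = {} \<or> A = ground M")
        case True
        then show ?thesis using not_empty irreducible_nonempty[OF M] by auto
      next
        case False
        have "?G A (separation A N) = ?G A N" if "N \<in> ?R" for N
        proof -
          have "A \<subseteq> ground N" using A reducible_above_ground[OF that] by simp
          then show ?thesis by (simp add: mrestrict_separation mcontract_separation)
        qed
        then have G: "of_nat (?G A (separation A N)) = (of_nat (?G A N) :: 'k)" if "N \<in> ?R" for N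
          using that by presburger
        have "A \<subseteq> ground M" "A \<noteq> {}" "A \<noteq> ground M" using A False by simp_all
        from sum_moebius_separation_function[OF M this, of "\<lambda>N. of_nat (?G A N)", OF G]
        have "(\<Sum>N\<in>?R. ?mu N * of_nat (?G A N)) = 0" .
        then show ?thesis using False by simp
      qed
    qed simp
    also have "\<dots> = (\<Sum>N\<in>?R. ?mu N * of_nat (?G (ground M) N))" by simp
    also have "\<dots> = (\<Sum>N\<in>?R. if N = M then (if abs_matroid_class M = n then 1 else 0) else 0)"
    proof (rule sum.cong)
      fix N assume N: "N \<in> ?R"
      have G: "?G (ground M) N = (if abs_matroid_class N = a then word_count v (mcontract N (ground N)) else 0)"
        using reducible_above_ground[OF N] mrestrict_ground[of N] by simp
      show "?mu N * of_nat (?G (ground M) N) = (if N = M then (if abs_matroid_class M = n then 1 else 0) else 0)"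
      proof (cases "N = M")
        case False
        then have "\<not> irreducible_matroid N"
          using N by (auto simp: reducible_above_def reducible_matroid_def)
        then have "abs_matroid_class N \<noteq> a" using letters(1) irreducible_class_iff by metis
        then show ?thesis using G False by simp
      next
        case True
        show ?thesis
        proof (cases "v = []")
          case v: True
          then have "n = a" using Cons letters(1) class_word_irreducible by metis
          then show ?thesis unfolding G using True v by (simp add: moebius_refl)
        next
          case False
          then have "length ?w \<noteq> 1" using Cons by simp
          then have "n \<noteq> abs_matroid_class M" using irreducible_class_word[of n] M by auto
          \<comment> \<open>The first letter has used up the whole ground set, so no further
            irreducible letter can follow.\<close>
          moreover have "word_count v (mcontract N (ground N)) = 0"
            using False letters(2) by (rule word_count_empty) simp
          ultimately show ?thesis unfolding G using True by auto
        qed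
      qed
    qed simp
    also have "\<dots> = (if abs_matroid_class M = n then 1 else 0)"
    proof -
      have "M \<in> ?R" by (simp add: reducible_above_def)
      then show ?thesis using finite_reducible_above[of M] by simp
    qed
    finally show ?thesis by (simp add: class_vec_def lookup_single when_def)
  qed
  finally show "Poly_Mapping.lookup (phi (\<Sum>N\<in>?R. scale (?mu N) (matroid_vec N))) n
      = Poly_Mapping.lookup (class_vec (abs_matroid_class M)) n" .
qed

theorem theorem7:
  shows "is_basis_family primitive_vec (abs_matroid_class ` {M. irreducible_matroid M})
           (primitives :: ('a::infinite matroid_class \<Rightarrow>\<^sub>0 'k::field_char_0) set)
       \<and> (\<forall>M :: 'a matroid. irreducible_matroid M \<longrightarrow>
            (primitive_vec (abs_matroid_class M) :: 'a matroid_class \<Rightarrow>\<^sub>0 'k)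
              = (\<Sum>N\<in>reducible_above M.
                   scale (of_int (moebius (reducible_order M) M N)) (matroid_vec N)))"
proof (intro conjI allI impI)
  fix M :: "'a matroid" assume "irreducible_matroid M"
  then have "phi (primitive_vec (abs_matroid_class M) :: _ \<Rightarrow>\<^sub>0 'k)
      = phi (\<Sum>N\<in>reducible_above M. scale (of_int (moebius (reducible_order M) M N)) (matroid_vec N))"
    by (simp only: phi_primitive_vec phi_moebius_sum)
  then show "(primitive_vec (abs_matroid_class M) :: _ \<Rightarrow>\<^sub>0 'k)
      = (\<Sum>N\<in>reducible_above M. scale (of_int (moebius (reducible_order M) M N)) (matroid_vec N))"
    by (rule injD[OF bij_is_inj[OF bij_phi]])
qed (rule is_basis_family_primitive_vec)

end
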